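(* Let $(M,\pi)$ be a Poisson manifold such that $$\big(f\,d\{g,h\}-\{g,h\}\,df\big)+\big(g\,d\{h,f\}-\{h,f\}\,dg\big)+\big(h\,d\{f,g\}-\{f,g\}\,dh\big)\in\delta\Omega^2(M)\quad\text{for all } f,g,h\in C^\infty(M).$$ Then there exists an $L_\infty$-algebra $(L,(l_k)_{k\geq 1})$ with underlying graded vector space $L_{-i}=\Omega^{i+1}(M)$ for $i\ge0$ (and $L_i=0$ for $i>0$), differential $l_1=\delta$ (with $l_1=0$ on $L_0=\Omega^1(M)$), and with binary bracket given on $\alpha,\beta\in L_0=\Omega^1(M)$ by $$l_2(\alpha,\beta)=\tfrac12\big(\delta\alpha\cdot d\delta\beta-\delta\beta\cdot d\delta\alpha\big).$$ Moreover, it is possible to choose it such that $l_k=0$ for all $k>3$ (resulting in a Lie 2-algebra).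
   Context: For a Poisson manifold $(M,\pi)$, the Poisson bracket is $\{f,g\}=\iota_\pi(df\wedge dg)$, and the Koszul differential on $\Omega^\bullet(M)$ is $\delta=\iota_\pi d-d\iota_\pi$; it lowers form degree by one, satisfies $\delta^2=0$ and $\delta(f\,dg)=\{f,g\}$. An $L_\infty$-algebra is a $\mathbb Z$-graded vector space $L$ with graded skew-symmetric multilinear maps $l_k:\bigwedge^kL\to L$ of degree $2-k$ ($k\ge1$) such that for all $n\ge1$ and homogeneous $x_1,\dots,x_n$ $$\sum_{i+j=n+1}(-1)^{i(j+1)}\sum_{\sigma\in \mathrm{ush}(i,n-i)}\mathrm{sgn}(\sigma)\,\epsilon(\sigma;x_1,\dots,x_n)\,l_j(l_i(x_{\sigma(1)},\dots,x_{\sigma(i)}),x_{\sigma(i+1)},\dots,x_{\sigma(n)})=0,$$ where $\epsilon$ is the Koszul sign and $\mathrm{ush}(i,n-i)\subset S_n$ is the set of $(i,n-i)$-unshuffles. The phrase "Lie 2-algebra" here only refers to the property $l_k=0$ for all $k>3$. *)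

theory Defs
  imports
    "HOL-Analysis.Analysis"
    "HOL-Combinatorics.Permutations"
    "HOL-Library.Function_Algebras"
begin

instantiation "fun" :: (type, real_vector) real_vector
begin

definition "c *\<^sub>R f = (\<lambda>x. c *\<^sub>R f x)"

instance
  by standard (simp_all add: scaleR_fun_def fun_eq_iff scaleR_add_right scaleR_add_left)

end


section \<open>Smooth manifolds\<close>

text \<open>
  The model space is \<open>Euclidean_space n\<close>, the sequences that vanish from index \<open>n\<close> on, so that
  \<open>n\<close> is an ordinary natural number and \<open>n = 0\<close> is allowed.
\<close>

definition pdiff :: "nat \<Rightarrow> ((nat \<Rightarrow> real) \<Rightarrow> real) \<Rightarrow> (nat \<Rightarrow> real) \<Rightarrow> real" where
  "pdiff i f x = deriv (\<lambda>t. f (x(i := t))) (x i)"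

text \<open>\<open>Ck_on n k W f\<close> and \<open>smooth_on n W f\<close> are meant for relatively open subsets \<open>W\<close> of the model space.\<close>

primrec Ck_on :: "nat \<Rightarrow> nat \<Rightarrow> (nat \<Rightarrow> real) set \<Rightarrow> ((nat \<Rightarrow> real) \<Rightarrow> real) \<Rightarrow> bool" where
  "Ck_on n 0 W f \<longleftrightarrow> continuous_on W f"
| "Ck_on n (Suc k) W f \<longleftrightarrow> continuous_on W f \<and>
     (\<forall>i<n. (\<forall>x\<in>W. (\<lambda>t. f (x(i := t))) differentiable (at (x i))) \<and> Ck_on n k W (pdiff i f))"

definition smooth_on :: "nat \<Rightarrow> (nat \<Rightarrow> real) set \<Rightarrow> ((nat \<Rightarrow> real) \<Rightarrow> real) \<Rightarrow> bool" where
  "smooth_on n W f \<longleftrightarrow> (\<forall>k. Ck_on n k W f)"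

type_synonym 'a atlas = "('a set \<times> ('a \<Rightarrow> nat \<Rightarrow> real)) set"

definition chart :: "nat \<Rightarrow> 'a::topological_space set \<Rightarrow> ('a \<Rightarrow> nat \<Rightarrow> real) \<Rightarrow> bool" where
  "chart n U \<phi> \<longleftrightarrow> open U \<and> openin (Euclidean_space n) (\<phi> ` U) \<and>
     homeomorphic_map (top_of_set U) (subtopology (Euclidean_space n) (\<phi> ` U)) \<phi>"

text \<open>The points of the manifold are all elements of the type \<open>'a\<close>, with its topology.\<close>

definition smooth_manifold ::
    "nat \<Rightarrow> 'a::{t2_space, second_countable_topology} atlas \<Rightarrow> bool" where
  "smooth_manifold n \<A> \<longleftrightarrow>
     (\<forall>(U, \<phi>)\<in>\<A>. chart n U \<phi>) \<and>
     (\<forall>p. \<exists>(U, \<phi>)\<in>\<A>. p \<in> U) \<and>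
     (\<forall>(U, \<phi>)\<in>\<A>. \<forall>(V, \<psi>)\<in>\<A>. \<forall>i<n. smooth_on n (\<phi> ` (U \<inter> V)) (\<lambda>x. \<psi> (inv_into U \<phi> x) i))"

definition smooth_functions :: "nat \<Rightarrow> 'a atlas \<Rightarrow> ('a \<Rightarrow> real) set" where
  "smooth_functions n \<A> =
     {f. \<forall>(U, \<phi>)\<in>\<A>. smooth_on n (\<phi> ` U) (\<lambda>x. f (inv_into U \<phi> x))}"


section \<open>Vector fields and differential forms\<close>

text \<open>
  Below, \<open>C\<close> stands for the algebra of smooth functions of the manifold. Vector fields are the
  derivations of \<open>C\<close>, and \<open>k\<close>-forms are the alternating \<open>C\<close>-multilinear maps from \<open>k\<close>-tuples of
  vector fields to \<open>C\<close>. As the function types are larger than the intended domains, vector fields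
  are \<open>0\<close> outside \<open>C\<close>, and a \<open>k\<close>-form is \<open>0\<close> on lists that are not \<open>k\<close>-tuples of vector fields.
  Forms of all degrees thus live in one real vector space, where those of different degrees are
  independent; a function \<open>f\<close> is the \<open>0\<close>-form with value \<open>f\<close> on \<open>[]\<close>.
\<close>

type_synonym 'a vfield = "('a \<Rightarrow> real) \<Rightarrow> 'a \<Rightarrow> real"
type_synonym 'a form = "'a vfield list \<Rightarrow> 'a \<Rightarrow> real"

definition vector_fields :: "('a \<Rightarrow> real) set \<Rightarrow> 'a vfield set" where
  "vector_fields C = {X.
     (\<forall>f. f \<notin> C \<longrightarrow> X f = 0) \<and>
     (\<forall>f\<in>C. X f \<in> C) \<and>
     (\<forall>f\<in>C. \<forall>g\<in>C. X (f + g) = X f + X g) \<and>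
     (\<forall>c. \<forall>f\<in>C. X (c *\<^sub>R f) = c *\<^sub>R X f) \<and>
     (\<forall>f\<in>C. \<forall>g\<in>C. X (f * g) = X f * g + f * X g)}"

definition lie_bracket :: "'a vfield \<Rightarrow> 'a vfield \<Rightarrow> 'a vfield" where
  "lie_bracket X Y = (\<lambda>f. X (Y f) - Y (X f))"

definition forms :: "('a \<Rightarrow> real) set \<Rightarrow> nat \<Rightarrow> 'a form set" where
  "forms C k = {\<omega>.
     (\<forall>Xs. \<not> (length Xs = k \<and> set Xs \<subseteq> vector_fields C) \<longrightarrow> \<omega> Xs = 0) \<and>
     (\<forall>Xs. length Xs = k \<longrightarrow> set Xs \<subseteq> vector_fields C \<longrightarrow> \<omega> Xs \<in> C) \<and>
     (\<forall>Xs Ys. \<forall>X\<in>vector_fields C. \<forall>Y\<in>vector_fields C.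
        length Xs + 1 + length Ys = k \<longrightarrow> set Xs \<union> set Ys \<subseteq> vector_fields C \<longrightarrow>
        \<omega> (Xs @ (X + Y) # Ys) = \<omega> (Xs @ X # Ys) + \<omega> (Xs @ Y # Ys)) \<and>
     (\<forall>Xs Ys. \<forall>X\<in>vector_fields C. \<forall>f\<in>C.
        length Xs + 1 + length Ys = k \<longrightarrow> set Xs \<union> set Ys \<subseteq> vector_fields C \<longrightarrow>
        \<omega> (Xs @ (\<lambda>g. f * X g) # Ys) = f * \<omega> (Xs @ X # Ys)) \<and>
     (\<forall>Xs. \<not> distinct Xs \<longrightarrow> \<omega> Xs = 0)}"

definition of_fun :: "('a \<Rightarrow> real) \<Rightarrow> 'a form" where
  "of_fun f = (\<lambda>Xs. if Xs = [] then f else 0)"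

definition fscale :: "('a \<Rightarrow> real) \<Rightarrow> 'a form \<Rightarrow> 'a form" where
  "fscale f \<omega> = (\<lambda>Xs. f * \<omega> Xs)"

text \<open>Wedge product of two \<open>1\<close>-forms.\<close>

definition wedge1 :: "'a form \<Rightarrow> 'a form \<Rightarrow> 'a form" where
  "wedge1 \<alpha> \<beta> = (\<lambda>Xs. if length Xs = 2
     then \<alpha> [Xs ! 0] * \<beta> [Xs ! 1] - \<alpha> [Xs ! 1] * \<beta> [Xs ! 0] else 0)"

definition omit :: "nat \<Rightarrow> 'b list \<Rightarrow> 'b list" where
  "omit i xs = take i xs @ drop (Suc i) xs"

text \<open>The exterior derivative, by the coordinate-free formula.\<close>

definition ext_deriv :: "('a \<Rightarrow> real) set \<Rightarrow> 'a form \<Rightarrow> 'a form" where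
  "ext_deriv C \<omega> = (\<lambda>Xs. if set Xs \<subseteq> vector_fields C then
     (\<Sum>i<length Xs. (- 1) ^ i *\<^sub>R (Xs ! i) (\<omega> (omit i Xs))) +
     (\<Sum>j<length Xs. \<Sum>i<j.
        (- 1) ^ (i + j) *\<^sub>R \<omega> (lie_bracket (Xs ! i) (Xs ! j) # omit i (omit j Xs)))
     else 0)"


section \<open>Poisson manifolds\<close>

text \<open>
  A bivector field is an alternating \<open>C\<close>-bilinear map on \<open>1\<close>-forms; only its values on \<open>1\<close>-forms
  matter. At each point \<open>p\<close> it is a finite sum of bivectors \<open>A\<^sub>p \<and> B\<^sub>p\<close> with vector fields \<open>A\<close>, \<open>B\<close>
  (on a manifold, every tangent vector extends to a vector field), and the interior product is
  given pointwise by \<open>\<iota>\<^bsub>A \<and> B\<^esub> \<omega> = \<omega> (A, B, \<dots>)\<close>; the result does not depend on the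
  decomposition.
\<close>

definition bivector_field :: "('a \<Rightarrow> real) set \<Rightarrow> ('a form \<Rightarrow> 'a form \<Rightarrow> 'a \<Rightarrow> real) \<Rightarrow> bool" where
  "bivector_field C \<pi> \<longleftrightarrow>
     (\<forall>\<alpha>\<in>forms C 1. \<forall>\<beta>\<in>forms C 1. \<pi> \<alpha> \<beta> \<in> C) \<and>
     (\<forall>\<alpha>\<in>forms C 1. \<pi> \<alpha> \<alpha> = 0) \<and>
     (\<forall>\<alpha>\<in>forms C 1. \<forall>\<beta>\<in>forms C 1. \<forall>\<gamma>\<in>forms C 1.
        \<pi> (\<alpha> + \<beta>) \<gamma> = \<pi> \<alpha> \<gamma> + \<pi> \<beta> \<gamma> \<and> \<pi> \<gamma> (\<alpha> + \<beta>) = \<pi> \<gamma> \<alpha> + \<pi> \<gamma> \<beta>) \<and>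
     (\<forall>f\<in>C. \<forall>\<alpha>\<in>forms C 1. \<forall>\<beta>\<in>forms C 1.
        \<pi> (fscale f \<alpha>) \<beta> = f * \<pi> \<alpha> \<beta> \<and> \<pi> \<alpha> (fscale f \<beta>) = f * \<pi> \<alpha> \<beta>)"

definition decomposes_at ::
    "('a \<Rightarrow> real) set \<Rightarrow> ('a form \<Rightarrow> 'a form \<Rightarrow> 'a \<Rightarrow> real) \<Rightarrow> 'a \<Rightarrow> ('a vfield \<times> 'a vfield) list \<Rightarrow> bool"
  where
  "decomposes_at C \<pi> p ABs \<longleftrightarrow> set ABs \<subseteq> vector_fields C \<times> vector_fields C \<and>
     (\<forall>\<alpha>\<in>forms C 1. \<forall>\<beta>\<in>forms C 1.
        \<pi> \<alpha> \<beta> p = (\<Sum>(A, B)\<leftarrow>ABs. \<alpha> [A] p * \<beta> [B] p - \<alpha> [B] p * \<beta> [A] p))"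

definition interior_prod ::
    "('a \<Rightarrow> real) set \<Rightarrow> ('a form \<Rightarrow> 'a form \<Rightarrow> 'a \<Rightarrow> real) \<Rightarrow> 'a form \<Rightarrow> 'a form" where
  "interior_prod C \<pi> \<omega> = (\<lambda>Xs p.
     \<Sum>(A, B)\<leftarrow>(SOME ABs. decomposes_at C \<pi> p ABs). \<omega> (A # B # Xs) p)"

definition poisson_bracket ::
    "('a \<Rightarrow> real) set \<Rightarrow> ('a form \<Rightarrow> 'a form \<Rightarrow> 'a \<Rightarrow> real) \<Rightarrow> ('a \<Rightarrow> real) \<Rightarrow> ('a \<Rightarrow> real) \<Rightarrow> 'a \<Rightarrow> real"
  where
  "poisson_bracket C \<pi> f g =
     interior_prod C \<pi> (wedge1 (ext_deriv C (of_fun f)) (ext_deriv C (of_fun g))) []"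

definition poisson_manifold ::
    "nat \<Rightarrow> 'a::{t2_space, second_countable_topology} atlas \<Rightarrow> ('a form \<Rightarrow> 'a form \<Rightarrow> 'a \<Rightarrow> real) \<Rightarrow> bool"
  where
  "poisson_manifold n \<A> \<pi> \<longleftrightarrow> smooth_manifold n \<A> \<and>
     (let C = smooth_functions n \<A>; br = poisson_bracket C \<pi> in
        bivector_field C \<pi> \<and>
        (\<forall>f\<in>C. \<forall>g\<in>C. \<forall>h\<in>C. br f (br g h) + br g (br h f) + br h (br f g) = 0))"

definition koszul_diff ::
    "('a \<Rightarrow> real) set \<Rightarrow> ('a form \<Rightarrow> 'a form \<Rightarrow> 'a \<Rightarrow> real) \<Rightarrow> 'a form \<Rightarrow> 'a form" where
  "koszul_diff C \<pi> \<omega> =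
     interior_prod C \<pi> (ext_deriv C \<omega>) - ext_deriv C (interior_prod C \<pi> \<omega>)"


section \<open>\<open>L\<^sub>\<infinity>\<close>-algebras\<close>

definition graded_space :: "(int \<Rightarrow> 'v::real_vector set) \<Rightarrow> bool" where
  "graded_space V \<longleftrightarrow> (\<forall>d. subspace (V d)) \<and> (\<forall>d. V d \<inter> span (\<Union>e\<in>- {d}. V e) = {0})"

definition total_space :: "(int \<Rightarrow> 'v::real_vector set) \<Rightarrow> 'v set" where
  "total_space V = span (\<Union>d. V d)"

text \<open>Permutations act on the positions \<open>{..<n}\<close>, i.e. indices start at \<open>0\<close>.\<close>

definition permute_args :: "(nat \<Rightarrow> nat) \<Rightarrow> 'v list \<Rightarrow> 'v list" where
  "permute_args \<sigma> xs = map (\<lambda>r. xs ! \<sigma> r) [0..<length xs]"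

definition koszul_sign :: "(nat \<Rightarrow> nat) \<Rightarrow> int list \<Rightarrow> real" where
  "koszul_sign \<sigma> ds =
     (\<Prod>(r, s)\<in>{(r, s). r < s \<and> s < length ds \<and> \<sigma> r > \<sigma> s}. (- 1) powi (ds ! \<sigma> r * ds ! \<sigma> s))"

definition unshuffles :: "nat \<Rightarrow> nat \<Rightarrow> (nat \<Rightarrow> nat) set" where
  "unshuffles i m = {\<sigma>. \<sigma> permutes {..<i + m} \<and>
     strict_mono_on {..<i} \<sigma> \<and> strict_mono_on {i..<i + m} \<sigma>}"

text \<open>\<open>l k xs\<close> is the value of \<open>l\<^sub>k\<close> on the \<open>k\<close>-tuple \<open>xs\<close>; other values of \<open>l\<close> are irrelevant.\<close>

definition L_infinity_algebra ::
    "(int \<Rightarrow> 'v::real_vector set) \<Rightarrow> (nat \<Rightarrow> 'v list \<Rightarrow> 'v) \<Rightarrow> bool" where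
  "L_infinity_algebra V l \<longleftrightarrow> graded_space V \<and>
     (\<forall>k\<ge>1.
        (\<forall>xs ys. \<forall>x\<in>total_space V. \<forall>y\<in>total_space V. \<forall>a b.
           length xs + 1 + length ys = k \<longrightarrow> set xs \<union> set ys \<subseteq> total_space V \<longrightarrow>
           l k (xs @ (a *\<^sub>R x + b *\<^sub>R y) # ys) = a *\<^sub>R l k (xs @ x # ys) + b *\<^sub>R l k (xs @ y # ys)) \<and>
        (\<forall>xs ds. length xs = k \<longrightarrow> list_all2 (\<lambda>x d. x \<in> V d) xs ds \<longrightarrow>
           l k xs \<in> V (sum_list ds + 2 - int k) \<and>
           (\<forall>\<sigma>. \<sigma> permutes {..<k} \<longrightarrow>
              l k (permute_args \<sigma> xs) = (of_int (sign \<sigma>) * koszul_sign \<sigma> ds) *\<^sub>R l k xs))) \<and>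
     (\<forall>n\<ge>1. \<forall>xs ds. length xs = n \<longrightarrow> list_all2 (\<lambda>x d. x \<in> V d) xs ds \<longrightarrow>
        (\<Sum>i=1..n. let j = n + 1 - i in
           (- 1) ^ (i * (j + 1)) *\<^sub>R
           (\<Sum>\<sigma>\<in>unshuffles i (n - i). (of_int (sign \<sigma>) * koszul_sign \<sigma> ds) *\<^sub>R
              (let ys = permute_args \<sigma> xs in l j (l i (take i ys) # drop i ys)))) = 0)"

definition form_grading :: "('a \<Rightarrow> real) set \<Rightarrow> int \<Rightarrow> 'a form set" where
  "form_grading C d = (if d \<le> 0 then forms C (nat (1 - d)) else {0})"

end

theory Submission
  imports Defs
begin

text \<open>
  Write \<open>b f g = f dg - g df\<close>, so that the prescribed binary bracket is
  \<open>l\<^sub>2(\<alpha>, \<beta>) = b (\<delta>\<alpha>) (\<delta>\<beta>) / 2\<close>, a function of \<open>\<delta>\<alpha>\<close> and \<open>\<delta>\<beta>\<close> alone. Since \<open>\<delta>(f dg) = {f, g}\<close>,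
  applying \<open>\<delta>\<close> to it gives \<open>{\<delta>\<alpha>, \<delta>\<beta>}\<close>, and hence the Jacobiator of \<open>l\<^sub>2\<close> on \<open>\<alpha>, \<beta>, \<gamma>\<close> is
  \<open>- J f g h / 2\<close> with \<open>f = \<delta>\<alpha>\<close>, \<open>g = \<delta>\<beta>\<close>, \<open>h = \<delta>\<gamma>\<close> and \<open>J f g h\<close> the cyclic sum of \<open>b f {g, h}\<close>. This is the
  \<open>1\<close>-form that the hypothesis puts into \<open>\<delta>\<Omega>\<^sup>2\<close>. Choose a linear right inverse \<open>S\<close> of \<open>\<delta> : \<Omega>\<^sup>2 \<rightarrow> \<delta>\<Omega>\<^sup>2\<close>,
  let \<open>l\<^sub>3(\<alpha>, \<beta>, \<gamma>) = S (J f g h) / 2\<close>, and let all other brackets except \<open>l\<^sub>1 = \<delta>\<close> vanish.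

  Why this is an \<open>L\<^sub>\<infinity>\<close>-algebra: the brackets \<open>l\<^sub>2\<close> and \<open>l\<^sub>3\<close> see their arguments only through the projection
  \<open>\<alpha> \<mapsto> \<delta>\<alpha>\<close> to functions, which kills all forms of degree at least \<open>2\<close> and, as \<open>\<delta>\<^sup>2 = 0\<close>, all \<open>\<delta>\<close>-exact
  forms. Thus in every identity only a few terms survive. For three arguments they say that \<open>\<delta> l\<^sub>3\<close> cancels
  the Jacobiator of \<open>l\<^sub>2\<close>. For four arguments they say that \<open>S\<close> applied to an alternating sum of terms
  \<open>J {f, g} h k\<close> is zero. Up to sign \<open>J\<close> is the Chevalley-Eilenberg coboundary of \<open>b\<close>, with values in the trivial
  module \<open>\<Omega>\<^sup>1\<close>, so that sum vanishes already before \<open>S\<close> is applied, by the Jacobi identity of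
  \<open>{\<cdot>, \<cdot>}\<close>; this is why no \<open>l\<^sub>4\<close> is needed. The combinatorial part is the locale \<open>lie_two_data\<close>,
  with \<open>L_infinity\<close> as result; the cocycle identity is \<open>J_cocycle\<close>.

  The analytic input is that \<open>\<delta>\<close> is well defined on forms and \<open>\<delta>\<^sup>2 = 0\<close> (\<open>koszul_forms\<close> and \<open>koszul_koszul\<close>).
  With \<open>\<iota>\<close> the contraction with the bivector, \<open>\<delta>\<^sup>2 = (d T + T d) / 2\<close> for
  \<open>T = 2 \<iota> d \<iota> - d \<iota> \<iota> - \<iota> \<iota> d\<close>. Locally \<open>\<iota>\<close> is a sum of contractions with pairs of vector fields, and Cartan's
  formulas turn \<open>T\<close> into the contraction with a trivector, a multiple of the Schouten bracket of the bivector with itself. Its values on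
  differentials are multiples of Jacobiators of the Poisson bracket; thus \<open>T = 0\<close>. Cartan's formulas hold for the alternating
  multilinear forms of any algebra of functions. The passage between points and germs needs bump
  functions and, near each point, finitely many functions \<open>x i\<close> and vector fields \<open>E i\<close> such that every vector
  field \<open>X\<close> equals \<open>\<Sum>i. X (x i) * E i\<close> there. They come from a chart, by Hadamard's lemma.
\<close>

section \<open>Differential calculus on open subsets of the model space\<close>

text \<open>
  The coordinate boxes of the model space form a neighbourhood basis there, and they are convex.
\<close>

definition ebox :: "nat \<Rightarrow> (nat \<Rightarrow> real) \<Rightarrow> real \<Rightarrow> (nat \<Rightarrow> real) set" where
  "ebox n a e = {y. (\<forall>i\<ge>n. y i = 0) \<and> (\<forall>i<n. \<bar>y i - a i\<bar> < e)}"

lemma Euclidean_space_alt: "Euclidean_space n = top_of_set {x. \<forall>i\<ge>n. x i = 0}"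
  by (simp add: Euclidean_space_def euclidean_product_topology)

lemma openin_ebox: "openin (Euclidean_space n) (ebox n a e)"
proof -
  have "open (\<Inter>i\<in>{..<n}. (\<lambda>y::nat \<Rightarrow> real. y i) -` {a i - e <..< a i + e})"
    by (intro open_INT open_vimage ballI continuous_on_product_coordinates) auto
  moreover have "ebox n a e = {x. \<forall>i\<ge>n. x i = 0} \<inter> (\<Inter>i\<in>{..<n}. (\<lambda>y::nat \<Rightarrow> real. y i) -` {a i - e <..< a i + e})"
    by (auto simp: ebox_def abs_less_iff algebra_simps)
  ultimately show ?thesis
    unfolding Euclidean_space_alt by (simp add: openin_open_Int)
qed

lemma openin_Euclidean_subset: "openin (Euclidean_space n) W \<Longrightarrow> x \<in> W \<Longrightarrow> n \<le> i \<Longrightarrow> x i = 0"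
  using openin_subset[of "Euclidean_space n" W] by (auto simp: topspace_Euclidean_space)

lemma openin_contains_ebox:
  assumes "openin (Euclidean_space n) W" "x \<in> W"
  obtains e where "e > 0" "ebox n x e \<subseteq> W"
proof -
  obtain S where S: "openin (product_topology (\<lambda>i. euclidean) UNIV) S" "W = {x. \<forall>i\<ge>n. x i = 0} \<inter> S"
    using assms(1) unfolding Euclidean_space_def openin_subtopology by auto
  obtain X where X: "x \<in> (\<Pi>\<^sub>E i\<in>UNIV. X i)" "\<And>i. open (X i)" "(\<Pi>\<^sub>E i\<in>UNIV. X i) \<subseteq> S"
    using product_topology_open_contains_basis[OF S(1), of x] S(2) assms(2) by auto
  have "\<exists>d>0. \<forall>t. \<bar>t - x i\<bar> < d \<longrightarrow> t \<in> X i" for i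
    using X(1) X(2)[of i] unfolding open_dist by (auto simp: dist_real_def)
  then obtain d where d: "\<And>i. d i > 0" "\<And>i t. \<bar>t - x i\<bar> < d i \<Longrightarrow> t \<in> X i" by metis
  define e where "e = Min (insert 1 (d ` {..<n}))"
  have e: "e > 0" "\<And>i. i < n \<Longrightarrow> e \<le> d i"
    using d(1) by (auto simp: e_def)
  have "ebox n x e \<subseteq> W"
  proof
    fix y assume y: "y \<in> ebox n x e"
    have "y i \<in> X i" for i
    proof (cases "i < n")
      case True then show ?thesis using y e(2)[of i] by (intro d(2)) (force simp: ebox_def)
    next
      case False
      then have "y i = x i" using y assms openin_Euclidean_subset[OF assms] by (auto simp: ebox_def)
      then show ?thesis using X(1) by auto
    qed
    then show "y \<in> W" using X(3) S(2) y by (auto simp: ebox_def)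
  qed
  then show ?thesis using e(1) that by blast
qed

lemma openin_Euclidean_contI:
  assumes "openin (Euclidean_space n) W" "continuous_on W (g :: _ \<Rightarrow> real)" "open S"
  shows "openin (Euclidean_space n) {y\<in>W. g y \<in> S}"
proof -
  have "openin (top_of_set W) (W \<inter> g -` S)"
    using assms(2,3) by (simp add: continuous_openin_preimage_gen)
  then have "openin (Euclidean_space n) (W \<inter> g -` S)"
    using assms(1) unfolding Euclidean_space_alt by (meson openin_trans)
  moreover have "W \<inter> g -` S = {y\<in>W. g y \<in> S}" by auto
  ultimately show ?thesis by simp
qed

lemma continuous_on_ebox:
  assumes "openin (Euclidean_space n) W" "continuous_on W (g :: _ \<Rightarrow> real)" "x \<in> W" "e > 0"
  obtains d where "d > 0" "ebox n x d \<subseteq> W" "\<And>y. y \<in> ebox n x d \<Longrightarrow> \<bar>g y - g x\<bar> < e"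
proof -
  have "openin (Euclidean_space n) {y\<in>W. g y \<in> ball (g x) e}"
    using assms by (intro openin_Euclidean_contI) auto
  then obtain d where "d > 0" "ebox n x d \<subseteq> {y\<in>W. g y \<in> ball (g x) e}"
    using assms by (elim openin_contains_ebox) auto
  then show ?thesis using that[of d] by (auto simp: dist_real_def abs_minus_commute)
qed

lemma eventually_upd:
  assumes "openin (Euclidean_space n) W" "x \<in> W" "i < n"
  shows "\<forall>\<^sub>F t in nhds (x i). x(i := t) \<in> W"
proof -
  obtain e where e: "e > 0" "ebox n x e \<subseteq> W" using openin_contains_ebox assms by blast
  have "x(i := t) \<in> W" if "dist t (x i) < e" for t
    using that assms openin_Euclidean_subset[OF assms(1,2)] e
    by (intro subsetD[OF e(2)]) (auto simp: ebox_def dist_real_def)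
  then show ?thesis using e(1) unfolding eventually_nhds_metric by blast
qed

lemma pdiff_cong:
  assumes "openin (Euclidean_space n) W" "\<And>y. y \<in> W \<Longrightarrow> f y = g y" "x \<in> W" "i < n"
  shows "pdiff i f x = pdiff i g x"
  unfolding pdiff_def
  by (rule deriv_cong_ev) (use eventually_upd[OF assms(1,3,4)] assms(2) in \<open>auto elim: eventually_mono\<close>)

lemma Ck_on_imp_continuous: "Ck_on n k W f \<Longrightarrow> continuous_on W f"
  by (cases k) auto

lemma Ck_on_DERIV:
  "Ck_on n (Suc k) W f \<Longrightarrow> i < n \<Longrightarrow> x \<in> W \<Longrightarrow> DERIV (\<lambda>t. f (x(i := t))) (x i) :> pdiff i f x"
  by (auto simp: pdiff_def DERIV_deriv_iff_real_differentiable)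

lemma Ck_on_pdiff: "Ck_on n (Suc k) W f \<Longrightarrow> i < n \<Longrightarrow> Ck_on n k W (pdiff i f)"
  by auto

text \<open>
  Partial derivatives are taken along coordinate lines, which stay in a relatively open set for a while. So
  they depend only on the values there, and explicit derivatives can be used to establish smoothness.
\<close>

lemma Ck_on_cong:
  assumes "openin (Euclidean_space n) W"
  shows "Ck_on n k W f \<Longrightarrow> (\<And>y. y \<in> W \<Longrightarrow> f y = g y) \<Longrightarrow> Ck_on n k W g"
proof (induction k arbitrary: f g)
  case 0 then show ?case by (auto cong: continuous_on_cong)
next
  case (Suc k)
  have c: "continuous_on W g" using Suc.prems by (auto cong: continuous_on_cong)
  show ?case unfolding Ck_on.simps
  proof (intro conjI c allI impI ballI)
    fix i x assume i: "i < n" and x: "x \<in> W"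
    have "\<forall>\<^sub>F t in nhds (x i). f (x(i := t)) = g (x(i := t))"
      using eventually_upd[OF assms x i] by eventually_elim (use Suc.prems in auto)
    then show "(\<lambda>t. g (x(i := t))) differentiable at (x i)"
      using Ck_on_DERIV[OF Suc.prems(1) i x] DERIV_cong_ev[OF refl _ refl, of "\<lambda>t. f (x(i := t))" "\<lambda>t. g (x(i := t))" "x i"]
      unfolding real_differentiable_def by blast
  next
    fix i assume i: "i < n"
    show "Ck_on n k W (pdiff i g)"
      by (rule Suc.IH[of "pdiff i f"])
        (use Suc.prems i pdiff_cong[OF assms, of f g] in auto)
  qed
qed

lemma Ck_on_SucI:
  assumes "openin (Euclidean_space n) W" "continuous_on W f"
    "\<And>i x. i < n \<Longrightarrow> x \<in> W \<Longrightarrow> DERIV (\<lambda>t. f (x(i := t))) (x i) :> g i x"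
    "\<And>i. i < n \<Longrightarrow> Ck_on n k W (g i)"
  shows "Ck_on n (Suc k) W f"
  unfolding Ck_on.simps
proof (intro conjI allI impI ballI)
  fix i assume i: "i < n"
  show "Ck_on n k W (pdiff i f)"
    by (rule Ck_on_cong[OF assms(1) assms(4)[OF i]]) (auto simp: pdiff_def dest!: assms(3)[OF i] DERIV_imp_deriv)
qed (use assms(2,3) in \<open>auto simp: real_differentiable_def\<close>)

lemma Ck_on_Suc_imp: "Ck_on n (Suc k) W f \<Longrightarrow> Ck_on n k W f"
  by (induction k arbitrary: f) auto

lemma Ck_on_subset: "Ck_on n k W f \<Longrightarrow> V \<subseteq> W \<Longrightarrow> Ck_on n k V f"
  by (induction k arbitrary: f) (auto intro: continuous_on_subset)

lemma Ck_on_local: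
  assumes "openin (Euclidean_space n) W"
    and "\<And>x. x \<in> W \<Longrightarrow> \<exists>V. openin (Euclidean_space n) V \<and> x \<in> V \<and> V \<subseteq> W \<and> Ck_on n k V f"
  shows "Ck_on n k W f"
  using assms(2)
proof (induction k arbitrary: f)
  case 0
  show ?case unfolding Ck_on.simps continuous_on_eq_continuous_within
  proof
    fix x assume "x \<in> W"
    then obtain V where V: "openin (Euclidean_space n) V" "x \<in> V" "V \<subseteq> W" "continuous_on V f" using 0 by force
    obtain S where S: "open S" "V = S \<inter> {x. \<forall>i\<ge>n. x i = 0}"
      using V(1) unfolding Euclidean_space_alt by (auto simp: openin_open)
    have "W \<inter> S = V" using S V(3) openin_Euclidean_subset[OF assms(1)] by auto
    then have "at x within W = at x within V"
      using S(1) V(2) S(2) at_within_nhd[of x S W V] by auto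
    then show "continuous (at x within W) f"
      using V(2,4) by (simp add: continuous_on_eq_continuous_within continuous_within)
  qed
next
  case (Suc k)
  have loc: "\<exists>V. openin (Euclidean_space n) V \<and> x \<in> V \<and> V \<subseteq> W \<and> Ck_on n k V g"
    if "x \<in> W" "\<And>V. Ck_on n (Suc k) V f \<Longrightarrow> Ck_on n k V g" for x g
    using Suc.prems[OF that(1)] that(2) by meson
  have "Ck_on n k W f" by (rule Suc.IH, erule loc) (rule Ck_on_Suc_imp)
  then have "continuous_on W f" by (rule Ck_on_imp_continuous)
  moreover have "(\<lambda>t. f (x(i := t))) differentiable at (x i)" if "i < n" "x \<in> W" for i x
    using Suc.prems[OF that(2)] that(1) by auto
  moreover have "Ck_on n k W (pdiff i f)" if "i < n" for i
    by (rule Suc.IH, erule loc) (rule Ck_on_pdiff[OF _ that])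
  ultimately show ?case by simp
qed

lemma Ck_on_const:
  assumes "openin (Euclidean_space n) W"
  shows "Ck_on n k W (\<lambda>_. c)"
proof (induction k arbitrary: c)
  case (Suc k)
  then show ?case by (intro Ck_on_SucI[where g="\<lambda>_ _. 0", OF assms]) auto
qed auto

lemma Ck_on_proj:
  assumes "openin (Euclidean_space n) W"
  shows "Ck_on n k W (\<lambda>x. x j)"
proof (cases k)
  case (Suc l)
  have "DERIV (\<lambda>t. (x(i := t)) j) (x i) :> (if i = j then 1 else 0)" for i and x :: "nat \<Rightarrow> real"
    by auto
  then show ?thesis unfolding Suc
    by (intro Ck_on_SucI[where g="\<lambda>i _. if i = j then 1 else 0", OF assms] Ck_on_const assms)
      (auto intro: continuous_on_product_then_coordinatewise[OF continuous_on_id])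
qed (auto intro: continuous_on_product_then_coordinatewise[OF continuous_on_id])

lemma Ck_on_add:
  assumes "openin (Euclidean_space n) W"
  shows "Ck_on n k W f \<Longrightarrow> Ck_on n k W g \<Longrightarrow> Ck_on n k W (\<lambda>x. f x + g x)"
proof (induction k arbitrary: f g)
  case (Suc k)
  show ?case
  proof (rule Ck_on_SucI[where g="\<lambda>i x. pdiff i f x + pdiff i g x", OF assms])
    fix i x assume *: "i < n" "x \<in> W"
    show "DERIV (\<lambda>t. f (x(i := t)) + g (x(i := t))) (x i) :> pdiff i f x + pdiff i g x"
      by (intro DERIV_add Ck_on_DERIV[OF Suc.prems(1) *] Ck_on_DERIV[OF Suc.prems(2) *])
  next
    fix i assume "i < n"
    then show "Ck_on n k W (\<lambda>x. pdiff i f x + pdiff i g x)"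
      using Suc.prems by (intro Suc.IH Ck_on_pdiff)
  qed (use Suc.prems in \<open>auto intro!: continuous_intros\<close>)
qed (auto intro: continuous_intros)

lemma Ck_on_mult:
  assumes "openin (Euclidean_space n) W"
  shows "Ck_on n k W f \<Longrightarrow> Ck_on n k W g \<Longrightarrow> Ck_on n k W (\<lambda>x. f x * g x)"
proof (induction k arbitrary: f g)
  case (Suc k)
  show ?case
  proof (rule Ck_on_SucI[where g="\<lambda>i x. pdiff i f x * g x + pdiff i g x * f x", OF assms])
    fix i x assume *: "i < n" "x \<in> W"
    show "DERIV (\<lambda>t. f (x(i := t)) * g (x(i := t))) (x i) :> pdiff i f x * g x + pdiff i g x * f x"
      using DERIV_mult[OF Ck_on_DERIV[OF Suc.prems(1) *] Ck_on_DERIV[OF Suc.prems(2) *]]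
      by (simp del: fun_upd_apply add: fun_upd_triv)
  next
    fix i assume "i < n"
    then show "Ck_on n k W (\<lambda>x. pdiff i f x * g x + pdiff i g x * f x)"
      by (intro Ck_on_add[OF assms] Suc.IH Ck_on_pdiff[OF Suc.prems(1)] Ck_on_pdiff[OF Suc.prems(2)]
          Ck_on_Suc_imp[OF Suc.prems(1)] Ck_on_Suc_imp[OF Suc.prems(2)])
  qed (use Suc.prems in \<open>auto intro!: continuous_intros\<close>)
qed (auto intro: continuous_intros)

lemma Ck_on_sum:
  assumes "openin (Euclidean_space n) W"
  shows "(\<And>j. j \<in> J \<Longrightarrow> Ck_on n k W (f j)) \<Longrightarrow> Ck_on n k W (\<lambda>x. \<Sum>j\<in>J. f j x)"
  by (induction J rule: infinite_finite_induct) (auto intro: Ck_on_const Ck_on_add assms)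

lemma Ck_on_inverse:
  assumes "openin (Euclidean_space n) W" "\<And>x. x \<in> W \<Longrightarrow> f x \<noteq> 0"
  shows "Ck_on n k W f \<Longrightarrow> Ck_on n k W (\<lambda>x. inverse (f x))"
proof (induction k)
  case (Suc k)
  show ?case
  proof (rule Ck_on_SucI[where g="\<lambda>i x. (- 1) * (pdiff i f x * (inverse (f x) * inverse (f x)))", OF assms(1)])
    fix i x assume *: "i < n" "x \<in> W"
    show "DERIV (\<lambda>t. inverse (f (x(i := t)))) (x i) :> (- 1) * (pdiff i f x * (inverse (f x) * inverse (f x)))"
      using DERIV_inverse_fun[OF Ck_on_DERIV[OF Suc.prems *]] assms(2)[OF *(2)] by (simp add: mult_ac del: fun_upd_apply)
  next
    fix i assume "i < n"
    then show "Ck_on n k W (\<lambda>x. (- 1) * (pdiff i f x * (inverse (f x) * inverse (f x))))"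
      by (intro Ck_on_mult[OF assms(1)] Ck_on_const[OF assms(1)] Suc.IH Ck_on_pdiff[OF Suc.prems]
          Ck_on_Suc_imp[OF Suc.prems])
  qed (use Suc.prems assms in \<open>auto intro!: continuous_intros\<close>)
qed (auto intro!: continuous_intros assms)

lemma isCont_imp_tendsto_nhds: "isCont f x \<Longrightarrow> (f \<longlongrightarrow> f x) (nhds x)"
  by (simp add: isCont_def tendsto_at_iff_tendsto_nhds)

text \<open>
  The chain rule for a curve. The sequence space has no norm to speak of differentiability in, so the coordinates
  are switched on one at a time: each step changes a single coordinate and is controlled by the mean value
  theorem and the continuity of one partial derivative.
\<close>

lemma DERIV_along_curve:
  assumes W: "openin (Euclidean_space m) W" and F: "Ck_on m (Suc k) W F"
    and ev: "\<forall>\<^sub>F t in nhds t0. \<gamma> t \<in> W"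
    and d: "\<And>j. j < m \<Longrightarrow> DERIV (\<lambda>t. \<gamma> t j) t0 :> \<gamma>' j"
  shows "DERIV (\<lambda>t. F (\<gamma> t)) t0 :> (\<Sum>j<m. pdiff j F (\<gamma> t0) * \<gamma>' j)"
proof -
  define H where "H = (\<lambda>l t j. if j < l then \<gamma> t j else \<gamma> t0 j)"
  have x0: "\<gamma> t0 \<in> W" using eventually_nhds_x_imp_x[OF ev] .
  have near: "\<forall>\<^sub>F t in nhds t0. \<forall>j<m. \<bar>\<gamma> t j - \<gamma> t0 j\<bar> < e" if "e > 0" for e
  proof -
    have "\<forall>\<^sub>F t in nhds t0. \<bar>\<gamma> t j - \<gamma> t0 j\<bar> < e" if "j < m" for j
    proof -
      have "isCont (\<lambda>t. \<gamma> t j) t0" using d[OF that] by (rule DERIV_isCont)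
      then have "((\<lambda>t. \<gamma> t j) \<longlongrightarrow> \<gamma> t0 j) (nhds t0)"
        by (rule isCont_imp_tendsto_nhds)
      from tendstoD[OF this \<open>e > 0\<close>] show ?thesis by (simp add: dist_real_def)
    qed
    then have "\<forall>\<^sub>F t in nhds t0. \<forall>j\<in>{..<m}. \<bar>\<gamma> t j - \<gamma> t0 j\<bar> < e"
      by (intro eventually_ball_finite) auto
    then show ?thesis by (simp add: Ball_def)
  qed
  \<comment> \<open>\<open>H l\<close> is the curve with only its first \<open>l\<close> coordinates moving.\<close>
  have main: "DERIV (\<lambda>t. F (H l t)) t0 :> (\<Sum>j<l. pdiff j F (\<gamma> t0) * \<gamma>' j)" if "l \<le> m" for l
    using that
  proof (induction l)
    case 0 then show ?case by (simp add: H_def)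
  next
    case (Suc l)
    then have l: "l < m" by simp
    \<comment> \<open>The difference quotient in the coordinate \<open>l\<close>; at \<open>t0\<close> it has the limit \<open>pdiff l F (\<gamma> t0)\<close>.\<close>
    define D where "D t = (if \<gamma> t l = \<gamma> t0 l then pdiff l F (\<gamma> t0)
      else (F (H (Suc l) t) - F (H l t)) / (\<gamma> t l - \<gamma> t0 l))" for t
    have HS: "H (Suc l) t = (H l t)(l := \<gamma> t l)" "H l t = (H l t)(l := \<gamma> t0 l)" for t
      by (auto simp: H_def fun_eq_iff)
    have Deq: "F (H (Suc l) t) - F (H l t) = D t * (\<gamma> t l - \<gamma> t0 l)" for t
      using HS[of t] by (auto simp: D_def)
    have "(D \<longlongrightarrow> D t0) (nhds t0)"
    proof (rule tendstoI)
      fix e :: real assume "e > 0"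
      then obtain r where r: "r > 0" "ebox m (\<gamma> t0) r \<subseteq> W"
        "\<And>y. y \<in> ebox m (\<gamma> t0) r \<Longrightarrow> \<bar>pdiff l F y - pdiff l F (\<gamma> t0)\<bar> < e"
        using continuous_on_ebox[OF W Ck_on_imp_continuous[OF Ck_on_pdiff[OF F l]] x0] by metis
      show "\<forall>\<^sub>F t in nhds t0. dist (D t) (D t0) < e"
        using near[OF r(1)]
      proof eventually_elim
        case (elim t)
        have in_box: "(H l t)(l := s) \<in> ebox m (\<gamma> t0) r" if "\<bar>s - \<gamma> t0 l\<bar> < r" for s
          using elim that r(1) openin_Euclidean_subset[OF W x0] l by (auto simp: ebox_def H_def)
        show ?case
        proof (cases "\<gamma> t l = \<gamma> t0 l")
          case True then show ?thesis using \<open>e > 0\<close> by (simp add: D_def)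
        next
          case False
          define a b where "a = min (\<gamma> t l) (\<gamma> t0 l)" and "b = max (\<gamma> t l) (\<gamma> t0 l)"
          have "a < b" using False by (auto simp: a_def b_def)
          have seg: "\<bar>s - \<gamma> t0 l\<bar> < r" if "a \<le> s" "s \<le> b" for s
            using that elim l r(1) by (auto simp: a_def b_def abs_if min_def max_def split: if_splits)
          have "DERIV (\<lambda>s. F ((H l t)(l := s))) s :> pdiff l F ((H l t)(l := s))" if "a \<le> s" "s \<le> b" for s
            using Ck_on_DERIV[OF F l, of "(H l t)(l := s)"] in_box[OF seg[OF that]] r(2) by auto
          from MVT2[OF \<open>a < b\<close> this] obtain z where z: "a < z" "z < b"
            "F ((H l t)(l := b)) - F ((H l t)(l := a)) = (b - a) * pdiff l F ((H l t)(l := z))" by blast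
          have "F (H (Suc l) t) - F (H l t) = (\<gamma> t l - \<gamma> t0 l) * pdiff l F ((H l t)(l := z))"
            using z(3) HS[of t] by (cases "\<gamma> t l \<le> \<gamma> t0 l") (auto simp: a_def b_def algebra_simps)
          then have "D t = pdiff l F ((H l t)(l := z))" using False by (simp add: D_def)
          then show ?thesis using r(3)[OF in_box[OF seg]] z by (simp add: D_def dist_real_def)
        qed
      qed
    qed
    then have contD: "isCont D t0" by (simp add: isCont_def tendsto_at_iff_tendsto_nhds)
    obtain q where q: "\<And>t. \<gamma> t l - \<gamma> t0 l = q t * (t - t0)" "isCont q t0" "q t0 = \<gamma>' l"
      using d[OF l] unfolding CARAT_DERIV by metis
    have "H (Suc l) t0 = H l t0" by (auto simp: H_def fun_eq_iff less_Suc_eq)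
    moreover have "D t0 = pdiff l F (\<gamma> t0)" by (simp add: D_def)
    moreover have "isCont (\<lambda>t. D t * q t) t0" using contD q(2) by (intro continuous_intros)
    ultimately have "DERIV (\<lambda>t. F (H (Suc l) t) - F (H l t)) t0 :> pdiff l F (\<gamma> t0) * \<gamma>' l"
      unfolding CARAT_DERIV by (intro exI[of _ "\<lambda>t. D t * q t"]) (auto simp: Deq q(1,3))
    then have "DERIV (\<lambda>t. F (H l t) + (F (H (Suc l) t) - F (H l t))) t0 :> (\<Sum>j<l. pdiff j F (\<gamma> t0) * \<gamma>' j) + pdiff l F (\<gamma> t0) * \<gamma>' l"
      using Suc by (intro DERIV_add) auto
    then show ?case by simp
  qed
  have "\<forall>\<^sub>F t in nhds t0. F (H m t) = F (\<gamma> t)"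
    using ev
  proof eventually_elim
    case (elim t)
    have "H m t = \<gamma> t" using openin_Euclidean_subset[OF W elim] openin_Euclidean_subset[OF W x0]
      by (auto simp: H_def fun_eq_iff)
    then show ?case by simp
  qed
  then show ?thesis
    using main[OF order_refl] DERIV_cong_ev[OF refl _ refl, of "\<lambda>t. F (H m t)" "\<lambda>t. F (\<gamma> t)" t0] by blast
qed

lemma Ck_on_compose:
  assumes V: "openin (Euclidean_space m) V" and W: "openin (Euclidean_space n) W"
    and G: "\<And>x. x \<in> W \<Longrightarrow> G x \<in> V"
  shows "Ck_on m k V F \<Longrightarrow> (\<And>j. j < m \<Longrightarrow> Ck_on n k W (\<lambda>x. G x j)) \<Longrightarrow> Ck_on n k W (\<lambda>x. F (G x))"
proof (induction k arbitrary: F)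
  have cont: "continuous_on W (\<lambda>x. F (G x))" if "continuous_on V F" "\<And>j. j < m \<Longrightarrow> continuous_on W (\<lambda>x. G x j)" for F :: "_ \<Rightarrow> real"
  proof (rule continuous_on_compose2[OF that(1)])
    show "continuous_on W G"
    proof (rule continuous_on_coordinatewise_then_product)
      fix j show "continuous_on W (\<lambda>x. G x j)"
      proof (cases "j < m")
        case False
        then have "continuous_on W (\<lambda>x. G x j) \<longleftrightarrow> continuous_on W (\<lambda>x. 0::real)"
          using openin_Euclidean_subset[OF V G] by (intro continuous_on_cong) auto
        then show ?thesis by simp
      qed (use that in auto)
    qed
  qed (use G in auto)
  {
    case 0 then show ?case using cont by simp
  next
    case (Suc k)
    show ?case
    proof (rule Ck_on_SucI[where g="\<lambda>i x. \<Sum>j<m. pdiff j F (G x) * pdiff i (\<lambda>x. G x j) x", OF W])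
      show "continuous_on W (\<lambda>x. F (G x))" 
        by (rule cont[OF Ck_on_imp_continuous[OF Suc.prems(1)] Ck_on_imp_continuous[OF Suc.prems(2)]])
      fix i x assume i: "i < n" and x: "x \<in> W"
      show "DERIV (\<lambda>t. F (G (x(i := t)))) (x i) :> (\<Sum>j<m. pdiff j F (G x) * pdiff i (\<lambda>x. G x j) x)"
        using DERIV_along_curve[OF V Suc.prems(1), of "\<lambda>t. G (x(i := t))" "x i" "\<lambda>j. pdiff i (\<lambda>x. G x j) x"]
          Ck_on_DERIV[OF Suc.prems(2) i x] eventually_mono[OF eventually_upd[OF W x i] G] by simp
    next
      fix i assume i: "i < n"
      show "Ck_on n k W (\<lambda>x. \<Sum>j<m. pdiff j F (G x) * pdiff i (\<lambda>x. G x j) x)"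
      proof (rule Ck_on_sum[OF W], rule Ck_on_mult[OF W])
        fix j assume "j \<in> {..<m}"
        then have j: "j < m" by simp
        show "Ck_on n k W (\<lambda>x. pdiff j F (G x))"
          by (rule Suc.IH[OF Ck_on_pdiff[OF Suc.prems(1) j] Ck_on_Suc_imp[OF Suc.prems(2)]])
        show "Ck_on n k W (pdiff i (\<lambda>x. G x j))" by (rule Ck_on_pdiff[OF Suc.prems(2)[OF j] i])
      qed
    qed
  }
qed

lemma ebox_segment:
  assumes "x \<in> ebox n a e" "\<And>i. i \<ge> n \<Longrightarrow> a i = 0" "0 \<le> s" "s \<le> (1::real)"
  shows "(\<lambda>j. a j + s * (x j - a j)) \<in> ebox n a e"
proof -
  have "\<bar>s * (x j - a j)\<bar> < e" if "j < n" for j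
  proof -
    have "\<bar>s * (x j - a j)\<bar> \<le> \<bar>x j - a j\<bar>" using assms(3,4) by (simp add: abs_mult mult_left_le_one_le)
    then show ?thesis using assms(1) that by (force simp: ebox_def)
  qed
  then show ?thesis using assms by (auto simp: ebox_def)
qed

text \<open>
  With \<open>m = 0\<close> these are the remainder functions of Hadamard's lemma. A derivative of \<open>u (a + s (x - a))\<close> in \<open>x\<close>
  produces a factor \<open>s\<close>, and the exponent \<open>m\<close> makes the family closed under differentiation.
\<close>

definition ray_integral :: "(nat \<Rightarrow> real) \<Rightarrow> nat \<Rightarrow> ((nat \<Rightarrow> real) \<Rightarrow> real) \<Rightarrow> (nat \<Rightarrow> real) \<Rightarrow> real" where
  "ray_integral a m u x = integral (cbox 0 1) (\<lambda>s. s ^ m * u (\<lambda>j. a j + s * (x j - a j)))"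

lemma continuous_on_ray:
  assumes "\<And>i. i \<ge> n \<Longrightarrow> a i = 0" "continuous_on (ebox n a e) u"
  shows "continuous_on (ebox n a e \<times> cbox 0 1) (\<lambda>(x, s). s ^ m * u (\<lambda>j. a j + s * (x j - a j)))"
proof -
  have c: "continuous_on S (\<lambda>y. fst y j)" for j and S :: "((nat \<Rightarrow> real) \<times> real) set"
    by (rule continuous_on_product_then_coordinatewise) (intro continuous_intros)
  have "continuous_on (ebox n a e \<times> cbox 0 1) (\<lambda>y. u (\<lambda>j. a j + snd y * (fst y j - a j)))"
    by (rule continuous_on_compose2[OF assms(2)])
      (auto intro!: continuous_on_coordinatewise_then_product continuous_intros c ebox_segment assms(1))
  then show ?thesis by (auto simp: case_prod_unfold intro!: continuous_intros)
qed

lemma Ck_on_ray_integral: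
  assumes a: "\<And>i. i \<ge> n \<Longrightarrow> a i = 0"
  shows "Ck_on n k (ebox n a e) u \<Longrightarrow> Ck_on n k (ebox n a e) (ray_integral a m u)"
proof (induction k arbitrary: m u)
  case 0
  then show ?case using integral_continuous_on_param[OF continuous_on_ray[OF a]]
    by (simp add: ray_integral_def[abs_def])
next
  case (Suc k)
  show ?case
  proof (rule Ck_on_SucI[OF openin_ebox, where g="\<lambda>i. ray_integral a (Suc m) (pdiff i u)"])
    show "continuous_on (ebox n a e) (ray_integral a m u)"
      using integral_continuous_on_param[OF continuous_on_ray[OF a Ck_on_imp_continuous[OF Suc.prems]]]
      by (simp add: ray_integral_def[abs_def])
    fix i x assume i: "i < n" and x: "x \<in> ebox n a e"
    define U where "U = {a i - e <..< a i + e}"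
    have up: "x(i := t) \<in> ebox n a e" if "t \<in> U" for t
      using that x i by (auto simp: ebox_def U_def abs_less_iff)
    have xi: "x i \<in> U" using x i by (force simp: ebox_def U_def abs_less_iff)
    define P where "P = (\<lambda>t s j. a j + s * ((x(i := t)) j - a j))"
    have P: "P t s \<in> ebox n a e" if "t \<in> U" "s \<in> cbox 0 1" for t s
      unfolding P_def using ebox_segment[OF up[OF that(1)] a] that(2) by auto
    have P_upd: "P t s = (P t' s)(i := a i + s * (t - a i))" for t t' s by (auto simp: P_def)
    have "((\<lambda>t. integral (cbox 0 1) (\<lambda>s. s ^ m * u (P t s))) has_field_derivative
        integral (cbox 0 1) (\<lambda>s. s ^ Suc m * pdiff i u (P (x i) s))) (at (x i) within U)"
    proof (rule leibniz_rule_field_derivative)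
      fix t s :: real assume t: "t \<in> U" and s: "s \<in> cbox 0 1"
      have "DERIV (\<lambda>r. u ((P t s)(i := r))) (a i + s * (t - a i)) :> pdiff i u (P t s)"
      proof -
        have "P t s i = a i + s * (t - a i)" by (simp add: P_def)
        then show ?thesis using Ck_on_DERIV[OF Suc.prems i P[OF t s]] by (simp del: fun_upd_apply)
      qed
      then have "DERIV (\<lambda>r. u ((P t s)(i := a i + s * (r - a i)))) t :> pdiff i u (P t s) * s"
        by (rule DERIV_chain2) (auto intro!: derivative_eq_intros)
      moreover have "(\<lambda>r. u (P r s)) = (\<lambda>r. u ((P t s)(i := a i + s * (r - a i))))"
        by (intro ext arg_cong[of _ _ u] P_upd)
      ultimately have "DERIV (\<lambda>r. u (P r s)) t :> pdiff i u (P t s) * s" by (simp only:)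
      from DERIV_cmult[OF this, of "s ^ m"]
      have "DERIV (\<lambda>r. s ^ m * u (P r s)) t :> s ^ m * (pdiff i u (P t s) * s)" .
      moreover have "s ^ m * (pdiff i u (P t s) * s) = s ^ Suc m * pdiff i u (P t s)" by simp
      ultimately show "((\<lambda>t. s ^ m * u (P t s)) has_field_derivative s ^ Suc m * pdiff i u (P t s)) (at t within U)"
        using has_field_derivative_at_within by metis
    next
      fix t assume t: "t \<in> U"
      have "continuous_on (cbox 0 1) (\<lambda>s. (\<lambda>(y, s). s ^ m * u (\<lambda>j. a j + s * (y j - a j))) (x(i := t), s))"
        by (rule continuous_on_compose2[OF continuous_on_ray[OF a Ck_on_imp_continuous[OF Suc.prems]]])
          (use up[OF t] in \<open>auto intro!: continuous_intros\<close>)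
      then show "(\<lambda>s. s ^ m * u (P t s)) integrable_on cbox 0 1"
        by (intro integrable_continuous) (simp add: P_def)
    next
      have c: "continuous_on (U \<times> cbox 0 1) (\<lambda>y::real \<times> real. (\<lambda>(y, s). s ^ Suc m * pdiff i u (\<lambda>j. a j + s * (y j - a j))) (x(i := fst y), snd y))"
      proof (rule continuous_on_compose2[OF continuous_on_ray[OF a Ck_on_imp_continuous[OF Ck_on_pdiff[OF Suc.prems i]]]])
        have "continuous_on (U \<times> cbox 0 1) (\<lambda>y::real \<times> real. x(i := fst y))"
        proof (rule continuous_on_coordinatewise_then_product)
          fix j show "continuous_on (U \<times> cbox 0 1) (\<lambda>y::real \<times> real. (x(i := fst y)) j)"
            by (cases "j = i") (auto intro!: continuous_intros)
        qed
        then show "continuous_on (U \<times> cbox 0 1) (\<lambda>y::real \<times> real. (x(i := fst y), snd y))"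
          by (rule continuous_on_Pair) (rule continuous_on_snd[OF continuous_on_id])
      qed (use up in auto)
      then show "continuous_on (U \<times> cbox 0 1) (\<lambda>(t, s). s ^ Suc m * pdiff i u (P t s))"
        by (simp add: case_prod_unfold P_def)
    qed (use xi in \<open>auto simp: U_def\<close>)
    then have "DERIV (\<lambda>t. integral (cbox 0 1) (\<lambda>s. s ^ m * u (P t s))) (x i) :> integral (cbox 0 1) (\<lambda>s. s ^ Suc m * pdiff i u (P (x i) s))"
      using xi at_within_open[of "x i" U] by (simp add: U_def)
    then show "DERIV (\<lambda>t. ray_integral a m u (x(i := t))) (x i) :> ray_integral a (Suc m) (pdiff i u) x"
      by (simp add: ray_integral_def P_def del: fun_upd_apply)
  qed (use Suc in auto)
qed

text \<open>
  The fundamental theorem of calculus on the segment from \<open>a\<close> to \<open>x\<close>, which lies in the box.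
\<close>

lemma Hadamard:
  assumes a: "\<And>i. i \<ge> n \<Longrightarrow> a i = 0" and e: "e > 0" and u: "Ck_on n 1 (ebox n a e) u" and x: "x \<in> ebox n a e"
  shows "u x = u a + (\<Sum>i<n. (x i - a i) * ray_integral a 0 (pdiff i u) x)"
proof -
  define \<gamma> where "\<gamma> s j = a j + s * (x j - a j)" for s j
  have in1: "\<gamma> s \<in> ebox n a e" if "0 \<le> s" "s \<le> 1" for s
    unfolding \<gamma>_def using ebox_segment[OF x a that] .
  have d: "((\<lambda>s. u (\<gamma> s)) has_vector_derivative (\<Sum>i<n. pdiff i u (\<gamma> s) * (x i - a i))) (at s within {0..1})"
    if s: "s \<in> {0..1}" for s
  proof -
    have "isCont (\<lambda>s. \<gamma> s j) s" for j unfolding \<gamma>_def by (intro continuous_intros)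
    then have cont: "((\<lambda>s. \<gamma> s j) \<longlongrightarrow> \<gamma> s j) (nhds s)" for j by (rule isCont_imp_tendsto_nhds)
    obtain r where r: "r > 0" "ebox n (\<gamma> s) r \<subseteq> ebox n a e"
      using openin_contains_ebox[OF openin_ebox in1] s by (metis atLeastAtMost_iff)
    have "\<forall>\<^sub>F t in nhds s. \<forall>j\<in>{..<n}. dist (\<gamma> t j) (\<gamma> s j) < r"
      by (intro eventually_ball_finite) (use tendstoD[OF cont r(1)] in auto)
    then have "\<forall>\<^sub>F t in nhds s. \<gamma> t \<in> ebox n a e"
    proof eventually_elim
      case (elim t)
      then have "\<gamma> t \<in> ebox n (\<gamma> s) r" using a x by (auto simp: ebox_def dist_real_def \<gamma>_def)
      then show ?case using r by blast
    qed
    moreover have "DERIV (\<lambda>s. \<gamma> s i) s :> x i - a i" for i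
      by (auto simp: \<gamma>_def intro!: derivative_eq_intros)
    ultimately have "DERIV (\<lambda>s. u (\<gamma> s)) s :> (\<Sum>i<n. pdiff i u (\<gamma> s) * (x i - a i))"
      by (rule DERIV_along_curve[OF openin_ebox u[unfolded One_nat_def]])
    then show ?thesis by (simp add: has_field_derivative_at_within has_real_derivative_iff_has_vector_derivative[symmetric])
  qed
  have "((\<lambda>s. \<Sum>i<n. pdiff i u (\<gamma> s) * (x i - a i)) has_integral u (\<gamma> 1) - u (\<gamma> 0)) {0..1}"
    by (rule fundamental_theorem_of_calculus) (use d in auto)
  moreover have "((\<lambda>s. \<Sum>i<n. pdiff i u (\<gamma> s) * (x i - a i)) has_integral (\<Sum>i<n. ray_integral a 0 (pdiff i u) x * (x i - a i))) {0..1}"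
  proof (intro has_integral_sum has_integral_mult_left)
    fix i assume "i \<in> {..<n}"
    then have i: "i < n" by simp
    have "continuous_on (cbox 0 1) (\<lambda>s. (\<lambda>(y, s). s ^ 0 * pdiff i u (\<lambda>j. a j + s * (y j - a j))) (x, s))"
      by (rule continuous_on_compose2[OF continuous_on_ray[OF a Ck_on_imp_continuous[OF Ck_on_pdiff[OF u[unfolded One_nat_def] i]]]])
        (use x in \<open>auto intro!: continuous_intros\<close>)
    then have "(\<lambda>s. pdiff i u (\<gamma> s)) integrable_on cbox 0 1"
      by (intro integrable_continuous) (simp add: \<gamma>_def[abs_def])
    then show "((\<lambda>s. pdiff i u (\<gamma> s)) has_integral ray_integral a 0 (pdiff i u) x) {0..1}"
      by (simp add: ray_integral_def \<gamma>_def[abs_def] integrable_integral)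
  qed auto
  ultimately have "u (\<gamma> 1) - u (\<gamma> 0) = (\<Sum>i<n. ray_integral a 0 (pdiff i u) x * (x i - a i))"
    by (rule has_integral_unique)
  moreover have "\<gamma> 1 = x" "\<gamma> 0 = a" by (auto simp: \<gamma>_def)
  ultimately show ?thesis by (simp add: mult.commute)
qed

lemma ray_integral_center: "ray_integral a 0 u a = u a"
  by (simp add: ray_integral_def)

text \<open>
  For \<open>p = 1\<close> this is the standard smooth function that is flat at \<open>0\<close>. Its derivatives have the same shape with
  other polynomials, since \<open>1 / t\<close> has derivative \<open>- (1 / t)\<^sup>2\<close>; hence smoothness follows by induction for all \<open>p\<close> at once.
\<close>

definition exp_flat :: "real poly \<Rightarrow> real \<Rightarrow> real" where
  "exp_flat p t = (if t > 0 then poly p (inverse t) * exp (- inverse t) else 0)"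

lemma poly_exp_tendsto_0: "((\<lambda>x::real. poly p x * exp (- x)) \<longlongrightarrow> 0) at_top"
proof -
  have "((\<lambda>x::real. \<Sum>i\<le>degree p. coeff p i * (x ^ i / exp x)) \<longlongrightarrow> (\<Sum>i\<le>degree p. coeff p i * 0)) at_top"
    by (intro tendsto_intros tendsto_power_div_exp_0)
  moreover have "(\<Sum>i\<le>degree p. coeff p i * (x ^ i / exp x)) = poly p x * exp (- x)" for x
    by (simp add: poly_altdef sum_distrib_right exp_minus divide_inverse mult.assoc)
  ultimately show ?thesis by simp
qed

lemma DERIV_exp_flat: "DERIV (exp_flat p) t :> exp_flat ([:0, 0, 1:] * (p - pderiv p)) t"
proof -
  consider "t > 0" | "t < 0" | "t = 0" by linarith
  then show ?thesis
  proof cases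
    case 1
    have "DERIV (\<lambda>t. poly p (inverse t) * exp (- inverse t)) t :> exp_flat ([:0, 0, 1:] * (p - pderiv p)) t"
      using 1 by (auto intro!: derivative_eq_intros simp: exp_flat_def algebra_simps power2_eq_square)
    moreover have "\<forall>\<^sub>F s in nhds t. exp_flat p s = poly p (inverse s) * exp (- inverse s)"
      using eventually_nhds_in_open[of "{0<..}" t] 1 by (auto simp: exp_flat_def elim: eventually_mono)
    ultimately show ?thesis
      using DERIV_cong_ev[OF refl _ refl, of "exp_flat p" "\<lambda>t. poly p (inverse t) * exp (- inverse t)" t] by blast
  next
    case 2
    have "\<forall>\<^sub>F s in nhds t. exp_flat p s = 0"
      using eventually_nhds_in_open[of "{..<0}" t] 2 by (auto simp: exp_flat_def elim: eventually_mono)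
    then have "DERIV (exp_flat p) t :> 0" using DERIV_cong_ev[OF refl _ refl, of "exp_flat p" "\<lambda>_. 0"] by auto
    then show ?thesis using 2 by (simp add: exp_flat_def)
  next
    case 3
    have "((\<lambda>h. exp_flat p h / h) \<longlongrightarrow> 0) (at_left 0)"
      by (rule tendsto_eventually) (auto simp: exp_flat_def eventually_at_filter)
    moreover have "((\<lambda>h. exp_flat p h / h) \<longlongrightarrow> 0) (at_right 0)"
    proof -
      have "((\<lambda>h. poly (pCons 0 p) (inverse h) * exp (- inverse h)) \<longlongrightarrow> 0) (at_right (0::real))"
        using filterlim_compose[OF poly_exp_tendsto_0 filterlim_inverse_at_top_right] .
      moreover have "\<forall>\<^sub>F h in at_right 0. poly (pCons 0 p) (inverse h) * exp (- inverse h) = exp_flat p h / h"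
        by (auto simp: exp_flat_def eventually_at_filter field_simps)
      ultimately show ?thesis by (rule Lim_transform_eventually)
    qed
    ultimately have "((\<lambda>h. exp_flat p h / h) \<longlongrightarrow> 0) (at 0)"
      by (rule filterlim_split_at)
    then show ?thesis using 3 by (simp add: DERIV_def exp_flat_def)
  qed
qed

lemma Ck_on_exp_flat:
  assumes "openin (Euclidean_space n) W"
  shows "Ck_on n k W u \<Longrightarrow> Ck_on n k W (\<lambda>x. exp_flat p (u x))"
proof (induction k arbitrary: p)
  have c: "continuous_on W (\<lambda>x. exp_flat p (u x))" if "continuous_on W u" for p
    by (rule continuous_on_compose2[OF _ that]) (auto intro!: continuous_at_imp_continuous_on DERIV_isCont[OF DERIV_exp_flat])
  {
    case 0 then show ?case using c by simp
  next
    case (Suc k)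
    show ?case
    proof (rule Ck_on_SucI[OF assms c])
      fix i x assume "i < n" "x \<in> W"
      then show "DERIV (\<lambda>t. exp_flat p (u (x(i := t)))) (x i) :> exp_flat ([:0, 0, 1:] * (p - pderiv p)) (u x) * pdiff i u x"
        using DERIV_chain2[OF DERIV_exp_flat Ck_on_DERIV[OF Suc.prems]] by fastforce
    next
      fix i assume "i < n"
      then show "Ck_on n k W (\<lambda>x. exp_flat ([:0, 0, 1:] * (p - pderiv p)) (u x) * pdiff i u x)"
        by (intro Ck_on_mult[OF assms] Suc.IH Ck_on_Suc_imp[OF Suc.prems] Ck_on_pdiff[OF Suc.prems])
    qed (use Suc.prems in auto)
  }
qed

text \<open>
  With \<open>h\<close> the flat function and \<open>r\<close> the squared distance from \<open>a\<close>, the quotient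
  \<open>h (c - r) / (h (c - r) + h (r - d))\<close> is \<open>1\<close> for \<open>r \<le> d\<close> and \<open>0\<close> for \<open>r \<ge> c\<close>. The denominator is positive because \<open>d < c\<close>.
\<close>

lemma smooth_bump_ebox:
  assumes e: "e > 0"
  obtains b where "\<And>W. openin (Euclidean_space n) W \<Longrightarrow> smooth_on n W b"
    "\<And>x. (\<And>i. i < n \<Longrightarrow> \<bar>x i - a i\<bar> < e / (4 * (real n + 1))) \<Longrightarrow> b x = 1"
    "\<And>x i. b x \<noteq> 0 \<Longrightarrow> i < n \<Longrightarrow> \<bar>x i - a i\<bar> \<le> e / 2"
proof -
  define r where "r x = (\<Sum>i<n. (x i + (- a i)) * (x i + (- a i)))" for x :: "nat \<Rightarrow> real"
  define h where "h = exp_flat 1"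
  \<comment> \<open>\<open>c\<close> is the square of \<open>e / 2\<close>, and \<open>d\<close> exceeds a sum of \<open>n\<close> squares of numbers below \<open>e / (4 * (n + 1))\<close>.\<close>
  define c where "c = e * e / 4"
  define d where "d = e * e / (8 * (real n + 1))"
  define b where "b x = h (c + (- 1) * r x) * inverse (h (c + (- 1) * r x) + h (r x + (- d)))" for x
  have h: "h t > 0 \<longleftrightarrow> t > 0" "h t \<ge> 0" "h t = 0 \<longleftrightarrow> t \<le> 0" for t by (auto simp: h_def exp_flat_def)
  have "d < c" using e by (auto simp: c_def d_def field_simps intro!: add_pos_nonneg)
  have pos: "h (c + (- 1) * r x) + h (r x + (- d)) > 0" for x
  proof (cases "r x < c")
    case True then show ?thesis by (intro add_pos_nonneg) (auto simp: h)
  next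
    case False then show ?thesis using \<open>d < c\<close> by (intro add_nonneg_pos) (auto simp: h)
  qed
  have "smooth_on n W b" if W: "openin (Euclidean_space n) W" for W
  proof -
    have r: "Ck_on n k W r" for k
      unfolding r_def by (intro Ck_on_sum Ck_on_mult Ck_on_add Ck_on_proj Ck_on_const W)
    show ?thesis unfolding smooth_on_def b_def
      by (intro allI Ck_on_mult[OF W] Ck_on_inverse[OF W] pos[THEN less_imp_neq, symmetric]
          Ck_on_exp_flat[OF W, where p=1, folded h_def] Ck_on_add[OF W] Ck_on_const[OF W] r)
  qed
  moreover have "b x = 1" if x: "\<And>i. i < n \<Longrightarrow> \<bar>x i - a i\<bar> < e / (4 * (real n + 1))" for x
  proof -
    have "r x \<le> (\<Sum>i<n. (e / (4 * (real n + 1))) * (e / (4 * (real n + 1))))"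
      unfolding r_def
    proof (rule sum_mono)
      fix i assume "i \<in> {..<n}"
      then show "(x i + (- a i)) * (x i + (- a i)) \<le> (e / (4 * (real n + 1))) * (e / (4 * (real n + 1)))"
        using x[of i] mult_mono'[of "\<bar>x i - a i\<bar>" "e / (4 * (real n + 1))" "\<bar>x i - a i\<bar>" "e / (4 * (real n + 1))"] by simp
    qed
    also have "\<dots> = e * e / (16 * (real n + 1)) * (real n / (real n + 1))"
      by (simp add: field_simps)
    also have "\<dots> \<le> e * e / (16 * (real n + 1)) * 1"
      by (intro mult_left_mono) auto
    also have "\<dots> \<le> d" using e by (simp add: d_def field_simps)
    finally have "r x \<le> d" .
    then show ?thesis using h(3)[of "r x + (- d)"] pos[of x] by (simp add: b_def)
  qed
  moreover have "\<bar>x i - a i\<bar> \<le> e / 2" if "b x \<noteq> 0" "i < n" for x i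
  proof -
    have "r x < c" using that(1) h(3)[of "c + (- 1) * r x"] by (auto simp: b_def)
    moreover have "(x i + (- a i)) * (x i + (- a i)) \<le> r x"
      unfolding r_def by (rule member_le_sum) (use that in auto)
    ultimately have "(x i - a i)\<^sup>2 \<le> (e / 2)\<^sup>2" by (simp add: c_def power2_eq_square)
    then show ?thesis using e abs_le_square_iff[of "x i - a i" "e / 2"] by simp
  qed
  ultimately show ?thesis using that by blast
qed


section \<open>Bump functions and local frames on a smooth manifold\<close>

lemma sum_fun_apply: "(\<Sum>i\<in>I. f i) x = (\<Sum>i\<in>I. f i x)"
  by (induction I rule: infinite_finite_induct) auto

text \<open>
  The algebraic part of the argument needs only an algebra of functions with the constants; \<open>framed_function_algebra\<close> adds what is
  special about smooth functions.
\<close>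

locale function_algebra =
  fixes C :: "('a \<Rightarrow> real) set"
  assumes const_in: "(\<lambda>_. c) \<in> C"
    and add_in: "f \<in> C \<Longrightarrow> g \<in> C \<Longrightarrow> f + g \<in> C"
    and mult_in: "f \<in> C \<Longrightarrow> g \<in> C \<Longrightarrow> f * g \<in> C"
begin

abbreviation "VF \<equiv> vector_fields C"

lemma zero_in [simp]: "0 \<in> C"
  using const_in[of 0] by (simp add: zero_fun_def)

lemma scaleR_in: "f \<in> C \<Longrightarrow> c *\<^sub>R f \<in> C"
  using mult_in[OF const_in[of c]] by (simp add: times_fun_def scaleR_fun_def)

lemma uminus_in: "f \<in> C \<Longrightarrow> - f \<in> C"
  using scaleR_in[of f "-1"] by simp

lemma diff_in: "f \<in> C \<Longrightarrow> g \<in> C \<Longrightarrow> f - g \<in> C"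
  using add_in[of f "- g"] uminus_in by simp

lemma sum_in: "(\<And>i. i \<in> I \<Longrightarrow> f i \<in> C) \<Longrightarrow> sum f I \<in> C"
  by (induction I rule: infinite_finite_induct) (auto intro: add_in)

lemma subspace_C: "subspace C"
  by (simp add: subspace_def add_in scaleR_in)

lemma VF_out: "X \<in> VF \<Longrightarrow> f \<notin> C \<Longrightarrow> X f = 0"
  and VF_in: "X \<in> VF \<Longrightarrow> f \<in> C \<Longrightarrow> X f \<in> C"
  and VF_add: "X \<in> VF \<Longrightarrow> f \<in> C \<Longrightarrow> g \<in> C \<Longrightarrow> X (f + g) = X f + X g"
  and VF_scaleR: "X \<in> VF \<Longrightarrow> f \<in> C \<Longrightarrow> X (c *\<^sub>R f) = c *\<^sub>R X f"
  and VF_mult: "X \<in> VF \<Longrightarrow> f \<in> C \<Longrightarrow> g \<in> C \<Longrightarrow> X (f * g) = X f * g + f * X g"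
  unfolding vector_fields_def by blast+

lemma VF_0: "X \<in> VF \<Longrightarrow> X 0 = 0"
  using VF_scaleR[of X 0 0] by simp

lemma VF_uminus: "X \<in> VF \<Longrightarrow> f \<in> C \<Longrightarrow> X (- f) = - X f"
  using VF_scaleR[of X f "-1"] by simp

lemma VF_diff: "X \<in> VF \<Longrightarrow> f \<in> C \<Longrightarrow> g \<in> C \<Longrightarrow> X (f - g) = X f - X g"
  using VF_add[of X f "- g"] VF_uminus[of X g] uminus_in[of g] by (simp only: diff_conv_add_uminus)

lemma VF_sum: "X \<in> VF \<Longrightarrow> (\<And>i. i \<in> I \<Longrightarrow> f i \<in> C) \<Longrightarrow> X (sum f I) = (\<Sum>i\<in>I. X (f i))"
  by (induction I rule: infinite_finite_induct) (auto simp: VF_0 VF_add sum_in)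

lemma VF_const: "X \<in> VF \<Longrightarrow> X (\<lambda>_. c) = 0"
proof -
  assume X: "X \<in> VF"
  have "X ((\<lambda>_. 1) * (\<lambda>_. 1)) = X (\<lambda>_. 1) * (\<lambda>_. 1) + (\<lambda>_. 1) * X (\<lambda>_. 1)"
    by (rule VF_mult[OF X const_in const_in])
  then have "X (\<lambda>_. 1) = 0" by (simp add: times_fun_def fun_eq_iff)
  then show ?thesis using VF_scaleR[OF X const_in, of c 1] by (simp add: scaleR_fun_def zero_fun_def)
qed

end

text \<open>
  These three properties are all that is used of a manifold: membership is a local condition, there are bump functions, and
  near each point the vector fields have finite coordinates. The \<open>x i\<close> and \<open>E i\<close> are defined globally, as cut-offs of coordinates
  and coordinate fields, which avoids restricting derivations to open sets.
\<close>

locale framed_function_algebra = function_algebra C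
  for C :: "('a::topological_space \<Rightarrow> real) set" +
  assumes locality: "(\<And>p. \<exists>U g. open U \<and> p \<in> U \<and> g \<in> C \<and> (\<forall>q\<in>U. f q = g q)) \<Longrightarrow> f \<in> C"
    and bump: "open U \<Longrightarrow> p \<in> U \<Longrightarrow>
      \<exists>\<rho>\<in>C. \<exists>V. open V \<and> p \<in> V \<and> V \<subseteq> U \<and> (\<forall>q\<in>V. \<rho> q = 1) \<and> (\<forall>q. q \<notin> U \<longrightarrow> \<rho> q = 0)"
    and frame: "\<exists>U (m::nat) x E. open U \<and> p \<in> U \<and> (\<forall>i<m. x i \<in> C \<and> E i \<in> vector_fields C) \<and>
      (\<forall>X\<in>vector_fields C. \<forall>f\<in>C. \<forall>q\<in>U. X f q = (\<Sum>i<m. X (x i) q * E i f q))"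


lemma smooth_on_Ck: "smooth_on n W f \<Longrightarrow> V \<subseteq> W \<Longrightarrow> Ck_on n k V f"
  unfolding smooth_on_def by (blast intro: Ck_on_subset)

lemma chart_facts:
  assumes "chart n U \<phi>"
  shows "open U" "inj_on \<phi> U" "openin (Euclidean_space n) (\<phi> ` U)"
    and "\<And>W. open W \<Longrightarrow> W \<subseteq> U \<Longrightarrow> openin (Euclidean_space n) (\<phi> ` W)"
    and "\<And>V. openin (Euclidean_space n) V \<Longrightarrow> open {q\<in>U. \<phi> q \<in> V}"
    and "continuous_on (\<phi> ` U) (inv_into U \<phi>)"
proof -
  have h: "homeomorphic_map (top_of_set U) (subtopology (Euclidean_space n) (\<phi> ` U)) \<phi>"
    and o: "open U" "openin (Euclidean_space n) (\<phi> ` U)" using assms by (auto simp: chart_def)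
  have sub: "\<phi> ` U \<subseteq> {x. \<forall>i\<ge>n. x i = 0}" using openin_Euclidean_subset[OF o(2)] by blast
  have st: "subtopology (Euclidean_space n) (\<phi> ` U) = top_of_set (\<phi> ` U)"
    using sub unfolding Euclidean_space_alt subtopology_subtopology by (simp add: Int_absorb1)
  show "open U" "openin (Euclidean_space n) (\<phi> ` U)" using o .
  show inj: "inj_on \<phi> U" using homeomorphic_imp_injective_map[OF h] by simp
  show "openin (Euclidean_space n) (\<phi> ` W)" if "open W" "W \<subseteq> U" for W
  proof -
    have "openin (top_of_set U) W" using that by (simp add: open_subset)
    then have "openin (subtopology (Euclidean_space n) (\<phi> ` U)) (\<phi> ` W)"
      using homeomorphic_imp_open_map[OF h] by (simp add: open_map_def)
    then show ?thesis using o(2) openin_trans_full by blast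
  qed
  show "open {q\<in>U. \<phi> q \<in> V}" if V: "openin (Euclidean_space n) V" for V
  proof -
    have "openin (subtopology (Euclidean_space n) (\<phi> ` U)) (\<phi> ` U \<inter> V)"
      using V by (auto simp: openin_subtopology)
    then have "openin (top_of_set U) {q \<in> topspace (top_of_set U). \<phi> q \<in> \<phi> ` U \<inter> V}"
      using homeomorphic_imp_continuous_map[OF h] by (auto simp: continuous_map_def)
    moreover have "{q \<in> topspace (top_of_set U). \<phi> q \<in> \<phi> ` U \<inter> V} = {q\<in>U. \<phi> q \<in> V}" by auto
    ultimately show ?thesis using o(1) openin_open_trans by metis
  qed
  obtain g where "homeomorphic_maps (top_of_set U) (top_of_set (\<phi> ` U)) \<phi> g"
    using h st by (auto simp: homeomorphic_map_maps)
  then have g: "continuous_on (\<phi> ` U) g" "\<forall>x\<in>U. g (\<phi> x) = x" by (auto simp: homeomorphic_maps_def)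
  show "continuous_on (\<phi> ` U) (inv_into U \<phi>)"
    using g inj by (subst continuous_on_cong[OF refl, of _ _ g]) auto
qed

text \<open>
  The function on the manifold that is \<open>u\<close> in the chart \<open>\<phi>\<close> over \<open>B\<close> and zero elsewhere.
\<close>

definition extend_by_zero :: "'a set \<Rightarrow> ('a \<Rightarrow> nat \<Rightarrow> real) \<Rightarrow> (nat \<Rightarrow> real) set \<Rightarrow> ((nat \<Rightarrow> real) \<Rightarrow> real) \<Rightarrow> 'a \<Rightarrow> real" where
  "extend_by_zero U \<phi> B u q = (if q \<in> U \<and> \<phi> q \<in> B then u (\<phi> q) else 0)"

context
  fixes n :: nat and \<A> :: "'a::{t2_space, second_countable_topology} atlas"
  assumes M: "smooth_manifold n \<A>"
begin

lemma atlas_chart: "(U, \<phi>) \<in> \<A> \<Longrightarrow> chart n U \<phi>"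
  using M by (auto simp: smooth_manifold_def)

lemma atlas_cover: obtains U \<phi> where "(U, \<phi>) \<in> \<A>" "p \<in> U"
proof -
  have "\<exists>(U, \<phi>)\<in>\<A>. p \<in> U" using M unfolding smooth_manifold_def by (elim conjE allE)
  then show ?thesis using that by auto
qed

text \<open>
  Smoothness in one chart around each point suffices: a change of charts is smooth, so this is the chain rule.
\<close>

lemma smooth_functionsI:
  assumes "\<And>p. \<exists>U \<phi> W. (U, \<phi>) \<in> \<A> \<and> open W \<and> p \<in> W \<and> W \<subseteq> U \<and>
    smooth_on n (\<phi> ` W) (\<lambda>x. f (inv_into U \<phi> x))"
  shows "f \<in> smooth_functions n \<A>"
  unfolding smooth_functions_def smooth_on_def
proof clarify
  fix V \<psi> k assume V: "(V, \<psi>) \<in> \<A>"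
  note cV = chart_facts[OF atlas_chart[OF V]]
  show "Ck_on n k (\<psi> ` V) (\<lambda>x. f (inv_into V \<psi> x))"
  proof (rule Ck_on_local[OF cV(3)])
    fix y assume "y \<in> \<psi> ` V"
    then obtain p where p: "p \<in> V" "y = \<psi> p" by blast
    obtain U \<phi> W where U: "(U, \<phi>) \<in> \<A>" and W: "open W" "p \<in> W" "W \<subseteq> U"
      and s: "smooth_on n (\<phi> ` W) (\<lambda>x. f (inv_into U \<phi> x))" using assms[of p] by blast
    note cU = chart_facts[OF atlas_chart[OF U]]
    have o: "openin (Euclidean_space n) (\<psi> ` (V \<inter> W))" using W(1) cV(1) by (intro cV(4)) auto
    have inv: "inv_into V \<psi> x \<in> V \<inter> W" if "x \<in> \<psi> ` (V \<inter> W)" for x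
      using that cV(2) by auto
    have "Ck_on n k (\<psi> ` (V \<inter> W)) (\<lambda>x. f (inv_into U \<phi> (\<phi> (inv_into V \<psi> x))))"
    proof (rule Ck_on_compose[where V="\<phi> ` W" and F="\<lambda>x. f (inv_into U \<phi> x)" and G="\<lambda>x. \<phi> (inv_into V \<psi> x)"])
      show "openin (Euclidean_space n) (\<phi> ` W)" using W cU(4) by blast
      show "Ck_on n k (\<phi> ` W) (\<lambda>x. f (inv_into U \<phi> x))" using s by (simp add: smooth_on_def)
      fix j assume "j < n"
      then have "smooth_on n (\<psi> ` (V \<inter> U)) (\<lambda>x. \<phi> (inv_into V \<psi> x) j)"
        using M U V unfolding smooth_manifold_def by (elim conjE) (drule (1) bspec, simp, drule (1) bspec, simp)
      then show "Ck_on n k (\<psi> ` (V \<inter> W)) (\<lambda>x. \<phi> (inv_into V \<psi> x) j)"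
        by (rule smooth_on_Ck) (use W in auto)
    qed (use o inv in auto)
    then have "Ck_on n k (\<psi> ` (V \<inter> W)) (\<lambda>x. f (inv_into V \<psi> x))"
      by (rule Ck_on_cong[OF o]) (use inv W(3) cU(2) in \<open>auto simp: subset_iff\<close>)
    then show "\<exists>Z. openin (Euclidean_space n) Z \<and> y \<in> Z \<and> Z \<subseteq> \<psi> ` V \<and> Ck_on n k Z (\<lambda>x. f (inv_into V \<psi> x))"
      using o p W(2) by (intro exI[of _ "\<psi> ` (V \<inter> W)"]) auto
  qed
qed

lemma smooth_functionsD:
  "f \<in> smooth_functions n \<A> \<Longrightarrow> (U, \<phi>) \<in> \<A> \<Longrightarrow> Ck_on n k (\<phi> ` U) (\<lambda>x. f (inv_into U \<phi> x))"
  by (auto simp: smooth_functions_def smooth_on_def)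

lemma function_algebra_smooth: "function_algebra (smooth_functions n \<A>)"
proof
  note o = chart_facts(3)[OF atlas_chart]
  show "(\<lambda>_. c) \<in> smooth_functions n \<A>" for c
    by (auto simp: smooth_functions_def smooth_on_def intro!: Ck_on_const o)
  fix f g assume "f \<in> smooth_functions n \<A>" "g \<in> smooth_functions n \<A>"
  note fg = smooth_functionsD[OF this(1)] smooth_functionsD[OF this(2)]
  show "f + g \<in> smooth_functions n \<A>" "f * g \<in> smooth_functions n \<A>"
    unfolding smooth_functions_def smooth_on_def
    by (auto intro!: Ck_on_add o fg Ck_on_mult simp: plus_fun_def times_fun_def)
qed

interpretation function_algebra "smooth_functions n \<A>"
  by (rule function_algebra_smooth)

lemma smooth_functions_local:
  assumes "\<And>p. \<exists>U g. open U \<and> p \<in> U \<and> g \<in> smooth_functions n \<A> \<and> (\<forall>q\<in>U. f q = g q)"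
  shows "f \<in> smooth_functions n \<A>"
proof (rule smooth_functionsI)
  fix p
  obtain W g where W: "open W" "p \<in> W" "g \<in> smooth_functions n \<A>" "\<forall>q\<in>W. f q = g q" using assms by blast
  obtain U \<phi> where U: "(U, \<phi>) \<in> \<A>" "p \<in> U" by (rule atlas_cover)
  note cU = chart_facts[OF atlas_chart[OF U(1)]]
  have o: "openin (Euclidean_space n) (\<phi> ` (U \<inter> W))" using W(1) cU(1) by (intro cU(4)) auto
  have "Ck_on n k (\<phi> ` (U \<inter> W)) (\<lambda>x. f (inv_into U \<phi> x))" for k
    by (rule Ck_on_cong[OF o Ck_on_subset[OF smooth_functionsD[OF W(3) U(1)]]])
      (use W(4) cU(2) in auto)
  then show "\<exists>U \<phi> W. (U, \<phi>) \<in> \<A> \<and> open W \<and> p \<in> W \<and> W \<subseteq> U \<and> smooth_on n (\<phi> ` W) (\<lambda>x. f (inv_into U \<phi> x))"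
    using U W(1,2) cU(1) by (intro exI[of _ U] exI[of _ \<phi>] exI[of _ "U \<inter> W"]) (auto simp: smooth_on_def)
qed

lemma compact_box: "compact {y. (\<forall>i\<ge>n. y i = 0) \<and> (\<forall>i<n. \<bar>y i - a i\<bar> \<le> (r::real))}"
proof -
  have "compactin (product_topology (\<lambda>i. euclidean) UNIV)
      (\<Pi>\<^sub>E i\<in>UNIV. if i < n then {a i - r .. a i + r} else {0})"
    unfolding compactin_PiE by auto
  moreover have "(\<Pi>\<^sub>E i\<in>UNIV. if i < n then {a i - r .. a i + r} else {0}) =
      {y. (\<forall>i\<ge>n. y i = 0) \<and> (\<forall>i<n. \<bar>y i - a i\<bar> \<le> r)}"
  proof (intro set_eqI)
    fix y :: "nat \<Rightarrow> real"
    have "y i \<in> (if i < n then {a i - r .. a i + r} else {0}) \<longleftrightarrow> (n \<le> i \<longrightarrow> y i = 0) \<and> (i < n \<longrightarrow> \<bar>y i - a i\<bar> \<le> r)" for i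
      by (auto simp: abs_le_iff)
    then show "y \<in> (\<Pi>\<^sub>E i\<in>UNIV. if i < n then {a i - r .. a i + r} else {0}) \<longleftrightarrow>
        y \<in> {y. (\<forall>i\<ge>n. y i = 0) \<and> (\<forall>i<n. \<bar>y i - a i\<bar> \<le> r)}"
      by (auto simp: PiE_iff)
  qed
  ultimately show ?thesis by (simp add: euclidean_product_topology)
qed

text \<open>
  A bump function on a coordinate box turns functions on the box into global smooth functions. This is where the Hausdorff property
  enters: the support is compact in the chart and therefore closed in the manifold.
\<close>

lemma chart_cutoff:
  assumes U: "(U, \<phi>) \<in> \<A>" and p: "p \<in> U" and N: "open N" "p \<in> N"
  obtains e b V where "e > 0" "ebox n (\<phi> p) e \<subseteq> \<phi> ` (U \<inter> N)"
    "open V" "p \<in> V" "V \<subseteq> N" "\<And>q. q \<in> V \<Longrightarrow> q \<in> U \<and> \<phi> q \<in> ebox n (\<phi> p) e \<and> b (\<phi> q) = 1"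
    "\<And>u. smooth_on n (ebox n (\<phi> p) e) u \<Longrightarrow>
      extend_by_zero U \<phi> (ebox n (\<phi> p) e) (\<lambda>y. b y * u y) \<in> smooth_functions n \<A>"
proof -
  note cU = chart_facts[OF atlas_chart[OF U]]
  have o: "openin (Euclidean_space n) (\<phi> ` (U \<inter> N))" using N(1) cU(1) by (intro cU(4)) auto
  obtain e where e: "e > 0" "ebox n (\<phi> p) e \<subseteq> \<phi> ` (U \<inter> N)"
    using openin_contains_ebox[OF o] p N(2) by blast
  obtain b where b: "\<And>W. openin (Euclidean_space n) W \<Longrightarrow> smooth_on n W b"
    "\<And>x. (\<And>i. i < n \<Longrightarrow> \<bar>x i - \<phi> p i\<bar> < e / (4 * (real n + 1))) \<Longrightarrow> b x = 1"
    "\<And>x i. b x \<noteq> 0 \<Longrightarrow> i < n \<Longrightarrow> \<bar>x i - \<phi> p i\<bar> \<le> e / 2"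
    using smooth_bump_ebox[OF e(1)] by metis
  define B where "B = ebox n (\<phi> p) e"
  define B' where "B' = ebox n (\<phi> p) (e / (4 * (real n + 1)))"
  define V where "V = {q\<in>U. \<phi> q \<in> B'}"
  have small: "e / (4 * (real n + 1)) \<le> e" using e(1) by (simp add: field_simps)
  have B'B: "B' \<subseteq> B" using small by (force simp: B'_def B_def ebox_def)
  have V1: "open V" unfolding V_def B'_def by (intro cU(5) openin_ebox)
  have V2: "p \<in> V"
    using p e(1) openin_Euclidean_subset[OF cU(3)] by (auto simp: V_def B'_def ebox_def)
  have V3: "V \<subseteq> N"
  proof
    fix q assume "q \<in> V"
    then have q: "q \<in> U" "\<phi> q \<in> \<phi> ` (U \<inter> N)" using B'B e(2) by (auto simp: V_def B_def)
    then show "q \<in> N" using cU(2) by (auto dest: inj_onD)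
  qed
  have V4: "q \<in> U \<and> \<phi> q \<in> B \<and> b (\<phi> q) = 1" if "q \<in> V" for q
    using that B'B b(2)[of "\<phi> q"] by (auto simp: V_def B'_def ebox_def)
  have V5: "extend_by_zero U \<phi> B (\<lambda>y. b y * u y) \<in> smooth_functions n \<A>" (is "?f \<in> _")
    if u: "smooth_on n B u" for u
  proof (rule smooth_functionsI)
    fix q
    define K where "K = inv_into U \<phi> ` {y. (\<forall>i\<ge>n. y i = 0) \<and> (\<forall>i<n. \<bar>y i - \<phi> p i\<bar> \<le> e / 2)}"
    have KB: "{y. (\<forall>i\<ge>n. y i = 0) \<and> (\<forall>i<n. \<bar>y i - \<phi> p i\<bar> \<le> e / 2)} \<subseteq> B"
      using e(1) by (fastforce simp: B_def ebox_def)
    have "compact K" unfolding K_def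
    proof (rule compact_continuous_image[OF _ compact_box])
      show "continuous_on {y. (\<forall>i\<ge>n. y i = 0) \<and> (\<forall>i<n. \<bar>y i - \<phi> p i\<bar> \<le> e / 2)} (inv_into U \<phi>)"
        using cU(6) by (rule continuous_on_subset) (use KB e(2) in \<open>unfold B_def, blast\<close>)
    qed
    then have "closed K" by (rule compact_imp_closed)
    have f0: "?f q' = 0" if "q' \<notin> K" for q'
    proof (rule ccontr)
      assume "?f q' \<noteq> 0"
      then have q': "q' \<in> U" "\<phi> q' \<in> B" "b (\<phi> q') \<noteq> 0" by (auto simp: extend_by_zero_def split: if_splits)
      then have "\<phi> q' \<in> {y. (\<forall>i\<ge>n. y i = 0) \<and> (\<forall>i<n. \<bar>y i - \<phi> p i\<bar> \<le> e / 2)}"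
        using b(3) by (auto simp: B_def ebox_def)
      then have "inv_into U \<phi> (\<phi> q') \<in> K" unfolding K_def by blast
      then show False using q' that cU(2) by simp
    qed
    show "\<exists>U \<phi> W. (U, \<phi>) \<in> \<A> \<and> open W \<and> q \<in> W \<and> W \<subseteq> U \<and> smooth_on n (\<phi> ` W) (\<lambda>x. ?f (inv_into U \<phi> x))"
    proof (cases "q \<in> U \<and> \<phi> q \<in> B")
      case True
      define W where "W = {q\<in>U. \<phi> q \<in> B}"
      have W: "open W" "q \<in> W" "W \<subseteq> U"
        using True cU(5)[OF openin_ebox] by (auto simp: W_def B_def)
      have o: "openin (Euclidean_space n) (\<phi> ` W)" using W cU(4) by blast
      have "Ck_on n k (\<phi> ` W) (\<lambda>x. ?f (inv_into U \<phi> x))" for k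
      proof (rule Ck_on_cong[OF o])
        have "Ck_on n k (\<phi> ` W) u"
          using u by (rule smooth_on_Ck) (auto simp: W_def)
        then show "Ck_on n k (\<phi> ` W) (\<lambda>y. b y * u y)"
          using b(1)[OF o] by (intro Ck_on_mult o) (auto simp: smooth_on_def)
        show "b y * u y = ?f (inv_into U \<phi> y)" if "y \<in> \<phi> ` W" for y
          using that cU(2) by (auto simp: W_def extend_by_zero_def)
      qed
      then show ?thesis using U W by (intro exI[of _ U] exI[of _ \<phi>] exI[of _ W]) (auto simp: smooth_on_def)
    next
      case False
      have "q \<notin> K"
      proof
        assume "q \<in> K"
        then obtain y where y: "y \<in> B" "q = inv_into U \<phi> y" using KB unfolding K_def by blast
        have "y \<in> \<phi> ` U" using y(1) e(2) unfolding B_def by blast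
        then show False using False y inv_into_into[of y \<phi> U] f_inv_into_f[of y \<phi> U] by simp
      qed
      obtain U' \<phi>' where U': "(U', \<phi>') \<in> \<A>" "q \<in> U'" by (rule atlas_cover)
      note c' = chart_facts[OF atlas_chart[OF U'(1)]]
      define W where "W = U' \<inter> - K"
      have W: "open W" "q \<in> W" "W \<subseteq> U'"
        using U'(2) \<open>q \<notin> K\<close> \<open>closed K\<close> c'(1) by (auto simp: W_def)
      have o: "openin (Euclidean_space n) (\<phi>' ` W)" using W c'(4) by blast
      have "Ck_on n k (\<phi>' ` W) (\<lambda>x. ?f (inv_into U' \<phi>' x))" for k
        by (rule Ck_on_cong[OF o Ck_on_const[OF o, of _ 0]]) (use c'(2) f0 in \<open>auto simp: W_def\<close>)
      then show ?thesis using U' W by (intro exI[of _ U'] exI[of _ \<phi>'] exI[of _ W]) (auto simp: smooth_on_def)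
    qed
  qed
  show ?thesis by (rule that[of e V b, OF e V1 V2 V3 V4[unfolded B_def] V5[unfolded B_def]])
qed

lemma smooth_functions_bump:
  assumes "open N" "p \<in> N"
  shows "\<exists>\<rho>\<in>smooth_functions n \<A>. \<exists>V. open V \<and> p \<in> V \<and> V \<subseteq> N \<and> (\<forall>q\<in>V. \<rho> q = 1) \<and> (\<forall>q. q \<notin> N \<longrightarrow> \<rho> q = 0)"
proof -
  obtain U \<phi> where U: "(U, \<phi>) \<in> \<A>" "p \<in> U" by (rule atlas_cover)
  obtain e b V where *: "e > 0" "ebox n (\<phi> p) e \<subseteq> \<phi> ` (U \<inter> N)"
    "open V" "p \<in> V" "V \<subseteq> N" "\<And>q. q \<in> V \<Longrightarrow> q \<in> U \<and> \<phi> q \<in> ebox n (\<phi> p) e \<and> b (\<phi> q) = 1"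
    "\<And>u. smooth_on n (ebox n (\<phi> p) e) u \<Longrightarrow>
      extend_by_zero U \<phi> (ebox n (\<phi> p) e) (\<lambda>y. b y * u y) \<in> smooth_functions n \<A>"
    by (rule chart_cutoff[OF U assms]) blast
  define \<rho> where "\<rho> = extend_by_zero U \<phi> (ebox n (\<phi> p) e) (\<lambda>y. b y * 1)"
  have "\<rho> \<in> smooth_functions n \<A>"
    unfolding \<rho>_def by (rule *(7)) (auto simp: smooth_on_def intro!: Ck_on_const openin_ebox)
  moreover have "\<rho> q = 1" if "q \<in> V" for q using *(6)[OF that] by (simp add: \<rho>_def extend_by_zero_def)
  moreover have "\<rho> q = 0" if "q \<notin> N" for q
    using that *(2) chart_facts(2)[OF atlas_chart[OF U(1)]]
    by (auto simp: \<rho>_def extend_by_zero_def dest: inj_onD)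
  ultimately show ?thesis using *(3-5) by blast
qed

text \<open>
  The \<open>x i\<close> and \<open>E i\<close> are cut-off coordinates and partial derivatives. A derivation is determined by its values on coordinates: by
  Hadamard's lemma \<open>f = f q + (\<Sum>i. (x i - x i q) * g i)\<close> near \<open>q\<close> with \<open>g i q = E i f q\<close>, and only the factors that vanish at \<open>q\<close>
  need to be differentiated.
\<close>

lemma smooth_functions_frame:
  "\<exists>N (m::nat) x E. open N \<and> p \<in> N \<and>
    (\<forall>i<m. x i \<in> smooth_functions n \<A> \<and> E i \<in> vector_fields (smooth_functions n \<A>)) \<and>
    (\<forall>X\<in>vector_fields (smooth_functions n \<A>). \<forall>f\<in>smooth_functions n \<A>. \<forall>q\<in>N.
       X f q = (\<Sum>i<m. X (x i) q * E i f q))"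
proof -
  let ?C = "smooth_functions n \<A>"
  obtain U \<phi> where U: "(U, \<phi>) \<in> \<A>" "p \<in> U" by (rule atlas_cover)
  note cU = chart_facts[OF atlas_chart[OF U(1)]]
  obtain e b V where V: "e > 0" "ebox n (\<phi> p) e \<subseteq> \<phi> ` (U \<inter> UNIV)"
    "open V" "p \<in> V" "\<And>q. q \<in> V \<Longrightarrow> q \<in> U \<and> \<phi> q \<in> ebox n (\<phi> p) e \<and> b (\<phi> q) = 1"
    "\<And>u. smooth_on n (ebox n (\<phi> p) e) u \<Longrightarrow>
      extend_by_zero U \<phi> (ebox n (\<phi> p) e) (\<lambda>y. b y * u y) \<in> ?C"
    by (rule chart_cutoff[OF U open_UNIV UNIV_I]) blast
  define B where "B = ebox n (\<phi> p) e"
  define F where "F f = (\<lambda>y. f (inv_into U \<phi> y))" for f :: "'a \<Rightarrow> real"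
  have CkF: "Ck_on n k (\<phi> ` U) (F f)" if "f \<in> ?C" for f k
    using smooth_functionsD[OF that U(1)] by (simp add: F_def)
  have D: "DERIV (\<lambda>t. F f (y(i := t))) (y i) :> pdiff i (F f) y" if "f \<in> ?C" "y \<in> \<phi> ` U" "i < n" for f y i
    using Ck_on_DERIV[OF CkF[OF that(1)] that(3,2)] .
  define x where "x i = extend_by_zero U \<phi> B (\<lambda>y. b y * y i)" for i
  define E where "E i f = (if f \<in> ?C then extend_by_zero U \<phi> B (\<lambda>y. b y * pdiff i (F f) y) else 0)" for i f
  have x: "x i \<in> ?C" for i
    unfolding x_def B_def by (rule V) (auto simp: smooth_on_def intro!: Ck_on_proj openin_ebox)
  have E: "E i \<in> vector_fields ?C" if i: "i < n" for i
    unfolding vector_fields_def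
  proof (intro CollectI conjI allI impI ballI)
    fix f g c assume f: "f \<in> ?C"
    have "B \<subseteq> \<phi> ` U" using V(2) by (simp add: B_def)
    then have "smooth_on n B (pdiff i (F f))" unfolding smooth_on_def
      using Ck_on_subset[OF Ck_on_pdiff[OF CkF[OF f] i]] by blast
    then show "E i f \<in> ?C" using f V(6) by (simp add: E_def B_def)
    have "pdiff i (F (c *\<^sub>R f)) (\<phi> q) = c * pdiff i (F f) (\<phi> q)" if "q \<in> U" for q
      unfolding pdiff_def[of i "F (c *\<^sub>R f)"]
      by (rule DERIV_imp_deriv) (use DERIV_cmult[OF D[OF f imageI[OF that] i], of c] in \<open>simp add: F_def scaleR_fun_def\<close>)
    then show "E i (c *\<^sub>R f) = c *\<^sub>R E i f"
      using f scaleR_in[OF f] by (auto simp: E_def extend_by_zero_def scaleR_fun_def fun_eq_iff)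
    assume g: "g \<in> ?C"
    have "pdiff i (F (f + g)) (\<phi> q) = pdiff i (F f) (\<phi> q) + pdiff i (F g) (\<phi> q)" if "q \<in> U" for q
      unfolding pdiff_def[of i "F (f + g)"]
      by (rule DERIV_imp_deriv) (use DERIV_add[OF D[OF f imageI[OF that] i] D[OF g imageI[OF that] i]] in \<open>simp add: F_def plus_fun_def\<close>)
    then show "E i (f + g) = E i f + E i g"
      using f g add_in[OF f g] by (auto simp: E_def extend_by_zero_def plus_fun_def fun_eq_iff algebra_simps)
    have "pdiff i (F (f * g)) (\<phi> q) = pdiff i (F f) (\<phi> q) * F g (\<phi> q) + pdiff i (F g) (\<phi> q) * F f (\<phi> q)" if "q \<in> U" for q
      unfolding pdiff_def[of i "F (f * g)"]
      by (rule DERIV_imp_deriv) (use DERIV_mult[OF D[OF f imageI[OF that] i] D[OF g imageI[OF that] i]] in \<open>simp add: F_def times_fun_def fun_upd_triv del: fun_upd_apply\<close>)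
    then show "E i (f * g) = E i f * g + f * E i g"
      using f g mult_in[OF f g] cU(2)
      by (auto simp: E_def extend_by_zero_def plus_fun_def times_fun_def fun_eq_iff algebra_simps F_def)
  qed (simp add: E_def)
  have "X f q = (\<Sum>i<n. X (x i) q * E i f q)" if X: "X \<in> vector_fields ?C" and f: "f \<in> ?C" and q: "q \<in> V" for X f q
  proof -
    have qU: "q \<in> U" using V(5)[OF q] by blast
    obtain e' b' V' where V': "e' > 0" "ebox n (\<phi> q) e' \<subseteq> \<phi> ` (U \<inter> V)"
      "q \<in> V'" "\<And>q'. q' \<in> V' \<Longrightarrow> q' \<in> U \<and> \<phi> q' \<in> ebox n (\<phi> q) e' \<and> b' (\<phi> q') = 1"
      "\<And>u. smooth_on n (ebox n (\<phi> q) e') u \<Longrightarrow>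
        extend_by_zero U \<phi> (ebox n (\<phi> q) e') (\<lambda>y. b' y * u y) \<in> ?C"
      by (rule chart_cutoff[OF U(1) qU V(3) q]) blast
    define B' where "B' = ebox n (\<phi> q) e'"
    define g where "g i = ray_integral (\<phi> q) 0 (pdiff i (F f))" for i
    define \<rho> where "\<rho> = extend_by_zero U \<phi> B' (\<lambda>y. b' y * 1)"
    define h where "h i = extend_by_zero U \<phi> B' (\<lambda>y. b' y * g i y)" for i
    define k where "k i = \<rho> * (x i - (\<lambda>_. \<phi> q i))" for i
    have a0: "\<And>i. i \<ge> n \<Longrightarrow> \<phi> q i = 0" using openin_Euclidean_subset[OF cU(3)] qU by blast
    have F_B': "Ck_on n k B' (F f)" for k
      by (rule Ck_on_subset[OF CkF[OF f]]) (use V'(2) in \<open>unfold B'_def, blast\<close>)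
    have \<rho>: "\<rho> \<in> ?C" unfolding \<rho>_def B'_def
      by (rule V') (auto simp: smooth_on_def intro!: Ck_on_const openin_ebox)
    have h: "h i \<in> ?C" if "i < n" for i unfolding h_def B'_def
      by (rule V') (auto simp: smooth_on_def g_def intro!: Ck_on_ray_integral a0 Ck_on_pdiff[OF F_B'[unfolded B'_def] that])
    have k: "k i \<in> ?C" for i unfolding k_def by (intro mult_in \<rho> diff_in x const_in)
    have \<rho>q: "\<rho> q = 1" using V'(4)[OF V'(3)] by (simp add: \<rho>_def extend_by_zero_def B'_def)
    have xq: "x i q' = \<phi> q' i" if "q' \<in> V" for i q'
      using V(5)[OF that] by (simp add: x_def extend_by_zero_def B_def)
    have kq: "k i q = 0" for i by (simp add: k_def xq[OF q])
    have hq: "h i q = E i f q" for i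
      using V'(4)[OF V'(3)] V(5)[OF q] f by (simp add: h_def extend_by_zero_def B'_def B_def g_def ray_integral_center E_def)
    have in_V: "q' \<in> V" if "q' \<in> U" "\<phi> q' \<in> B'" for q'
      using that V'(2) cU(2) by (auto simp: B'_def dest: inj_onD)
    \<comment> \<open>Hadamard's expansion, multiplied by \<open>\<rho> * \<rho>\<close> to make it an identity of global smooth functions; \<open>\<rho>\<close> is \<open>1\<close> near \<open>q\<close>.\<close>
    have "(\<rho> * \<rho>) * f = (\<rho> * \<rho>) * (\<lambda>_. f q) + (\<Sum>i<n. k i * h i)"
    proof
      fix q'
      show "((\<rho> * \<rho>) * f) q' = ((\<rho> * \<rho>) * (\<lambda>_. f q) + (\<Sum>i<n. k i * h i)) q'"
      proof (cases "q' \<in> U \<and> \<phi> q' \<in> B'")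
        case True
        have "F f (\<phi> q') = F f (\<phi> q) + (\<Sum>i<n. (\<phi> q' i - \<phi> q i) * g i (\<phi> q'))"
          unfolding g_def by (rule Hadamard[OF a0 V'(1) F_B'[unfolded B'_def]]) (use True in \<open>auto simp: B'_def\<close>)
        then have "f q' = f q + (\<Sum>i<n. (\<phi> q' i - \<phi> q i) * g i (\<phi> q'))"
          using True qU cU(2) by (simp add: F_def)
        moreover have "(\<Sum>i<n. k i * h i) q' = \<rho> q' * \<rho> q' * (\<Sum>i<n. (\<phi> q' i - \<phi> q i) * g i (\<phi> q'))"
          using True xq[OF in_V] by (simp add: k_def h_def \<rho>_def extend_by_zero_def sum_fun_apply sum_distrib_left mult_ac)
        ultimately show ?thesis by (simp add: algebra_simps)
      next
        case False
        then have "\<rho> q' = 0" by (auto simp: \<rho>_def extend_by_zero_def)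
        then show ?thesis by (simp add: k_def sum_fun_apply)
      qed
    qed
    then have "X ((\<rho> * \<rho>) * f) q = X ((\<rho> * \<rho>) * (\<lambda>_. f q) + (\<Sum>i<n. k i * h i)) q" by simp
    moreover have "X ((\<rho> * \<rho>) * f) q = X (\<rho> * \<rho>) q * f q + X f q"
      using VF_mult[OF X mult_in[OF \<rho> \<rho>] f] \<rho>q by simp
    moreover have "X ((\<rho> * \<rho>) * (\<lambda>_. f q) + (\<Sum>i<n. k i * h i)) = X ((\<rho> * \<rho>) * (\<lambda>_. f q)) + (\<Sum>i<n. X (k i * h i))"
    proof -
      have "X (\<Sum>i<n. k i * h i) = (\<Sum>i<n. X (k i * h i))"
        by (rule VF_sum[OF X]) (auto intro: mult_in k h)
      then show ?thesis
        by (subst VF_add[OF X]) (auto intro!: mult_in sum_in k h \<rho> const_in)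
    qed
    moreover have "X ((\<rho> * \<rho>) * (\<lambda>_. f q)) q = X (\<rho> * \<rho>) q * f q"
      using VF_mult[OF X mult_in[OF \<rho> \<rho>] const_in] VF_const[OF X] by simp
    moreover have "(\<Sum>i<n. X (k i * h i)) q = (\<Sum>i<n. X (x i) q * E i f q)"
    proof -
      have "X (k i * h i) q = X (x i) q * E i f q" if "i < n" for i
      proof -
        have "X (k i * h i) q = X (k i) q * h i q"
          using VF_mult[OF X k h[OF that]] kq by simp
        also have "X (k i) q = X (x i) q"
          unfolding k_def using VF_mult[OF X \<rho> diff_in[OF x const_in]] VF_diff[OF X x const_in] VF_const[OF X] \<rho>q xq[OF q]
          by simp
        finally show ?thesis unfolding hq .
      qed
      then show ?thesis by (simp add: sum_fun_apply)
    qed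
    ultimately show ?thesis by simp
  qed
  then show ?thesis using V(3,4) x E by blast
qed

lemma framed_function_algebra_smooth: "framed_function_algebra (smooth_functions n \<A>)"
  by unfold_locales (rule smooth_functions_local smooth_functions_bump smooth_functions_frame; assumption)+

end


section \<open>Cartan calculus on the forms of a function algebra\<close>

text \<open>
  Pointwise evaluation is a simplification rule only for forms and vector fields. For functions on the base it would open up
  arguments of vector fields, like the sum in \<open>X (f + g)\<close>, and hide them from the derivation rules.
\<close>

lemmas fun_ops = plus_fun_apply zero_fun_apply times_fun_apply uminus_apply minus_apply

declare fun_ops [simp del]

lemma form_ops [simp]:
  fixes \<omega> \<eta> :: "'a form"
  shows "(\<omega> + \<eta>) Xs = \<omega> Xs + \<eta> Xs" "(\<omega> - \<eta>) Xs = \<omega> Xs - \<eta> Xs" "(- \<omega>) Xs = - \<omega> Xs"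
    "(0 :: 'a form) Xs = 0" "(c *\<^sub>R \<omega>) Xs = c *\<^sub>R \<omega> Xs"
  by (simp_all add: fun_ops scaleR_fun_def[of c \<omega>])

lemma vfield_ops [simp]:
  fixes X Y :: "'a vfield"
  shows "(X + Y) f = X f + Y f" "(X - Y) f = X f - Y f" "(- X) f = - X f"
    "(0 :: 'a vfield) f = 0" "(c *\<^sub>R X) f = c *\<^sub>R X f"
  by (simp_all add: fun_ops scaleR_fun_def[of c X])

lemma scaleR_mult_fun [simp]:
  fixes f g :: "'a \<Rightarrow> real"
  shows "f * c *\<^sub>R g = c *\<^sub>R (f * g)" "c *\<^sub>R f * g = c *\<^sub>R (f * g)"
  by (simp_all add: fun_eq_iff scaleR_fun_def fun_ops)

definition contr :: "'a vfield \<Rightarrow> 'a form \<Rightarrow> 'a form" where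
  "contr X \<omega> = (\<lambda>Xs. \<omega> (X # Xs))"

lemma contr_apply: "contr X \<omega> Xs = \<omega> (X # Xs)"
  by (simp add: contr_def)

lemma contr_lin [simp]: "contr X 0 = 0" "contr X (\<omega> + \<eta>) = contr X \<omega> + contr X \<eta>"
  "contr X (\<omega> - \<eta>) = contr X \<omega> - contr X \<eta>" "contr X (- \<omega>) = - contr X \<omega>"
  "contr X (fscale f \<omega>) = fscale f (contr X \<omega>)"
  by (simp_all add: contr_def fun_eq_iff fscale_def)

lemma lie_bracket_anti: "lie_bracket X Y = - lie_bracket Y X"
  by (simp add: lie_bracket_def fun_eq_iff)

lemma fscale_lin: "fscale f (\<omega> + \<eta>) = fscale f \<omega> + fscale f \<eta>" "fscale f (\<omega> - \<eta>) = fscale f \<omega> - fscale f \<eta>"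
  "fscale f (- \<omega>) = - fscale f \<omega>" "fscale f 0 = 0"
  by (simp_all add: fscale_def fun_eq_iff algebra_simps)

context function_algebra
begin

text \<open>
  The Lie derivative of a form along a vector field.
\<close>

definition lie :: "'a vfield \<Rightarrow> 'a form \<Rightarrow> 'a form" where
  "lie X \<omega> = (\<lambda>Xs. if set Xs \<subseteq> VF
     then X (\<omega> Xs) - (\<Sum>i<length Xs. \<omega> (Xs[i := lie_bracket X (Xs ! i)])) else 0)"

abbreviation d :: "'a form \<Rightarrow> 'a form" where "d \<equiv> ext_deriv C"

text \<open>
  A linear space that contains the forms of all degrees and on which the operators below are linear. Its elements are determined by
  the value on \<open>[]\<close> and the contractions with vector fields (\<open>cochain_eqI\<close>), so that identities between forms can be proved by
  induction on the degree.
\<close>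

definition cochains :: "'a form set" where
  "cochains = {\<omega>. \<forall>Xs. \<omega> Xs \<in> C \<and> (\<not> set Xs \<subseteq> VF \<longrightarrow> \<omega> Xs = 0)}"

lemma cochains_in: "\<omega> \<in> cochains \<Longrightarrow> \<omega> Xs \<in> C"
  and cochains_out: "\<omega> \<in> cochains \<Longrightarrow> \<not> set Xs \<subseteq> VF \<Longrightarrow> \<omega> Xs = 0"
  by (auto simp: cochains_def)

lemma subspace_cochains: "subspace cochains"
  by (auto simp: subspace_def cochains_def add_in scaleR_in)

lemma cochains_add: "\<omega> \<in> cochains \<Longrightarrow> \<eta> \<in> cochains \<Longrightarrow> \<omega> + \<eta> \<in> cochains"
  and cochains_diff: "\<omega> \<in> cochains \<Longrightarrow> \<eta> \<in> cochains \<Longrightarrow> \<omega> - \<eta> \<in> cochains"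
  and cochains_scaleR: "\<omega> \<in> cochains \<Longrightarrow> c *\<^sub>R \<omega> \<in> cochains"
  and cochains_uminus: "\<omega> \<in> cochains \<Longrightarrow> - \<omega> \<in> cochains"
  and cochains_0 [simp]: "0 \<in> cochains"
  using subspace_cochains subspace_add subspace_diff subspace_scale subspace_neg subspace_0 by blast+

lemma cochains_contr: "\<omega> \<in> cochains \<Longrightarrow> contr X \<omega> \<in> cochains"
  by (auto simp: cochains_def contr_def)

lemma cochain_eqI:
  assumes "\<omega> \<in> cochains" "\<eta> \<in> cochains" "\<omega> [] = \<eta> []" "\<And>X. X \<in> VF \<Longrightarrow> contr X \<omega> = contr X \<eta>"
  shows "\<omega> = \<eta>"
proof
  fix Xs show "\<omega> Xs = \<eta> Xs"
  proof (cases Xs)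
    case (Cons X Ys)
    show ?thesis
    proof (cases "X \<in> VF")
      case True then show ?thesis using assms(4)[OF True] by (simp add: Cons contr_def fun_eq_iff)
    next
      case False then show ?thesis using assms(1,2)[THEN cochains_out, of Xs] Cons by auto
    qed
  qed (simp add: assms)
qed

lemma VF_I:
  assumes "\<And>f. f \<notin> C \<Longrightarrow> X f = 0" "\<And>f. f \<in> C \<Longrightarrow> X f \<in> C"
    "\<And>f g. f \<in> C \<Longrightarrow> g \<in> C \<Longrightarrow> X (f + g) = X f + X g"
    "\<And>c f. f \<in> C \<Longrightarrow> X (c *\<^sub>R f) = c *\<^sub>R X f"
    "\<And>f g. f \<in> C \<Longrightarrow> g \<in> C \<Longrightarrow> X (f * g) = X f * g + f * X g"
  shows "X \<in> VF"
  using assms by (auto simp: vector_fields_def)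

lemma VF_plus: "X \<in> VF \<Longrightarrow> Y \<in> VF \<Longrightarrow> X + Y \<in> VF"
  by (rule VF_I) (simp_all add: VF_out VF_in add_in VF_add VF_scaleR VF_mult scaleR_add_right algebra_simps)

lemma VF_fmult: "X \<in> VF \<Longrightarrow> f \<in> C \<Longrightarrow> (\<lambda>g. f * X g) \<in> VF"
  by (rule VF_I) (simp_all add: VF_out VF_in mult_in VF_add VF_scaleR VF_mult algebra_simps)

lemma VF_zero: "0 \<in> VF"
  by (rule VF_I) auto

lemma fmult_const: "(\<lambda>g. (\<lambda>_. c) * X g) = c *\<^sub>R (X :: 'a vfield)"
  by (simp add: fun_eq_iff scaleR_fun_def fun_ops)

lemma VF_scale: "X \<in> VF \<Longrightarrow> c *\<^sub>R X \<in> VF"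
  by (subst fmult_const[of c X, symmetric]) (intro VF_fmult const_in)

lemma VF_neg: "X \<in> VF \<Longrightarrow> - X \<in> VF"
  using VF_scale[of X "-1"] by simp

lemma VF_lincomb: "(\<And>i. i \<in> I \<Longrightarrow> c i \<in> C \<and> E i \<in> VF) \<Longrightarrow> (\<lambda>g. \<Sum>i\<in>I. c i * E i g) \<in> VF"
proof (induction I rule: infinite_finite_induct)
  case (insert i I)
  then have "(\<lambda>g. c i * E i g) + (\<lambda>g. \<Sum>i\<in>I. c i * E i g) \<in> VF"
    by (intro VF_plus VF_fmult) auto
  then show ?case using insert.hyps by (simp add: plus_fun_def[of "\<lambda>g. c i * E i g"])
qed (use VF_zero in \<open>auto simp: zero_fun_def[where 'b="'a \<Rightarrow> real"]\<close>)

lemma VF_lie_bracket: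
  assumes "X \<in> VF" "Y \<in> VF"
  shows "lie_bracket X Y \<in> VF"
  unfolding lie_bracket_def
  by (rule VF_I) (use assms in \<open>simp_all add: VF_out VF_in diff_in add_in mult_in VF_0 VF_add VF_scaleR VF_mult scaleR_diff_right algebra_simps\<close>)

lemma lie_bracket_add: "X \<in> VF \<Longrightarrow> Y \<in> VF \<Longrightarrow> Z \<in> VF \<Longrightarrow>
    lie_bracket X (Y + Z) = lie_bracket X Y + lie_bracket X Z"
proof
  fix f assume "X \<in> VF" "Y \<in> VF" "Z \<in> VF"
  then show "lie_bracket X (Y + Z) f = (lie_bracket X Y + lie_bracket X Z) f"
    by (cases "f \<in> C") (simp_all add: lie_bracket_def VF_out VF_0 VF_add VF_in)
qed

lemma lie_bracket_fmult:
  assumes "X \<in> VF" "Y \<in> VF" "f \<in> C"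
  shows "lie_bracket X (\<lambda>g. f * Y g) = (\<lambda>g. X f * Y g) + (\<lambda>g. f * lie_bracket X Y g)"
proof
  fix g show "lie_bracket X (\<lambda>g. f * Y g) g = ((\<lambda>g. X f * Y g) + (\<lambda>g. f * lie_bracket X Y g)) g"
    using assms by (cases "g \<in> C") (simp_all add: lie_bracket_def VF_out VF_0 VF_mult VF_in algebra_simps)
qed

lemma lie_bracket_Jacobi:
  assumes "X \<in> VF" "Y \<in> VF" "Z \<in> VF"
  shows "lie_bracket (lie_bracket X Y) Z = lie_bracket X (lie_bracket Y Z) - lie_bracket Y (lie_bracket X Z)"
proof
  fix g show "lie_bracket (lie_bracket X Y) Z g = (lie_bracket X (lie_bracket Y Z) - lie_bracket Y (lie_bracket X Z)) g"
    using assms by (cases "g \<in> C") (simp_all add: lie_bracket_def VF_out VF_0 VF_diff VF_in)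
qed

lemma forms_out: "\<omega> \<in> forms C k \<Longrightarrow> \<not> (length Xs = k \<and> set Xs \<subseteq> VF) \<Longrightarrow> \<omega> Xs = 0"
  unfolding forms_def by blast

lemma forms_in: "\<omega> \<in> forms C k \<Longrightarrow> \<omega> Xs \<in> C"
  using forms_out[of \<omega> k Xs] unfolding forms_def by (cases "length Xs = k \<and> set Xs \<subseteq> VF") auto

lemma forms_cochains: "\<omega> \<in> forms C k \<Longrightarrow> \<omega> \<in> cochains"
  using forms_in forms_out unfolding cochains_def by blast

lemma forms_alt: "\<omega> \<in> forms C k \<Longrightarrow> \<not> distinct Xs \<Longrightarrow> \<omega> Xs = 0"
  unfolding forms_def by blast

lemma forms_add_at: "\<omega> \<in> forms C k \<Longrightarrow> X \<in> VF \<Longrightarrow> Y \<in> VF \<Longrightarrow> length Xs + 1 + length Ys = k \<Longrightarrow>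
    set Xs \<union> set Ys \<subseteq> VF \<Longrightarrow> \<omega> (Xs @ (X + Y) # Ys) = \<omega> (Xs @ X # Ys) + \<omega> (Xs @ Y # Ys)"
  and forms_fmult_at: "\<omega> \<in> forms C k \<Longrightarrow> X \<in> VF \<Longrightarrow> f \<in> C \<Longrightarrow> length Xs + 1 + length Ys = k \<Longrightarrow>
    set Xs \<union> set Ys \<subseteq> VF \<Longrightarrow> \<omega> (Xs @ (\<lambda>g. f * X g) # Ys) = f * \<omega> (Xs @ X # Ys)"
  unfolding forms_def by simp_all

lemma subspace_forms: "subspace (forms C k)"
  unfolding subspace_def
proof (intro conjI ballI allI)
  show "0 \<in> forms C k" by (simp add: forms_def)
  show "\<omega> + \<eta> \<in> forms C k" if "\<omega> \<in> forms C k" "\<eta> \<in> forms C k" for \<omega> \<eta>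
    using that by (simp add: forms_def add_in algebra_simps)
  show "c *\<^sub>R \<omega> \<in> forms C k" if "\<omega> \<in> forms C k" for \<omega> c
    using that by (simp add: forms_def scaleR_in algebra_simps)
qed

lemma forms_add: "\<omega> \<in> forms C k \<Longrightarrow> \<eta> \<in> forms C k \<Longrightarrow> \<omega> + \<eta> \<in> forms C k"
  and forms_diff: "\<omega> \<in> forms C k \<Longrightarrow> \<eta> \<in> forms C k \<Longrightarrow> \<omega> - \<eta> \<in> forms C k"
  and forms_scaleR: "\<omega> \<in> forms C k \<Longrightarrow> c *\<^sub>R \<omega> \<in> forms C k"
  and forms_0 [simp]: "0 \<in> forms C k"
  using subspace_forms subspace_add subspace_diff subspace_scale subspace_0 by blast+

lemma forms_fscale: "\<omega> \<in> forms C k \<Longrightarrow> f \<in> C \<Longrightarrow> fscale f \<omega> \<in> forms C k"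
  by (simp add: forms_def fscale_def mult_in algebra_simps)

lemma forms_sum: "(\<And>i. i \<in> I \<Longrightarrow> \<omega> i \<in> forms C k) \<Longrightarrow> sum \<omega> I \<in> forms C k"
  by (rule subspace_sum[OF subspace_forms])

lemma forms_0_iff: "\<omega> \<in> forms C 0 \<longleftrightarrow> \<omega> [] \<in> C \<and> (\<forall>Xs. Xs \<noteq> [] \<longrightarrow> \<omega> Xs = 0)"
  unfolding forms_def by auto (metis distinct.simps(1))

lemma of_fun_forms: "f \<in> C \<Longrightarrow> of_fun f \<in> forms C 0"
  by (simp add: forms_0_iff of_fun_def)

lemma forms_0_of_fun: "\<omega> \<in> forms C 0 \<Longrightarrow> \<omega> = of_fun (\<omega> [])"
  by (auto simp: forms_0_iff of_fun_def fun_eq_iff)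

lemma contr_forms_0: "\<omega> \<in> forms C 0 \<Longrightarrow> contr X \<omega> = 0"
  by (auto simp: forms_0_iff contr_def fun_eq_iff)

lemma contr_forms_Suc:
  assumes "\<omega> \<in> forms C (Suc k)" "X \<in> VF"
  shows "contr X \<omega> \<in> forms C k"
  unfolding forms_def
proof (intro CollectI conjI allI impI ballI)
  fix Xs Ys Y Z f assume Y: "Y \<in> VF" and l: "length Xs + 1 + length Ys = k" and s: "set Xs \<union> set Ys \<subseteq> VF"
  have l': "length (X # Xs) + 1 + length Ys = Suc k" "set (X # Xs) \<union> set Ys \<subseteq> VF" using l s assms by auto
  show "contr X \<omega> (Xs @ (Y + Z) # Ys) = contr X \<omega> (Xs @ Y # Ys) + contr X \<omega> (Xs @ Z # Ys)" if "Z \<in> VF"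
    using forms_add_at[OF assms(1) Y that l'] by (simp add: contr_def)
  show "contr X \<omega> (Xs @ (\<lambda>g. f * Y g) # Ys) = f * contr X \<omega> (Xs @ Y # Ys)" if "f \<in> C"
    using forms_fmult_at[OF assms(1) Y that l'] by (simp add: contr_def)
next
  fix Xs assume "\<not> (length Xs = k \<and> set Xs \<subseteq> VF)"
  then show "contr X \<omega> Xs = 0" using forms_out[OF assms(1), of "X # Xs"] by (auto simp: contr_def)
next
  fix Xs :: "'a vfield list" assume "\<not> distinct Xs"
  then show "contr X \<omega> Xs = 0" using forms_alt[OF assms(1), of "X # Xs"] by (auto simp: contr_def)
qed (auto simp: contr_def forms_in[OF assms(1)])

lemma contr_forms: "\<omega> \<in> forms C k \<Longrightarrow> X \<in> VF \<Longrightarrow> contr X \<omega> \<in> forms C (k - 1)"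
  by (cases k) (auto simp: contr_forms_0 contr_forms_Suc)

text \<open>
  Induction on the degree, phrased with contractions so that degree \<open>0\<close>, whose contractions vanish, needs no case of its own.
\<close>

lemma form_induct [consumes 1, case_names zero step]:
  assumes "\<omega> \<in> forms C k" "P 0"
    "\<And>k \<omega>. \<omega> \<in> forms C k \<Longrightarrow> (\<And>Y. Y \<in> VF \<Longrightarrow> P (contr Y \<omega>)) \<Longrightarrow> P \<omega>"
  shows "P \<omega>"
  using assms(1)
proof (induction k arbitrary: \<omega>)
  case 0 then show ?case using assms(2) by (intro assms(3)[OF 0]) (simp add: contr_forms_0)
next
  case (Suc k) then show ?case by (intro assms(3)[OF Suc.prems] Suc.IH contr_forms_Suc)
qed

lemma contr_add:
  assumes "\<omega> \<in> forms C k" "X \<in> VF" "Y \<in> VF"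
  shows "contr (X + Y) \<omega> = contr X \<omega> + contr Y \<omega>"
proof
  fix Xs
  show "contr (X + Y) \<omega> Xs = (contr X \<omega> + contr Y \<omega>) Xs"
  proof (cases "Suc (length Xs) = k \<and> set Xs \<subseteq> VF")
    case True
    then have "\<omega> ([] @ (X + Y) # Xs) = \<omega> ([] @ X # Xs) + \<omega> ([] @ Y # Xs)"
      using assms(2,3) by (intro forms_add_at[OF assms(1)]) auto
    then show ?thesis by (simp add: contr_def)
  next
    case False
    then show ?thesis using forms_out[OF assms(1), of "_ # Xs"] by (auto simp: contr_def)
  qed
qed

lemma contr_fmult:
  assumes "\<omega> \<in> forms C k" "X \<in> VF" "f \<in> C"
  shows "contr (\<lambda>g. f * X g) \<omega> = fscale f (contr X \<omega>)"
proof
  fix Xs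
  show "contr (\<lambda>g. f * X g) \<omega> Xs = fscale f (contr X \<omega>) Xs"
  proof (cases "Suc (length Xs) = k \<and> set Xs \<subseteq> VF")
    case True
    then have "\<omega> ([] @ (\<lambda>g. f * X g) # Xs) = f * \<omega> ([] @ X # Xs)"
      using assms(2,3) by (intro forms_fmult_at[OF assms(1)]) auto
    then show ?thesis by (simp add: contr_def fscale_def)
  next
    case False
    then show ?thesis using forms_out[OF assms(1), of "_ # Xs"] by (auto simp: contr_def fscale_def)
  qed
qed

lemma contr_scaleR: "\<omega> \<in> forms C k \<Longrightarrow> X \<in> VF \<Longrightarrow> contr (c *\<^sub>R X) \<omega> = c *\<^sub>R contr X \<omega>"
  by (subst fmult_const[of c X, symmetric])
    (simp add: contr_fmult const_in, simp add: fscale_def fun_eq_iff scaleR_fun_def fun_ops)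

lemma contr_zero: "\<omega> \<in> forms C k \<Longrightarrow> contr 0 \<omega> = 0"
  using contr_scaleR[OF _ VF_zero, of \<omega> k 0] by simp

lemma contr_neg: "\<omega> \<in> forms C k \<Longrightarrow> X \<in> VF \<Longrightarrow> contr (- X) \<omega> = - contr X \<omega>"
  using contr_scaleR[of \<omega> k X "-1"] by simp

lemma contr_minus: "\<omega> \<in> forms C k \<Longrightarrow> X \<in> VF \<Longrightarrow> Y \<in> VF \<Longrightarrow> contr (X - Y) \<omega> = contr X \<omega> - contr Y \<omega>"
  using contr_add[of \<omega> k X "- Y"] contr_neg[of \<omega> k Y] VF_neg by simp

lemma contr_lincomb:
  assumes "\<omega> \<in> forms C k" "\<And>i. i \<in> I \<Longrightarrow> c i \<in> C \<and> E i \<in> VF"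
  shows "contr (\<lambda>g. \<Sum>i\<in>I. c i * E i g) \<omega> = (\<Sum>i\<in>I. fscale (c i) (contr (E i) \<omega>))"
  using assms(2)
proof (induction I rule: infinite_finite_induct)
  case (insert i I)
  then have "contr ((\<lambda>g. c i * E i g) + (\<lambda>g. \<Sum>i\<in>I. c i * E i g)) \<omega> =
      contr (\<lambda>g. c i * E i g) \<omega> + contr (\<lambda>g. \<Sum>i\<in>I. c i * E i g) \<omega>"
    by (intro contr_add[OF assms(1)] VF_fmult VF_lincomb) auto
  then show ?case
    using insert by (simp add: plus_fun_def[of "\<lambda>g. c i * E i g"] contr_fmult[OF assms(1)])
qed (use contr_zero[OF assms(1)] in \<open>simp_all add: zero_fun_def[where 'b="'a \<Rightarrow> real"]\<close>)

lemma contr_self: "\<omega> \<in> forms C k \<Longrightarrow> contr X (contr X \<omega>) = 0"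
  using forms_alt by (fastforce simp: contr_def fun_eq_iff)

lemma contr_anti:
  assumes "\<omega> \<in> forms C k" "X \<in> VF" "Y \<in> VF"
  shows "contr X (contr Y \<omega>) = - contr Y (contr X \<omega>)"
proof -
  have "contr (X + Y) (contr (X + Y) \<omega>) = 0" by (rule contr_self[OF assms(1)])
  moreover have "contr (X + Y) (contr (X + Y) \<omega>) = contr X (contr X \<omega>) + contr X (contr Y \<omega>) + (contr Y (contr X \<omega>) + contr Y (contr Y \<omega>))"
    using assms contr_forms VF_plus by (simp add: contr_add[of _ "k - 1"] contr_add[of _ k])
  ultimately show ?thesis using contr_self[OF assms(1)] by (simp add: eq_neg_iff_add_eq_0)
qed

lemma move_front:
  assumes "\<omega> \<in> forms C k" "Z \<in> VF" "set As \<subseteq> VF"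
  shows "\<omega> (Z # As @ Bs) = (- 1) ^ length As *\<^sub>R \<omega> (As @ Z # Bs)"
  using assms(1,3)
proof (induction As arbitrary: \<omega> k)
  case (Cons A As)
  have "\<omega> (Z # A # As @ Bs) = - \<omega> (A # Z # As @ Bs)"
    using fun_cong[OF contr_anti[OF Cons.prems(1), of A Z], of "As @ Bs"] Cons.prems assms by (simp add: contr_def)
  also have "\<omega> (A # Z # As @ Bs) = (- 1) ^ length As *\<^sub>R \<omega> (A # As @ Z # Bs)"
    using Cons.IH[OF contr_forms[OF Cons.prems(1), of A]] Cons.prems by (simp add: contr_def)
  finally show ?case by simp
qed simp

text \<open>
  A form of degree \<open>k + 1\<close> is a linear map from vector fields to forms of degree \<open>k\<close> that is alternating in its first two arguments:
  the transposition of neighbours in later positions is covered by the contractions being forms.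
\<close>

lemma forms_SucI:
  assumes c: "\<eta> \<in> cochains" and nil: "\<eta> [] = 0"
    and con: "\<And>X. X \<in> VF \<Longrightarrow> contr X \<eta> \<in> forms C k"
    and add: "\<And>X Y. X \<in> VF \<Longrightarrow> Y \<in> VF \<Longrightarrow> contr (X + Y) \<eta> = contr X \<eta> + contr Y \<eta>"
    and scale: "\<And>X f. X \<in> VF \<Longrightarrow> f \<in> C \<Longrightarrow> contr (\<lambda>g. f * X g) \<eta> = fscale f (contr X \<eta>)"
    and self: "\<And>X. X \<in> VF \<Longrightarrow> contr X (contr X \<eta>) = 0"
  shows "\<eta> \<in> forms C (Suc k)"
  unfolding forms_def
proof (intro CollectI conjI allI impI ballI)
  fix Xs assume a: "\<not> (length Xs = Suc k \<and> set Xs \<subseteq> VF)"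
  show "\<eta> Xs = 0"
  proof (cases Xs)
    case (Cons X Ys)
    show ?thesis
    proof (cases "set Xs \<subseteq> VF")
      case True
      then have "contr X \<eta> Ys = 0" using a Cons by (intro forms_out[OF con]) auto
      then show ?thesis by (simp add: Cons contr_def)
    qed (rule cochains_out[OF c])
  qed (simp add: nil)
next
  fix Xs :: "'a vfield list" assume "length Xs = Suc k" show "\<eta> Xs \<in> C" by (rule cochains_in[OF c])
next
  fix Xs Ys :: "'a vfield list" and X Y f assume l: "length Xs + 1 + length Ys = Suc k" and s: "set Xs \<union> set Ys \<subseteq> VF" and X: "X \<in> VF"
  show "\<eta> (Xs @ (X + Y) # Ys) = \<eta> (Xs @ X # Ys) + \<eta> (Xs @ Y # Ys)" if "Y \<in> VF"
  proof (cases Xs)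
    case Nil then show ?thesis using fun_cong[OF add[OF X that], of Ys] by (simp add: contr_def)
  next
    case (Cons Z Zs)
    then have "contr Z \<eta> \<in> forms C k" using s con by simp
    then have "contr Z \<eta> (Zs @ (X + Y) # Ys) = contr Z \<eta> (Zs @ X # Ys) + contr Z \<eta> (Zs @ Y # Ys)"
      using l s X that Cons by (intro forms_add_at[of _ k]) auto
    then show ?thesis by (simp add: contr_def Cons)
  qed
  show "\<eta> (Xs @ (\<lambda>g. f * X g) # Ys) = f * \<eta> (Xs @ X # Ys)" if "f \<in> C"
  proof (cases Xs)
    case Nil then show ?thesis using fun_cong[OF scale[OF X that], of Ys] by (simp add: contr_def fscale_def)
  next
    case (Cons Z Zs)
    then have "contr Z \<eta> \<in> forms C k" using s con by simp
    then have "contr Z \<eta> (Zs @ (\<lambda>g. f * X g) # Ys) = f * contr Z \<eta> (Zs @ X # Ys)"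
      using l s X that Cons by (intro forms_fmult_at[of _ k]) auto
    then show ?thesis by (simp add: contr_def Cons)
  qed
next
  fix Xs :: "'a vfield list" assume nd: "\<not> distinct Xs"
  show "\<eta> Xs = 0"
  proof (cases "set Xs \<subseteq> VF")
    case True
    obtain X Ys where Xs: "Xs = X # Ys" using nd by (cases Xs) auto
    then have X: "X \<in> VF" using True by simp
    have "contr X \<eta> Ys = 0"
    proof (cases "X \<in> set Ys")
      case True
      then obtain As Bs where Ys: "Ys = As @ X # Bs" by (meson split_list)
      have "contr X \<eta> (X # As @ Bs) = (- 1) ^ length As *\<^sub>R contr X \<eta> (As @ X # Bs)"
        using \<open>set Xs \<subseteq> VF\<close> Xs Ys by (intro move_front[OF con]) auto
      moreover have "contr X \<eta> (X # As @ Bs) = 0" using fun_cong[OF self[OF X], of "As @ Bs"] by (simp add: contr_def)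
      ultimately show ?thesis by (simp add: Ys)
    next
      case False then show ?thesis using nd Xs by (intro forms_alt[OF con[OF X]]) auto
    qed
    then show ?thesis by (simp add: Xs contr_def)
  qed (rule cochains_out[OF c])
qed

lemma lie_Nil: "lie X \<omega> [] = X (\<omega> [])"
  by (simp add: lie_def)

lemma cochains_lie:
  assumes "X \<in> VF" "\<omega> \<in> cochains"
  shows "lie X \<omega> \<in> cochains"
proof -
  have "X (\<omega> Xs) - (\<Sum>i<length Xs. \<omega> (Xs[i := lie_bracket X (Xs ! i)])) \<in> C" for Xs
    by (rule diff_in[OF VF_in[OF assms(1) cochains_in[OF assms(2)]] sum_in[OF cochains_in[OF assms(2)]]])
  then show ?thesis by (simp add: cochains_def lie_def)
qed

lemma lie_add: "X \<in> VF \<Longrightarrow> \<omega> \<in> cochains \<Longrightarrow> \<eta> \<in> cochains \<Longrightarrow> lie X (\<omega> + \<eta>) = lie X \<omega> + lie X \<eta>"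
  by (simp add: lie_def fun_eq_iff VF_add cochains_in sum.distrib algebra_simps)

lemma lie_scaleR: "X \<in> VF \<Longrightarrow> \<omega> \<in> cochains \<Longrightarrow> lie X (c *\<^sub>R \<omega>) = c *\<^sub>R lie X \<omega>"
  by (simp add: lie_def fun_eq_iff VF_scaleR cochains_in scaleR_sum_right algebra_simps
      scaleR_diff_right sum_fun_apply)

lemma lie_uminus: "X \<in> VF \<Longrightarrow> \<omega> \<in> cochains \<Longrightarrow> lie X (- \<omega>) = - lie X \<omega>"
  using lie_scaleR[of X \<omega> "-1"] by simp

lemma lie_diff: "X \<in> VF \<Longrightarrow> \<omega> \<in> cochains \<Longrightarrow> \<eta> \<in> cochains \<Longrightarrow> lie X (\<omega> - \<eta>) = lie X \<omega> - lie X \<eta>"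
  using lie_add[of X \<omega> "- \<eta>"] lie_uminus[of X \<eta>] by (simp add: cochains_uminus)

lemma lie_0: "X \<in> VF \<Longrightarrow> lie X 0 = 0"
  using lie_scaleR[of X 0 0] by simp

lemma lie_fscale: "X \<in> VF \<Longrightarrow> \<omega> \<in> cochains \<Longrightarrow> f \<in> C \<Longrightarrow>
    lie X (fscale f \<omega>) = fscale (X f) \<omega> + fscale f (lie X \<omega>)"
  by (auto simp: lie_def fscale_def VF_mult cochains_in cochains_out sum_distrib_left algebra_simps intro!: ext)

lemma contr_lie:
  assumes "\<omega> \<in> cochains" "X \<in> VF" "Y \<in> VF"
  shows "contr Y (lie X \<omega>) = lie X (contr Y \<omega>) - contr (lie_bracket X Y) \<omega>"
proof
  fix Xs
  show "contr Y (lie X \<omega>) Xs = (lie X (contr Y \<omega>) - contr (lie_bracket X Y) \<omega>) Xs"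
    using assms cochains_out[OF assms(1), of "lie_bracket X Y # Xs"]
    by (simp add: contr_def lie_def sum.lessThan_Suc_shift del: sum.lessThan_Suc)
qed

lemma lie_forms: "X \<in> VF \<Longrightarrow> \<omega> \<in> forms C k \<Longrightarrow> lie X \<omega> \<in> forms C k"
proof (induction k arbitrary: \<omega>)
  case 0
  have "lie X \<omega> Xs = 0" if "Xs \<noteq> []" for Xs
  proof -
    have "\<omega> Ys = 0" if "length Ys = length Xs" for Ys
      using 0(2) \<open>Xs \<noteq> []\<close> that forms_0_iff by (metis length_0_conv)
    then show ?thesis using VF_0[OF 0(1)] by (simp add: lie_def)
  qed
  then show ?case using 0 by (simp add: forms_0_iff lie_Nil VF_in)
next
  case (Suc k)
  note c = forms_cochains[OF Suc.prems(2)] and X = Suc.prems(1) and w = Suc.prems(2)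
  have con: "contr Y (lie X \<omega>) = lie X (contr Y \<omega>) - contr (lie_bracket X Y) \<omega>" if "Y \<in> VF" for Y
    using contr_lie[OF c X that] .
  show ?case
  proof (rule forms_SucI)
    show "lie X \<omega> \<in> cochains" using cochains_lie X c .
    show "lie X \<omega> [] = 0" using forms_out[OF w, of "[]"] by (simp add: lie_Nil VF_0[OF X])
    fix Y assume Y: "Y \<in> VF"
    note Y' = contr_forms_Suc[OF w Y] and br = VF_lie_bracket[OF X Y]
    show "contr Y (lie X \<omega>) \<in> forms C k"
      unfolding con[OF Y] by (intro forms_diff Suc.IH[OF X] Y' contr_forms_Suc[OF w] br)
    have "contr Y (lie X (contr Y \<omega>)) = - contr (lie_bracket X Y) (contr Y \<omega>)"
      using contr_lie[OF forms_cochains[OF Y'] X Y] by (simp add: contr_self[OF w] lie_0[OF X])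
    moreover have "contr Y (contr (lie_bracket X Y) \<omega>) = - contr (lie_bracket X Y) (contr Y \<omega>)"
      by (rule contr_anti[OF w Y br])
    ultimately show "contr Y (contr Y (lie X \<omega>)) = 0" unfolding con[OF Y] by simp
    { fix Z assume Z: "Z \<in> VF"
      show "contr (Y + Z) (lie X \<omega>) = contr Y (lie X \<omega>) + contr Z (lie X \<omega>)"
        using X Y Z c w
        by (simp add: con VF_plus contr_add lie_bracket_add lie_add cochains_contr VF_lie_bracket) }
    { fix f assume f: "f \<in> C"
      show "contr (\<lambda>g. f * Y g) (lie X \<omega>) = fscale f (contr Y (lie X \<omega>))"
        using X Y f c w
        by (simp add: con VF_fmult contr_add contr_fmult lie_bracket_fmult lie_fscale cochains_contr VF_lie_bracket VF_in fscale_lin) }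
  qed
qed

lemma lie_lie_bracket:
  assumes "X \<in> VF" "Y \<in> VF" "\<omega> \<in> forms C k"
  shows "lie (lie_bracket X Y) \<omega> = lie X (lie Y \<omega>) - lie Y (lie X \<omega>)"
  using assms(3)
proof (induction rule: form_induct)
  case zero then show ?case by (simp add: lie_0 assms VF_lie_bracket del: form_ops)
next
  case (step k \<omega>)
  note c = forms_cochains[OF step.hyps]
  show ?case
  proof (rule cochain_eqI)
    show "lie (lie_bracket X Y) \<omega> [] = (lie X (lie Y \<omega>) - lie Y (lie X \<omega>)) []"
      by (simp add: lie_Nil) (simp add: lie_bracket_def)
    fix Z assume Z: "Z \<in> VF"
    have 1: "contr Z (lie A (lie B \<omega>)) = lie A (lie B (contr Z \<omega>)) - lie A (contr (lie_bracket B Z) \<omega>)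
        - lie B (contr (lie_bracket A Z) \<omega>) + contr (lie_bracket B (lie_bracket A Z)) \<omega>"
      if "A \<in> VF" "B \<in> VF" for A B
      using that Z c by (simp add: contr_lie cochains_lie lie_diff cochains_contr VF_lie_bracket algebra_simps)
    have "contr (lie_bracket (lie_bracket X Y) Z) \<omega> =
        contr (lie_bracket X (lie_bracket Y Z)) \<omega> - contr (lie_bracket Y (lie_bracket X Z)) \<omega>"
      unfolding lie_bracket_Jacobi[OF assms(1,2) Z]
      by (rule contr_minus[OF step.hyps]) (intro VF_lie_bracket assms Z)+
    then show "contr Z (lie (lie_bracket X Y) \<omega>) = contr Z (lie X (lie Y \<omega>) - lie Y (lie X \<omega>))"
      using step.IH[OF Z] assms Z c by (simp add: 1 contr_lie VF_lie_bracket del: form_ops)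
  qed (intro cochains_diff cochains_lie VF_lie_bracket assms c)+
qed

lemma d_Nil: "d \<omega> [] = 0"
  by (simp add: ext_deriv_def)

lemma d_out: "\<not> set Xs \<subseteq> VF \<Longrightarrow> d \<omega> Xs = 0"
  by (simp add: ext_deriv_def)

lemma d_single: "Z \<in> VF \<Longrightarrow> d \<omega> [Z] = Z (\<omega> [])"
  by (simp add: ext_deriv_def omit_def)

lemma d_cochains:
  assumes "\<omega> \<in> cochains"
  shows "d \<omega> \<in> cochains"
proof -
  have "d \<omega> Xs \<in> C" for Xs
  proof (cases "set Xs \<subseteq> VF")
    case True
    have "(Xs ! i) (\<omega> (omit i Xs)) \<in> C" if "i < length Xs" for i
      using that True by (intro VF_in[of "Xs ! i"] cochains_in[OF assms]) auto
    then show ?thesis using True unfolding ext_deriv_def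
      by (simp only: if_True) (intro add_in sum_in scaleR_in cochains_in[OF assms]; simp)
  qed (simp add: d_out)
  then show ?thesis by (simp add: cochains_def d_out)
qed

lemma d_add: "\<omega> \<in> cochains \<Longrightarrow> \<eta> \<in> cochains \<Longrightarrow> d (\<omega> + \<eta>) = d \<omega> + d \<eta>"
  by (auto simp: ext_deriv_def fun_eq_iff VF_add[OF subsetD[OF _ nth_mem]] cochains_in sum.distrib scaleR_add_right algebra_simps)

lemma d_scaleR: "\<omega> \<in> cochains \<Longrightarrow> d (c *\<^sub>R \<omega>) = c *\<^sub>R d \<omega>"
  by (auto simp: ext_deriv_def fun_eq_iff VF_scaleR[OF subsetD[OF _ nth_mem]] cochains_in scaleR_add_right scaleR_sum_right
      sum_fun_apply sum_distrib_left algebra_simps)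

lemma d_uminus: "\<omega> \<in> cochains \<Longrightarrow> d (- \<omega>) = - d \<omega>"
  using d_scaleR[of \<omega> "-1"] by simp

lemma d_diff: "\<omega> \<in> cochains \<Longrightarrow> \<eta> \<in> cochains \<Longrightarrow> d (\<omega> - \<eta>) = d \<omega> - d \<eta>"
  using d_add[of \<omega> "- \<eta>"] d_uminus[of \<eta>] by (simp add: cochains_uminus)

lemma d_0: "d 0 = 0"
  using d_scaleR[of 0 0] by simp

lemma omit_Cons: "omit 0 (X # Xs) = Xs" "omit (Suc i) (X # Xs) = X # omit i Xs"
  by (simp_all add: omit_def)

text \<open>
  Cartan's formula. In the sums that define \<open>d \<omega>\<close> on \<open>X # Xs\<close>, the terms that involve position \<open>0\<close> make up the Lie derivative, and
  the others are those of \<open>d (contr X \<omega>)\<close> with one more sign.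
\<close>

lemma contr_d:
  assumes w: "\<omega> \<in> forms C k" and X: "X \<in> VF"
  shows "contr X (d \<omega>) = lie X \<omega> - d (contr X \<omega>)"
proof
  fix Xs
  show "contr X (d \<omega>) Xs = (lie X \<omega> - d (contr X \<omega>)) Xs"
  proof (cases "set Xs \<subseteq> VF")
    case True
    have swap: "\<omega> (Y # X # Ys) = - \<omega> (X # Y # Ys)" if "Y \<in> VF" for Y Ys
      using fun_cong[OF contr_anti[OF w X that], of Ys] by (simp add: contr_def)
    \<comment> \<open>The exterior derivative puts the bracket in front, the Lie derivative leaves it in place.\<close>
    have move: "\<omega> (lie_bracket X (Xs ! j) # omit j Xs) = (- 1) ^ j *\<^sub>R \<omega> (Xs[j := lie_bracket X (Xs ! j)])"
      if "j < length Xs" for j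
    proof -
      have "Xs ! j \<in> VF" using that True by auto
      then have "\<omega> (lie_bracket X (Xs ! j) # take j Xs @ drop (Suc j) Xs) =
          (- 1) ^ length (take j Xs) *\<^sub>R \<omega> (take j Xs @ lie_bracket X (Xs ! j) # drop (Suc j) Xs)"
        using True set_take_subset[of j Xs] by (intro move_front[OF w] VF_lie_bracket X) auto
      then show ?thesis using that by (simp add: omit_def upd_conv_take_nth_drop)
    qed
    have br: "lie_bracket (Xs ! i) (Xs ! j) \<in> VF" if "i < j" "j < length Xs" for i j
      using that True by (intro VF_lie_bracket) auto
    have "contr X (d \<omega>) Xs = X (\<omega> Xs) - (\<Sum>i<length Xs. (- 1) ^ i *\<^sub>R (Xs ! i) (contr X \<omega> (omit i Xs)))
        + (\<Sum>j<length Xs. - \<omega> (Xs[j := lie_bracket X (Xs ! j)])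
          - (\<Sum>i<j. (- 1) ^ (i + j) *\<^sub>R contr X \<omega> (lie_bracket (Xs ! i) (Xs ! j) # omit i (omit j Xs))))"
    proof -
      have "(\<Sum>i<j. (- 1) ^ (Suc i + Suc j) *\<^sub>R \<omega> (lie_bracket (Xs ! i) (Xs ! j) # X # omit i (omit j Xs)))
          = - (\<Sum>i<j. (- 1) ^ (i + j) *\<^sub>R contr X \<omega> (lie_bracket (Xs ! i) (Xs ! j) # omit i (omit j Xs)))"
        if "j < length Xs" for j
        unfolding sum_negf[symmetric] by (rule sum.cong) (use that swap[OF br] in \<open>auto simp: contr_def\<close>)
      moreover have "(- 1) ^ Suc j *\<^sub>R \<omega> (lie_bracket X (Xs ! j) # omit j Xs) = - \<omega> (Xs[j := lie_bracket X (Xs ! j)])"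
        if "j < length Xs" for j
        using move[OF that] by (simp add: power_add[symmetric] mult_2[symmetric] power_mult)
      ultimately have "(\<Sum>j<length Xs. (- 1) ^ Suc j *\<^sub>R \<omega> (lie_bracket X (Xs ! j) # omit j Xs) +
          (\<Sum>i<j. (- 1) ^ (Suc i + Suc j) *\<^sub>R \<omega> (lie_bracket (Xs ! i) (Xs ! j) # X # omit i (omit j Xs)))) =
        (\<Sum>j<length Xs. - \<omega> (Xs[j := lie_bracket X (Xs ! j)])
          - (\<Sum>i<j. (- 1) ^ (i + j) *\<^sub>R contr X \<omega> (lie_bracket (Xs ! i) (Xs ! j) # omit i (omit j Xs))))"
        by (intro sum.cong) auto
      then show ?thesis
        using True X by (simp add: contr_apply ext_deriv_def omit_Cons sum.lessThan_Suc_shift sum_negf del: sum.lessThan_Suc)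
    qed
    also have "\<dots> = (lie X \<omega> - d (contr X \<omega>)) Xs"
      using True by (simp add: lie_def ext_deriv_def sum_subtractf sum_negf algebra_simps)
    finally show ?thesis .
  next
    case False then show ?thesis by (simp add: contr_def d_out lie_def)
  qed
qed

text \<open>
  Twofold use of Cartan's formula shows that \<open>d \<omega>\<close> is skew in its first two arguments. Linearity in the first argument is then
  inherited from the second, where the induction hypothesis of \<open>d_forms\<close> provides it.
\<close>

lemma contr_contr_d:
  assumes w: "\<omega> \<in> forms C k" and X: "X \<in> VF" and Y: "Y \<in> VF"
  shows "contr Y (contr X (d \<omega>)) = - contr X (contr Y (d \<omega>))"
proof -
  have 1: "contr B (contr A (d \<omega>)) = lie A (contr B \<omega>) - contr (lie_bracket A B) \<omega> - lie B (contr A \<omega>) + d (contr B (contr A \<omega>))"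
    if "A \<in> VF" "B \<in> VF" for A B
    using that w forms_cochains[OF w] by (simp add: contr_d contr_d[OF contr_forms[OF w]] contr_lie)
  have "contr (lie_bracket Y X) \<omega> = - contr (lie_bracket X Y) \<omega>"
    using contr_neg[OF w VF_lie_bracket[OF X Y]] lie_bracket_anti[of Y X] by simp
  moreover have "d (contr X (contr Y \<omega>)) = - d (contr Y (contr X \<omega>))"
    using contr_anti[OF w X Y] d_uminus[OF cochains_contr[OF cochains_contr[OF forms_cochains[OF w]]]] by simp
  ultimately show ?thesis unfolding 1[OF X Y] 1[OF Y X] by simp
qed

lemma d_forms: "\<omega> \<in> forms C k \<Longrightarrow> d \<omega> \<in> forms C (Suc k)"
proof (induction k arbitrary: \<omega>)
  have step: "d \<omega> \<in> forms C (Suc k)" if w: "\<omega> \<in> forms C k"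
    and IH: "\<And>X. X \<in> VF \<Longrightarrow> d (contr X \<omega>) \<in> forms C k" for k \<omega>
  proof (rule forms_SucI)
    note c = forms_cochains[OF w]
    have con: "contr X (d \<omega>) \<in> forms C k" if "X \<in> VF" for X
      unfolding contr_d[OF w that] by (intro forms_diff lie_forms IH that w)
    show "d \<omega> \<in> cochains" by (rule d_cochains[OF c])
    show "d \<omega> [] = 0" by (rule d_Nil)
    fix X assume X: "X \<in> VF"
    show "contr X (d \<omega>) \<in> forms C k" by (rule con[OF X])
    show "contr X (contr X (d \<omega>)) = 0"
    proof -
      have "contr X (contr X (d \<omega>)) = - contr X (contr X (d \<omega>))" by (rule contr_contr_d[OF w X X])
      then have "2 *\<^sub>R contr X (contr X (d \<omega>)) = 0" by (simp add: scaleR_2 eq_neg_iff_add_eq_0)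
      then show ?thesis by (metis scaleR_eq_0_iff zero_neq_numeral)
    qed
    { fix Y assume Y: "Y \<in> VF"
      show "contr (X + Y) (d \<omega>) = contr X (d \<omega>) + contr Y (d \<omega>)"
      proof (rule cochain_eqI)
        show "contr (X + Y) (d \<omega>) [] = (contr X (d \<omega>) + contr Y (d \<omega>)) []"
          using X Y by (simp add: contr_def d_single VF_plus)
        fix Z assume Z: "Z \<in> VF"
        have "contr (X + Y) (contr Z (d \<omega>)) = contr X (contr Z (d \<omega>)) + contr Y (contr Z (d \<omega>))"
          by (rule contr_add[OF con[OF Z] X Y])
        then show "contr Z (contr (X + Y) (d \<omega>)) = contr Z (contr X (d \<omega>) + contr Y (d \<omega>))"
          using contr_contr_d[OF w _ Z] X Y VF_plus[OF X Y] by simp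
      qed (intro cochains_add cochains_contr d_cochains c)+ }
    { fix f assume f: "f \<in> C"
      show "contr (\<lambda>g. f * X g) (d \<omega>) = fscale f (contr X (d \<omega>))"
      proof (rule cochain_eqI)
        show "contr (\<lambda>g. f * X g) (d \<omega>) [] = fscale f (contr X (d \<omega>)) []"
          using X f by (simp add: contr_def d_single VF_fmult fscale_def)
        show "fscale f (contr X (d \<omega>)) \<in> cochains"
          by (rule forms_cochains[OF forms_fscale[OF con[OF X] f]])
        fix Z assume Z: "Z \<in> VF"
        have "contr (\<lambda>g. f * X g) (contr Z (d \<omega>)) = fscale f (contr X (contr Z (d \<omega>)))"
          by (rule contr_fmult[OF con[OF Z] X f])
        then show "contr Z (contr (\<lambda>g. f * X g) (d \<omega>)) = contr Z (fscale f (contr X (d \<omega>)))"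
          using contr_contr_d[OF w _ Z] X VF_fmult[OF X f] by (simp add: fscale_lin)
      qed (intro cochains_contr d_cochains c) }
  qed
  {
    case 0 show ?case by (rule step[OF 0]) (simp add: contr_forms_0[OF 0] d_0)
  next
    case (Suc k) show ?case by (rule step[OF Suc.prems]) (intro Suc.IH contr_forms_Suc Suc.prems)
  }
qed

lemma lie_d:
  assumes "X \<in> VF" "\<omega> \<in> forms C k"
  shows "lie X (d \<omega>) = d (lie X \<omega>)"
  using assms(2)
proof (induction rule: form_induct)
  case zero then show ?case by (simp add: d_0 lie_0 assms del: form_ops)
next
  case (step k \<omega>)
  note c = forms_cochains[OF step.hyps] and w = step.hyps
  show ?case
  proof (rule cochain_eqI)
    show "lie X (d \<omega>) [] = d (lie X \<omega>) []" by (simp add: lie_Nil d_Nil VF_0 assms)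
    fix Y assume Y: "Y \<in> VF"
    note br = VF_lie_bracket[OF assms(1) Y]
    have "contr Y (lie X (d \<omega>)) = lie X (lie Y \<omega>) - lie X (d (contr Y \<omega>)) - (lie (lie_bracket X Y) \<omega> - d (contr (lie_bracket X Y) \<omega>))"
      using assms(1) Y br c by (simp add: contr_lie d_cochains contr_d[OF w] lie_diff cochains_lie cochains_contr del: form_ops)
    also have "\<dots> = lie Y (lie X \<omega>) - d (lie X (contr Y \<omega>) - contr (lie_bracket X Y) \<omega>)"
      using assms(1) Y br c step.IH[OF Y]
      by (simp add: lie_lie_bracket[OF assms(1) Y w] d_diff cochains_lie cochains_contr del: form_ops)
    also have "\<dots> = contr Y (d (lie X \<omega>))"
      using contr_d[OF lie_forms[OF assms(1) w] Y] contr_lie[OF c assms(1) Y] by (simp del: form_ops)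
    finally show "contr Y (lie X (d \<omega>)) = contr Y (d (lie X \<omega>))" .
  qed (intro cochains_lie d_cochains assms c)+
qed

lemma d_d: "\<omega> \<in> forms C k \<Longrightarrow> d (d \<omega>) = 0"
proof (induction rule: form_induct)
  case zero then show ?case by (simp add: d_0 del: form_ops)
next
  case (step k \<omega>)
  note c = forms_cochains[OF step.hyps] and w = step.hyps
  show ?case
  proof (rule cochain_eqI)
    fix Y assume Y: "Y \<in> VF"
    have "contr Y (d (d \<omega>)) = lie Y (d \<omega>) - d (lie Y \<omega> - d (contr Y \<omega>))"
      using contr_d[OF d_forms[OF w] Y] contr_d[OF w Y] by (simp del: form_ops)
    also have "\<dots> = 0" using lie_d[OF Y w] step.IH[OF Y] c Y by (simp add: d_diff cochains_lie d_cochains cochains_contr del: form_ops)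
    finally show "contr Y (d (d \<omega>)) = contr Y 0" by simp
  qed (simp_all add: d_Nil d_cochains c del: form_ops, simp)
qed

end


section \<open>The Koszul differential squares to zero\<close>

lemma sum_list_sum_swap: "(\<Sum>x\<leftarrow>xs. \<Sum>i\<in>I. f x i) = (\<Sum>i\<in>I. \<Sum>x\<leftarrow>xs. (f x i :: real))"
  by (induction xs) (auto simp: sum.distrib)

text \<open>
  Pairing with a totally antisymmetric \<open>W\<close> sees only the antisymmetric part of \<open>S\<close>: the sum is unchanged when the three indices are
  permuted, and the six versions add up to zero.
\<close>

lemma sum_antisym_eq_0:
  fixes S W :: "nat \<Rightarrow> nat \<Rightarrow> nat \<Rightarrow> real"
  assumes W: "\<And>a b c. W b a c = - W a b c" "\<And>a b c. W a c b = - W a b c"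
    and S: "\<And>a b c. a < m \<Longrightarrow> b < m \<Longrightarrow> c < m \<Longrightarrow>
      S a b c - S a c b - S b a c + S b c a + S c a b - S c b a = 0"
  shows "(\<Sum>a<m. \<Sum>b<m. \<Sum>c<m. S a b c * W a b c) = 0"
proof -
  let ?Q = "\<lambda>g. \<Sum>a<m. \<Sum>b<m. \<Sum>c<m. g a b (c::nat) :: real"
  have swap12: "?Q g = ?Q (\<lambda>a b c. g b a c)" for g by (rule sum.swap)
  have swap23: "?Q g = ?Q (\<lambda>a b c. g a c b)" for g by (intro sum.cong refl sum.swap)
  define F where "F a b c = S a b c * W a b c" for a b c
  have e1: "?Q F = ?Q (\<lambda>a b c. F a c b)" by (rule swap23)
  have e2: "?Q F = ?Q (\<lambda>a b c. F b a c)" by (rule swap12)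
  have e3: "?Q F = ?Q (\<lambda>a b c. F b c a)" by (rule trans[OF e1 swap12])
  have e4: "?Q F = ?Q (\<lambda>a b c. F c a b)" by (rule trans[OF e2 swap23])
  have e5: "?Q F = ?Q (\<lambda>a b c. F c b a)" by (rule trans[OF e4 swap12])
  have W6: "W a c b = - W a b c" "W b a c = - W a b c" "W b c a = W a b c" "W c a b = W a b c" "W c b a = - W a b c" for a b c
    using W(1)[of a b c] W(2)[of a b c] W(2)[of b a c] W(1)[of a c b] W(1)[of b c a] by simp_all
  have "6 * ?Q F = ?Q F + ?Q (\<lambda>a b c. F a c b) + ?Q (\<lambda>a b c. F b a c) + ?Q (\<lambda>a b c. F b c a) + ?Q (\<lambda>a b c. F c a b) + ?Q (\<lambda>a b c. F c b a)"
    unfolding e1[symmetric] e2[symmetric] e3[symmetric] e4[symmetric] e5[symmetric] by simp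
  also have "\<dots> = ?Q (\<lambda>a b c. W a b c * (S a b c - S a c b - S b a c + S b c a + S c a b - S c b a))"
    unfolding sum.distrib[symmetric]
  proof (intro sum.cong refl)
    fix a b c
    show "F a b c + F a c b + F b a c + F b c a + F c a b + F c b a =
        W a b c * (S a b c - S a c b - S b a c + S b c a + S c a b - S c b a)"
      unfolding F_def W6[where a=a and b=b and c=c] by (simp add: algebra_simps)
  qed
  also have "\<dots> = 0" using S by simp
  finally show ?thesis by (simp add: F_def)
qed

text \<open>
  The values of the Schouten bracket on three differentials are Jacobiators up to a factor, in terms of numbers. In the application, \<open>a j u\<close> and \<open>b j u\<close>
  are the derivatives of the \<open>u\<close>-th function along the two vector fields \<open>A j\<close>, \<open>B j\<close> of the \<open>j\<close>-th pair, and \<open>ab j l u\<close> is its second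
  derivative \<open>A j (B l u)\<close>, and so on. The terms of a fixed pair \<open>(j, l)\<close> agree only together with those of \<open>(l, j)\<close>, since a commutator
  contains second derivatives in both orders.
\<close>

lemma Schouten_Jacobi_identity:
  fixes a b :: "'i \<Rightarrow> nat \<Rightarrow> real" and aa ab ba bb :: "'i \<Rightarrow> 'i \<Rightarrow> nat \<Rightarrow> real"
  defines "S \<equiv> \<lambda>j l u v w. (aa j l u - aa l j u) * b l v * b j w + a l u * (ab j l v - ba l j v) * b j w
      - a j u * (ba j l v - ab l j v) * b l w - a j u * a l v * (bb j l w - bb l j w)"
  defines "J \<equiv> \<lambda>j l u v w. a j u * (ba j l v * b l w + a l v * bb j l w - (bb j l v * a l w + b l v * ba j l w))
      - b j u * (aa j l v * b l w + a l v * ab j l w - (ab j l v * a l w + b l v * aa j l w))"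
  shows "(\<Sum>j\<in>I. \<Sum>l\<in>I. S j l u v w - S j l u w v - S j l v u w + S j l v w u + S j l w u v - S j l w v u) =
    - 2 * (\<Sum>j\<in>I. \<Sum>l\<in>I. J j l u v w + J j l v w u + J j l w u v)"
proof -
  let ?Q = "\<lambda>f. \<Sum>j\<in>I. \<Sum>l\<in>I. f j l :: real"
  let ?f = "\<lambda>j l. S j l u v w - S j l u w v - S j l v u w + S j l v w u + S j l w u v - S j l w v u"
  let ?g = "\<lambda>j l. J j l u v w + J j l v w u + J j l w u v"
  have swap: "?Q f = ?Q (\<lambda>j l. f l j)" for f :: "'i \<Rightarrow> 'i \<Rightarrow> real" by (rule sum.swap)
  have "?Q (\<lambda>j l. ?f j l + ?f l j) = ?Q (\<lambda>j l. - 2 * (?g j l + ?g l j))"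
    by (intro sum.cong refl) (simp add: S_def J_def algebra_simps)
  then have "?Q ?f + ?Q (\<lambda>j l. ?f l j) = - 2 * (?Q ?g + ?Q (\<lambda>j l. ?g l j))"
    by (simp only: sum.distrib[symmetric] sum_distrib_left)
  moreover have "x = - 2 * y" if "x + x' = - 2 * (y + y')" "x = x'" "y = y'" for x x' y y' :: real
    using that by simp
  ultimately show ?thesis using swap[of ?f] swap[of ?g] by blast
qed

text \<open>The degree of a \<open>1\<close>-form is to stay \<open>1\<close> instead of \<open>Suc 0\<close>.\<close>

declare One_nat_def [simp del]

definition loc_eq :: "'a set \<Rightarrow> 'a form \<Rightarrow> 'a form \<Rightarrow> bool" where
  "loc_eq U \<omega> \<eta> \<longleftrightarrow> (\<forall>Xs. \<forall>q\<in>U. \<omega> Xs q = \<eta> Xs q)"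

context framed_function_algebra
begin

definition frame_on :: "'a set \<Rightarrow> nat \<Rightarrow> (nat \<Rightarrow> 'a \<Rightarrow> real) \<Rightarrow> (nat \<Rightarrow> 'a vfield) \<Rightarrow> bool" where
  "frame_on U m x E \<longleftrightarrow> open U \<and> (\<forall>i<m. x i \<in> C \<and> E i \<in> VF) \<and>
    (\<forall>X\<in>VF. \<forall>f\<in>C. \<forall>q\<in>U. X f q = (\<Sum>i<m. X (x i) q * E i f q))"

lemma frame_exists: obtains U m x E where "frame_on U m x E" "p \<in> U"
  using frame[of p] unfolding frame_on_def by blast

lemma bump_at:
  assumes "open U" "q \<in> U"
  obtains \<rho> where "\<rho> \<in> C" "\<rho> q = 1" "\<And>q'. q' \<notin> U \<Longrightarrow> \<rho> q' = 0"
  using bump[OF assms] by blast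

lemma VF_local:
  assumes X: "X \<in> VF" and fg: "f \<in> C" "g \<in> C" and U: "open U" "\<And>q. q \<in> U \<Longrightarrow> f q = g q" and q: "q \<in> U"
  shows "X f q = X g q"
proof -
  obtain \<rho> where \<rho>: "\<rho> \<in> C" "\<rho> q = 1" "\<And>q'. q' \<notin> U \<Longrightarrow> \<rho> q' = 0" by (rule bump_at[OF U(1) q]) blast
  have "\<rho> * f = \<rho> * g" 
  proof
    show "(\<rho> * f) q' = (\<rho> * g) q'" for q' using U(2)[of q'] \<rho>(3)[of q'] by (cases "q' \<in> U") (simp_all add: fun_ops)
  qed
  then have "X (\<rho> * f) q = X (\<rho> * g) q" by simp
  then show ?thesis using \<rho> U(2)[OF q] by (simp add: VF_mult X fg fun_ops)
qed

lemma d_local: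
  assumes "open U" "\<omega> \<in> cochains" "\<eta> \<in> cochains" "loc_eq U \<omega> \<eta>"
  shows "loc_eq U (d \<omega>) (d \<eta>)"
  unfolding loc_eq_def
proof (intro allI ballI)
  fix Xs q assume q: "q \<in> U"
  have eq: "\<omega> Ys q' = \<eta> Ys q'" if "q' \<in> U" for Ys q' using assms(4) that by (simp add: loc_eq_def)
  show "d \<omega> Xs q = d \<eta> Xs q"
  proof (cases "set Xs \<subseteq> VF")
    case True
    have "(Xs ! i) (\<omega> Ys) q = (Xs ! i) (\<eta> Ys) q" if "i < length Xs" for i Ys
    proof (rule VF_local[OF _ cochains_in[OF assms(2)] cochains_in[OF assms(3)] assms(1) _ q])
      show "Xs ! i \<in> VF" using that True by auto
    qed (rule eq)
    then show ?thesis using True eq[OF q] by (simp add: ext_deriv_def fun_ops sum_fun_apply scaleR_fun_def)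
  qed (simp add: d_out)
qed

text \<open>
  All conditions on a form are conditions at single points, except for the smoothness of its values, which is local.
\<close>

lemma forms_local:
  assumes "\<And>p. \<exists>U \<eta>. open U \<and> p \<in> U \<and> \<eta> \<in> forms C k \<and> loc_eq U \<omega> \<eta>"
  shows "\<omega> \<in> forms C k"
proof -
  have at: "\<exists>\<eta>\<in>forms C k. \<forall>Xs. \<omega> Xs p = \<eta> Xs p" for p
    using assms[of p] unfolding loc_eq_def by blast
  show ?thesis unfolding forms_def
  proof (intro CollectI conjI allI impI ballI)
    fix Xs assume "\<not> (length Xs = k \<and> set Xs \<subseteq> VF)"
    then have "\<omega> Xs p = 0" for p using at[of p] forms_out by (metis zero_fun_apply)
    then show "\<omega> Xs = 0" by (simp add: fun_eq_iff fun_ops)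
  next
    fix Xs
    show "\<omega> Xs \<in> C"
    proof (rule locality)
      fix p show "\<exists>U g. open U \<and> p \<in> U \<and> g \<in> C \<and> (\<forall>q\<in>U. \<omega> Xs q = g q)"
        using assms[of p] forms_in unfolding loc_eq_def by meson
    qed
  next
    fix Xs Ys X Y assume *: "X \<in> VF" "length Xs + 1 + length Ys = k" "set Xs \<union> set Ys \<subseteq> VF"
    show "\<omega> (Xs @ (X + Y) # Ys) = \<omega> (Xs @ X # Ys) + \<omega> (Xs @ Y # Ys)" if "Y \<in> VF"
    proof
      fix p
      obtain \<eta> where "\<eta> \<in> forms C k" "\<And>Xs. \<omega> Xs p = \<eta> Xs p" using at by blast
      then show "\<omega> (Xs @ (X + Y) # Ys) p = (\<omega> (Xs @ X # Ys) + \<omega> (Xs @ Y # Ys)) p"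
        using forms_add_at[OF _ *(1) that *(2,3), of \<eta>] by (simp add: fun_ops)
    qed
    show "\<omega> (Xs @ (\<lambda>g. f * X g) # Ys) = f * \<omega> (Xs @ X # Ys)" if "f \<in> C" for f
    proof
      fix p
      obtain \<eta> where "\<eta> \<in> forms C k" "\<And>Xs. \<omega> Xs p = \<eta> Xs p" using at by blast
      then show "\<omega> (Xs @ (\<lambda>g. f * X g) # Ys) p = (f * \<omega> (Xs @ X # Ys)) p"
        using forms_fmult_at[OF _ *(1) that *(2,3), of \<eta>] by (simp add: fun_ops)
    qed
  next
    fix Xs :: "'a vfield list" assume nd: "\<not> distinct Xs"
    have "\<omega> Xs p = 0" for p using at[of p] forms_alt[OF _ nd] by (metis zero_fun_apply)
    then show "\<omega> Xs = 0" by (simp add: fun_eq_iff fun_ops)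
  qed
qed

text \<open>
  Tensoriality. The frame expands \<open>X\<close> only near \<open>q\<close>, but \<open>\<rho> X\<close> globally, and \<open>\<rho>\<close> can be pulled out of the form.
\<close>

lemma form_expand:
  assumes F: "frame_on U m x E" and q: "q \<in> U" and w: "\<omega> \<in> forms C k" and X: "X \<in> VF"
  shows "\<omega> (X # Xs) q = (\<Sum>i<m. X (x i) q * \<omega> (E i # Xs) q)"
proof -
  have U: "open U" and xE: "\<And>i. i < m \<Longrightarrow> x i \<in> C" "\<And>i. i < m \<Longrightarrow> E i \<in> VF"
    and fr: "\<And>f q. f \<in> C \<Longrightarrow> q \<in> U \<Longrightarrow> X f q = (\<Sum>i<m. X (x i) q * E i f q)"
    using F X unfolding frame_on_def by blast+
  obtain \<rho> where \<rho>: "\<rho> \<in> C" "\<rho> q = 1" "\<And>q'. q' \<notin> U \<Longrightarrow> \<rho> q' = 0" by (rule bump_at[OF U q]) blast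
  have "(\<lambda>g. \<rho> * X g) = (\<lambda>g. \<Sum>i<m. (\<rho> * X (x i)) * E i g)"
  proof (intro ext)
    fix g q'
    show "(\<rho> * X g) q' = (\<Sum>i<m. (\<rho> * X (x i)) * E i g) q'"
    proof (cases "g \<in> C")
      case True
      then show ?thesis
        using fr[of g q'] \<rho>(3)[of q'] by (cases "q' \<in> U") (simp_all add: sum_fun_apply fun_ops sum_distrib_left mult_ac)
    next
      case False
      then show ?thesis using X xE(2) by (simp add: sum_fun_apply fun_ops VF_out)
    qed
  qed
  then have "contr (\<lambda>g. \<rho> * X g) \<omega> Xs q = contr (\<lambda>g. \<Sum>i<m. (\<rho> * X (x i)) * E i g) \<omega> Xs q" by simp
  moreover have "contr (\<lambda>g. \<rho> * X g) \<omega> = fscale \<rho> (contr X \<omega>)" by (rule contr_fmult[OF w X \<rho>(1)])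
  moreover have "contr (\<lambda>g. \<Sum>i<m. (\<rho> * X (x i)) * E i g) \<omega> = (\<Sum>i<m. fscale (\<rho> * X (x i)) (contr (E i) \<omega>))"
    by (rule contr_lincomb[OF w]) (use xE X \<rho>(1) in \<open>auto intro!: mult_in intro: VF_in\<close>)
  ultimately have "fscale \<rho> (contr X \<omega>) Xs q = (\<Sum>i<m. fscale (\<rho> * X (x i)) (contr (E i) \<omega>)) Xs q"
    by (simp only:)
  then show ?thesis using \<rho>(2) by (simp add: fscale_def contr_def sum_fun_apply fun_ops)
qed

end

locale poisson_algebra = framed_function_algebra C
  for C :: "('a::topological_space \<Rightarrow> real) set" +
  fixes \<pi> :: "'a form \<Rightarrow> 'a form \<Rightarrow> 'a \<Rightarrow> real"
  assumes bivector: "bivector_field C \<pi>"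
    and Jacobi: "f \<in> C \<Longrightarrow> g \<in> C \<Longrightarrow> h \<in> C \<Longrightarrow>
      poisson_bracket C \<pi> f (poisson_bracket C \<pi> g h) + poisson_bracket C \<pi> g (poisson_bracket C \<pi> h f)
        + poisson_bracket C \<pi> h (poisson_bracket C \<pi> f g) = 0"
begin

abbreviation dfun :: "('a \<Rightarrow> real) \<Rightarrow> 'a form" where "dfun f \<equiv> d (of_fun f)"
abbreviation \<iota> :: "'a form \<Rightarrow> 'a form" where "\<iota> \<equiv> interior_prod C \<pi>"
abbreviation \<delta> :: "'a form \<Rightarrow> 'a form" where "\<delta> \<equiv> koszul_diff C \<pi>"
abbreviation br :: "('a \<Rightarrow> real) \<Rightarrow> ('a \<Rightarrow> real) \<Rightarrow> 'a \<Rightarrow> real" where "br \<equiv> poisson_bracket C \<pi>"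

lemma dfun_forms: "f \<in> C \<Longrightarrow> dfun f \<in> forms C 1"
  using d_forms[OF of_fun_forms] by (simp add: One_nat_def)

lemma dfun_single: "X \<in> VF \<Longrightarrow> dfun f [X] = X f"
  by (simp add: d_single of_fun_def)

lemma pi_in: "\<alpha> \<in> forms C 1 \<Longrightarrow> \<beta> \<in> forms C 1 \<Longrightarrow> \<pi> \<alpha> \<beta> \<in> C"
  and pi_self: "\<alpha> \<in> forms C 1 \<Longrightarrow> \<pi> \<alpha> \<alpha> = 0"
  and pi_add: "\<alpha> \<in> forms C 1 \<Longrightarrow> \<beta> \<in> forms C 1 \<Longrightarrow> \<gamma> \<in> forms C 1 \<Longrightarrow> \<pi> (\<alpha> + \<beta>) \<gamma> = \<pi> \<alpha> \<gamma> + \<pi> \<beta> \<gamma>"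
    "\<alpha> \<in> forms C 1 \<Longrightarrow> \<beta> \<in> forms C 1 \<Longrightarrow> \<gamma> \<in> forms C 1 \<Longrightarrow> \<pi> \<gamma> (\<alpha> + \<beta>) = \<pi> \<gamma> \<alpha> + \<pi> \<gamma> \<beta>"
  and pi_fscale: "f \<in> C \<Longrightarrow> \<alpha> \<in> forms C 1 \<Longrightarrow> \<beta> \<in> forms C 1 \<Longrightarrow> \<pi> (fscale f \<alpha>) \<beta> = f * \<pi> \<alpha> \<beta>"
    "f \<in> C \<Longrightarrow> \<alpha> \<in> forms C 1 \<Longrightarrow> \<beta> \<in> forms C 1 \<Longrightarrow> \<pi> \<alpha> (fscale f \<beta>) = f * \<pi> \<alpha> \<beta>"
  using bivector unfolding bivector_field_def by blast+

lemma pi_anti: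
  assumes "\<alpha> \<in> forms C 1" "\<beta> \<in> forms C 1"
  shows "\<pi> \<alpha> \<beta> = - \<pi> \<beta> \<alpha>"
proof -
  have "\<pi> (\<alpha> + \<beta>) (\<alpha> + \<beta>) = 0" by (rule pi_self[OF forms_add[OF assms]])
  moreover have "\<pi> (\<alpha> + \<beta>) (\<alpha> + \<beta>) = (\<pi> \<alpha> \<alpha> + \<pi> \<beta> \<alpha>) + (\<pi> \<alpha> \<beta> + \<pi> \<beta> \<beta>)"
    by (simp only: pi_add assms forms_add)
  ultimately have "\<pi> \<alpha> \<beta> + \<pi> \<beta> \<alpha> = 0"
    using assms by (simp add: pi_self add.commute)
  then show ?thesis by (simp add: eq_neg_iff_add_eq_0)
qed

lemma pi_zero: "\<alpha> \<in> forms C 1 \<Longrightarrow> \<pi> 0 \<alpha> = 0"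
  using pi_add(1)[of 0 0 \<alpha>] by simp

lemma pi_lincomb:
  assumes "\<And>i. i \<in> I \<Longrightarrow> c i \<in> C \<and> \<alpha> i \<in> forms C 1" "\<beta> \<in> forms C 1"
  shows "\<pi> (\<Sum>i\<in>I. fscale (c i) (\<alpha> i)) \<beta> = (\<Sum>i\<in>I. c i * \<pi> (\<alpha> i) \<beta>)"
  using assms(1)
  by (induction I rule: infinite_finite_induct)
    (simp_all add: pi_zero assms(2) pi_add pi_fscale forms_fscale forms_sum del: form_ops)

lemma pi_expand1:
  assumes F: "frame_on U m x E" and q: "q \<in> U" and a: "\<alpha> \<in> forms C 1" and b: "\<beta> \<in> forms C 1"
  shows "\<pi> \<alpha> \<beta> q = (\<Sum>i<m. \<alpha> [E i] q * \<pi> (dfun (x i)) \<beta> q)"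
proof -
  have U: "open U" and xE: "\<And>i. i < m \<Longrightarrow> x i \<in> C" "\<And>i. i < m \<Longrightarrow> E i \<in> VF"
    using F unfolding frame_on_def by blast+
  obtain \<rho> where \<rho>: "\<rho> \<in> C" "\<rho> q = 1" "\<And>q'. q' \<notin> U \<Longrightarrow> \<rho> q' = 0" by (rule bump_at[OF U q]) blast
  have s: "(\<Sum>i<m. fscale (\<rho> * \<alpha> [E i]) (dfun (x i))) \<in> forms C 1"
    using xE \<rho>(1) by (intro forms_sum forms_fscale dfun_forms mult_in forms_in[OF a]) auto
  have "fscale \<rho> \<alpha> = (\<Sum>i<m. fscale (\<rho> * \<alpha> [E i]) (dfun (x i)))"
  proof
    fix Xs
    show "fscale \<rho> \<alpha> Xs = (\<Sum>i<m. fscale (\<rho> * \<alpha> [E i]) (dfun (x i))) Xs"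
    proof (cases "length Xs = 1 \<and> set Xs \<subseteq> VF")
      case True
      then obtain X where Xs: "Xs = [X]" and X: "X \<in> VF" by (auto simp: length_Suc_conv One_nat_def)
      show ?thesis
      proof
        fix q'
        show "fscale \<rho> \<alpha> Xs q' = (\<Sum>i<m. fscale (\<rho> * \<alpha> [E i]) (dfun (x i))) Xs q'"
          using form_expand[OF F _ a X, of q' "[]"] \<rho>(3)[of q']
          by (cases "q' \<in> U") (simp_all add: Xs fscale_def sum_fun_apply fun_ops dfun_single X sum_distrib_left mult_ac)
      qed
    next
      case False
      then show ?thesis
        by (simp only: forms_out[OF s False] forms_out[OF forms_fscale[OF a \<rho>(1)] False])
    qed
  qed
  then have "\<pi> (fscale \<rho> \<alpha>) \<beta> = (\<Sum>i<m. (\<rho> * \<alpha> [E i]) * \<pi> (dfun (x i)) \<beta>)"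
    by (simp only:) (rule pi_lincomb[OF _ b], use xE \<rho>(1) in \<open>auto intro!: mult_in forms_in[OF a] dfun_forms\<close>)
  then have "(\<rho> * \<pi> \<alpha> \<beta>) q = (\<Sum>i<m. (\<rho> * \<alpha> [E i]) * \<pi> (dfun (x i)) \<beta>) q"
    by (simp only: pi_fscale(1)[OF \<rho>(1) a b])
  then show ?thesis using \<rho>(2) by (simp add: sum_fun_apply fun_ops)
qed

lemma pi_expand:
  assumes F: "frame_on U m x E" and q: "q \<in> U" and a: "\<alpha> \<in> forms C 1" and b: "\<beta> \<in> forms C 1"
  shows "\<pi> \<alpha> \<beta> q = (\<Sum>i<m. \<Sum>j<m. \<alpha> [E i] q * \<beta> [E j] q * \<pi> (dfun (x i)) (dfun (x j)) q)"
proof -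
  have x: "dfun (x i) \<in> forms C 1" if "i < m" for i using F that dfun_forms unfolding frame_on_def by blast
  have "\<pi> (dfun (x i)) \<beta> q = (\<Sum>j<m. \<beta> [E j] q * \<pi> (dfun (x i)) (dfun (x j)) q)" if "i < m" for i
    using pi_expand1[OF F q b x[OF that]] pi_anti[OF b x[OF that]] pi_anti[OF x x[OF that]]
    by (simp add: fun_ops sum_negf)
  then show ?thesis
    unfolding pi_expand1[OF F q a b] by (simp add: sum_distrib_left mult.assoc)
qed

text \<open>
  Half of the contraction of the bivector with \<open>dx j\<close> in its second argument. The bivector is the sum of the wedge products of
  \<open>half_sharp m x E j\<close> and \<open>E j\<close> on the frame domain. The factor \<open>1 / 2\<close> compensates for \<open>E i\<close> and \<open>E j\<close> being paired
  twice, in both orders.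
\<close>

definition half_sharp :: "nat \<Rightarrow> (nat \<Rightarrow> 'a \<Rightarrow> real) \<Rightarrow> (nat \<Rightarrow> 'a vfield) \<Rightarrow> nat \<Rightarrow> 'a vfield" where
  "half_sharp m x E j = (\<lambda>g. \<Sum>i<m. ((1 / 2) *\<^sub>R \<pi> (dfun (x i)) (dfun (x j))) * E i g)"

lemma half_sharp_VF:
  assumes "frame_on U m x E" "j < m"
  shows "half_sharp m x E j \<in> VF"
  unfolding half_sharp_def
  by (rule VF_lincomb) (use assms in \<open>auto simp: frame_on_def intro!: scaleR_in pi_in dfun_forms\<close>)

lemma local_decomposition:
  assumes F: "frame_on U m x E" and q: "q \<in> U"
  shows "decomposes_at C \<pi> q (map (\<lambda>j. (half_sharp m x E j, E j)) [0..<m])"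
  unfolding decomposes_at_def
proof (intro conjI ballI)
  have xE: "\<And>i. i < m \<Longrightarrow> x i \<in> C" "\<And>i. i < m \<Longrightarrow> E i \<in> VF"
    using F unfolding frame_on_def by blast+
  show "set (map (\<lambda>j. (half_sharp m x E j, E j)) [0..<m]) \<subseteq> VF \<times> VF"
    using half_sharp_VF[OF F] xE by auto
  fix \<alpha> \<beta> assume a: "\<alpha> \<in> forms C 1" and b: "\<beta> \<in> forms C 1"
  define P where "P i j = \<pi> (dfun (x i)) (dfun (x j)) q" for i j
  have P: "P j i = - P i j" if "i < m" "j < m" for i j
    using pi_anti[OF dfun_forms[OF xE(1)[OF that(1)]] dfun_forms[OF xE(1)[OF that(2)]]]
    by (simp add: P_def fun_ops)
  have A: "\<gamma> [half_sharp m x E j] q = (\<Sum>i<m. P i j / 2 * \<gamma> [E i] q)" if "\<gamma> \<in> forms C 1" "j < m" for \<gamma> j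
  proof -
    have "contr (half_sharp m x E j) \<gamma> = (\<Sum>i<m. fscale ((1 / 2) *\<^sub>R \<pi> (dfun (x i)) (dfun (x j))) (contr (E i) \<gamma>))"
      unfolding half_sharp_def using xE that(2)
      by (intro contr_lincomb[OF that(1)]) (auto intro!: scaleR_in pi_in dfun_forms)
    from fun_cong[OF fun_cong[OF this, of "[]"], of q] show ?thesis
      by (simp add: contr_def fscale_def sum_fun_apply fun_ops scaleR_fun_def P_def)
  qed
  have "(\<Sum>j<m. \<alpha> [half_sharp m x E j] q * \<beta> [E j] q - \<alpha> [E j] q * \<beta> [half_sharp m x E j] q) =
      (\<Sum>j<m. \<Sum>i<m. P i j / 2 * \<alpha> [E i] q * \<beta> [E j] q) - (\<Sum>j<m. \<Sum>i<m. P i j / 2 * \<alpha> [E j] q * \<beta> [E i] q)"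
    unfolding sum_subtractf[symmetric]
    by (intro sum.cong refl) (simp add: A a b sum_subtractf sum_distrib_left sum_distrib_right mult_ac)
  also have "(\<Sum>j<m. \<Sum>i<m. P i j / 2 * \<alpha> [E j] q * \<beta> [E i] q) = (\<Sum>j<m. \<Sum>i<m. P j i / 2 * \<alpha> [E i] q * \<beta> [E j] q)"
    by (rule sum.swap)
  also have "(\<Sum>j<m. \<Sum>i<m. P i j / 2 * \<alpha> [E i] q * \<beta> [E j] q) - \<dots> = (\<Sum>j<m. \<Sum>i<m. \<alpha> [E i] q * \<beta> [E j] q * P i j)"
    unfolding sum_subtractf[symmetric]
  proof (intro sum.cong refl)
    fix j i assume "j \<in> {..<m}" "i \<in> {..<m}"
    then have Pji: "P j i = - P i j" by (intro P) auto
    show "P i j / 2 * \<alpha> [E i] q * \<beta> [E j] q - P j i / 2 * \<alpha> [E i] q * \<beta> [E j] q = \<alpha> [E i] q * \<beta> [E j] q * P i j"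
      unfolding Pji by simp
  qed
  also have "\<dots> = (\<Sum>i<m. \<Sum>j<m. \<alpha> [E i] q * \<beta> [E j] q * P i j)" by (rule sum.swap)
  also have "\<dots> = \<pi> \<alpha> \<beta> q" unfolding P_def by (rule pi_expand[OF F q a b, symmetric])
  finally show "\<pi> \<alpha> \<beta> q = (\<Sum>(A, B)\<leftarrow>map (\<lambda>j. (half_sharp m x E j, E j)) [0..<m]. \<alpha> [A] q * \<beta> [B] q - \<alpha> [B] q * \<beta> [A] q)"
    by (simp add: o_def interv_sum_list_conv_sum_set_nat atLeast0LessThan)
qed

text \<open>
  The coefficients of a decomposition at \<open>q\<close> in the frame, antisymmetrised, are the values of the bivector on the \<open>dx i\<close>, and a form sees
  only this antisymmetric part. So every decomposition yields the same interior product, in particular the one at the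
  single point \<open>q\<close> chosen in its definition and the smooth one of \<open>local_decomposition\<close>.
\<close>

lemma decomposition_independent:
  assumes F: "frame_on U m x E" and q: "q \<in> U" and D: "decomposes_at C \<pi> q ABs" and w: "\<omega> \<in> forms C k"
  shows "(\<Sum>(A, B)\<leftarrow>ABs. \<omega> (A # B # Xs) q) =
    (\<Sum>i<m. \<Sum>j<m. \<pi> (dfun (x i)) (dfun (x j)) q / 2 * \<omega> (E i # E j # Xs) q)"
proof -
  have xE: "\<And>i. i < m \<Longrightarrow> x i \<in> C" "\<And>i. i < m \<Longrightarrow> E i \<in> VF"
    using F unfolding frame_on_def by blast+
  define W where "W i j = \<omega> (E i # E j # Xs) q" for i j
  have W: "W j i = - W i j" if "i < m" "j < m" for i j
    using fun_cong[OF fun_cong[OF contr_anti[OF w xE(2)[OF that(1)] xE(2)[OF that(2)]], of Xs], of q]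
    by (simp add: W_def contr_def fun_ops)
  have expand2: "\<omega> (A # B # Xs) q = (\<Sum>i<m. \<Sum>j<m. (A (x i) q * B (x j) q - B (x i) q * A (x j) q) * (W i j / 2))"
    if AB: "A \<in> VF" "B \<in> VF" for A B
  proof -
    have "\<omega> (A # B # Xs) q = (\<Sum>i<m. A (x i) q * (\<Sum>j<m. B (x j) q * W i j))"
    proof -
      have "\<omega> (E i # B # Xs) q = (\<Sum>j<m. B (x j) q * W i j)" if "i < m" for i
        using form_expand[OF F q contr_forms[OF w xE(2)[OF that]] AB(2), of Xs] by (simp add: contr_def W_def)
      then show ?thesis unfolding form_expand[OF F q w AB(1)] by simp
    qed
    then have 1: "\<omega> (A # B # Xs) q = (\<Sum>i<m. \<Sum>j<m. A (x i) q * B (x j) q * W i j)"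
      by (simp add: sum_distrib_left mult.assoc)
    also have "\<dots> = (\<Sum>i<m. \<Sum>j<m. A (x j) q * B (x i) q * W j i)" by (rule sum.swap)
    also have "\<dots> = (\<Sum>i<m. \<Sum>j<m. - (A (x j) q * B (x i) q * W i j))"
    proof (intro sum.cong refl)
      fix i j assume "i \<in> {..<m}" "j \<in> {..<m}"
      then have Wji: "W j i = - W i j" by (intro W) auto
      show "A (x j) q * B (x i) q * W j i = - (A (x j) q * B (x i) q * W i j)" unfolding Wji by simp
    qed
    finally have "2 * \<omega> (A # B # Xs) q = (\<Sum>i<m. \<Sum>j<m. A (x i) q * B (x j) q * W i j) + (\<Sum>i<m. \<Sum>j<m. - (A (x j) q * B (x i) q * W i j))"
      using 1 by simp
    also have "\<dots> = 2 * (\<Sum>i<m. \<Sum>j<m. (A (x i) q * B (x j) q - B (x i) q * A (x j) q) * (W i j / 2))"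
      unfolding sum.distrib[symmetric] sum_distrib_left by (intro sum.cong refl) (simp add: algebra_simps)
    finally show ?thesis by simp
  qed
  have sub: "set ABs \<subseteq> VF \<times> VF" using D by (simp add: decomposes_at_def)
  have "(\<Sum>(A, B)\<leftarrow>ABs. \<omega> (A # B # Xs) q) =
      (\<Sum>(A, B)\<leftarrow>ABs. \<Sum>i<m. \<Sum>j<m. (A (x i) q * B (x j) q - B (x i) q * A (x j) q) * (W i j / 2))"
    using sub expand2 by (intro arg_cong[of _ _ sum_list] map_cong refl) auto
  also have "\<dots> = (\<Sum>i<m. \<Sum>j<m. (\<Sum>(A, B)\<leftarrow>ABs. A (x i) q * B (x j) q - B (x i) q * A (x j) q) * (W i j / 2))"
    by (simp only: case_prod_unfold sum_list_sum_swap sum_list_mult_const)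
  also have "\<dots> = (\<Sum>i<m. \<Sum>j<m. \<pi> (dfun (x i)) (dfun (x j)) q * (W i j / 2))"
  proof (intro sum.cong refl)
    fix i j assume "i \<in> {..<m}" "j \<in> {..<m}"
    then have "\<pi> (dfun (x i)) (dfun (x j)) q = (\<Sum>(A, B)\<leftarrow>ABs. dfun (x i) [A] q * dfun (x j) [B] q - dfun (x i) [B] q * dfun (x j) [A] q)"
      using D xE dfun_forms unfolding decomposes_at_def by blast
    also have "\<dots> = (\<Sum>(A, B)\<leftarrow>ABs. A (x i) q * B (x j) q - B (x i) q * A (x j) q)"
      using sub by (intro arg_cong[of _ _ sum_list] map_cong refl) (auto simp: dfun_single)
    finally show "(\<Sum>(A, B)\<leftarrow>ABs. A (x i) q * B (x j) q - B (x i) q * A (x j) q) * (W i j / 2) =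
        \<pi> (dfun (x i)) (dfun (x j)) q * (W i j / 2)" by simp
  qed
  finally show ?thesis by (simp add: W_def)
qed

lemma decomposes_some: "decomposes_at C \<pi> p (SOME ABs. decomposes_at C \<pi> p ABs)"
proof -
  obtain U m x E where F: "frame_on U m x E" "p \<in> U" by (rule frame_exists)
  show ?thesis by (rule someI, rule local_decomposition[OF F])
qed

definition contr_pairs :: "nat \<Rightarrow> (nat \<Rightarrow> 'a vfield) \<Rightarrow> (nat \<Rightarrow> 'a vfield) \<Rightarrow> 'a form \<Rightarrow> 'a form" where
  "contr_pairs m A B \<omega> = (\<Sum>j<m. contr (B j) (contr (A j) \<omega>))"

lemma contr_pairs_forms:
  assumes AB: "\<And>j. j < m \<Longrightarrow> A j \<in> VF \<and> B j \<in> VF" and w: "\<omega> \<in> forms C k"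
  shows "contr_pairs m A B \<omega> \<in> forms C (k - 2)"
  unfolding contr_pairs_def
proof (rule forms_sum)
  fix j assume "j \<in> {..<m}"
  then have "contr (B j) (contr (A j) \<omega>) \<in> forms C (k - 1 - 1)"
    using AB by (intro contr_forms w) auto
  then show "contr (B j) (contr (A j) \<omega>) \<in> forms C (k - 2)" by (simp add: diff_diff_left)
qed

lemma interior_local:
  assumes F: "frame_on U m x E" and w: "\<omega> \<in> forms C k"
  shows "loc_eq U (\<iota> \<omega>) (contr_pairs m (half_sharp m x E) E \<omega>)"
  unfolding loc_eq_def
proof (intro allI ballI)
  fix Xs q assume q: "q \<in> U"
  have "\<iota> \<omega> Xs q = (\<Sum>(A, B)\<leftarrow>map (\<lambda>j. (half_sharp m x E j, E j)) [0..<m]. \<omega> (A # B # Xs) q)"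
    unfolding interior_prod_def decomposition_independent[OF F q decomposes_some w]
    by (rule decomposition_independent[OF F q local_decomposition[OF F q] w, symmetric])
  then show "\<iota> \<omega> Xs q = contr_pairs m (half_sharp m x E) E \<omega> Xs q"
    by (simp add: o_def interv_sum_list_conv_sum_set_nat atLeast0LessThan contr_pairs_def sum_fun_apply contr_def)
qed

lemma interior_forms: "\<omega> \<in> forms C k \<Longrightarrow> \<iota> \<omega> \<in> forms C (k - 2)"
proof (rule forms_local)
  fix p assume w: "\<omega> \<in> forms C k"
  obtain U m x E where F: "frame_on U m x E" "p \<in> U" by (rule frame_exists)
  have "contr_pairs m (half_sharp m x E) E \<omega> \<in> forms C (k - 2)"
    by (rule contr_pairs_forms[OF _ w]) (use half_sharp_VF[OF F(1)] F(1) in \<open>auto simp: frame_on_def\<close>)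
  then show "\<exists>U \<eta>. open U \<and> p \<in> U \<and> \<eta> \<in> forms C (k - 2) \<and> loc_eq U (\<iota> \<omega>) \<eta>"
    using interior_local[OF F(1) w] F unfolding frame_on_def by blast
qed

lemma interior_add: "\<iota> (\<omega> + \<eta>) = \<iota> \<omega> + \<iota> \<eta>"
  by (simp add: interior_prod_def fun_eq_iff fun_ops case_prod_unfold sum_list_addf)

lemma interior_scaleR: "\<iota> (c *\<^sub>R \<omega>) = c *\<^sub>R \<iota> \<omega>"
  by (simp add: interior_prod_def fun_eq_iff scaleR_fun_def case_prod_unfold sum_list_const_mult)

lemma interior_0: "\<iota> 0 = 0"
  using interior_scaleR[of 0 0] by simp

lemma interior_uminus: "\<iota> (- \<omega>) = - \<iota> \<omega>"
  using interior_scaleR[of "-1" \<omega>] by simp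

lemma interior_diff: "\<iota> (\<omega> - \<eta>) = \<iota> \<omega> - \<iota> \<eta>"
  using interior_add[of \<omega> "- \<eta>"] interior_uminus[of \<eta>] by simp

lemma interior_low: "\<omega> \<in> forms C k \<Longrightarrow> k < 2 \<Longrightarrow> \<iota> \<omega> = 0"
proof -
  assume "\<omega> \<in> forms C k" "k < 2"
  then have "\<omega> (A # B # Xs) = 0" for A B Xs using forms_out[of \<omega> k "A # B # Xs"] by simp
  then show ?thesis by (simp add: interior_prod_def fun_eq_iff fun_ops case_prod_unfold)
qed

lemma bracket_eq_pi: "f \<in> C \<Longrightarrow> g \<in> C \<Longrightarrow> br f g = \<pi> (dfun f) (dfun g)"
proof
  fix p assume "f \<in> C" "g \<in> C"
  then have "\<pi> (dfun f) (dfun g) p = (\<Sum>(A, B)\<leftarrow>(SOME ABs. decomposes_at C \<pi> p ABs).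
      dfun f [A] p * dfun g [B] p - dfun f [B] p * dfun g [A] p)"
    using decomposes_some[of p] dfun_forms unfolding decomposes_at_def by blast
  then show "br f g p = \<pi> (dfun f) (dfun g) p"
    by (simp add: poisson_bracket_def interior_prod_def wedge1_def fun_ops)
qed

lemma bracket_in: "f \<in> C \<Longrightarrow> g \<in> C \<Longrightarrow> br f g \<in> C"
  by (simp add: bracket_eq_pi pi_in dfun_forms)

lemma bracket_local:
  assumes F: "frame_on U m x E" and q: "q \<in> U" and fg: "f \<in> C" "g \<in> C"
  shows "br f g q = (\<Sum>j<m. half_sharp m x E j f q * E j g q - E j f q * half_sharp m x E j g q)"
proof -
  have "br f g q = (\<Sum>(A, B)\<leftarrow>map (\<lambda>j. (half_sharp m x E j, E j)) [0..<m]. dfun f [A] q * dfun g [B] q - dfun f [B] q * dfun g [A] q)"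
    using local_decomposition[OF F q] dfun_forms fg unfolding decomposes_at_def bracket_eq_pi[OF fg] by blast
  also have "\<dots> = (\<Sum>j<m. dfun f [half_sharp m x E j] q * dfun g [E j] q - dfun f [E j] q * dfun g [half_sharp m x E j] q)"
    by (simp add: o_def interv_sum_list_conv_sum_set_nat atLeast0LessThan)
  also have "\<dots> = (\<Sum>j<m. half_sharp m x E j f q * E j g q - E j f q * half_sharp m x E j g q)"
    using F half_sharp_VF[OF F] by (intro sum.cong refl) (auto simp: dfun_single frame_on_def)
  finally show ?thesis .
qed

lemma contr_sum: "contr X (\<Sum>i\<in>I. \<omega> i) = (\<Sum>i\<in>I. contr X (\<omega> i))"
  by (induction I rule: infinite_finite_induct) (simp_all del: form_ops)

lemma d_sum: "(\<And>i. i \<in> I \<Longrightarrow> \<omega> i \<in> forms C k) \<Longrightarrow> d (\<Sum>i\<in>I. \<omega> i) = (\<Sum>i\<in>I. d (\<omega> i))"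
proof (induction I rule: infinite_finite_induct)
  case (insert i I)
  have "d (\<omega> i + sum \<omega> I) = d (\<omega> i) + d (sum \<omega> I)"
    by (rule d_add[OF forms_cochains forms_cochains[OF forms_sum]]) (use insert.prems in auto)
  then show ?case using insert by (simp del: form_ops)
qed (simp_all add: d_0 del: form_ops)

lemma lie_sum:
  assumes "X \<in> VF"
  shows "(\<And>i. i \<in> I \<Longrightarrow> \<omega> i \<in> forms C k) \<Longrightarrow> lie X (\<Sum>i\<in>I. \<omega> i) = (\<Sum>i\<in>I. lie X (\<omega> i))"
proof (induction I rule: infinite_finite_induct)
  case (insert i I)
  have "lie X (\<omega> i + sum \<omega> I) = lie X (\<omega> i) + lie X (sum \<omega> I)"
    by (rule lie_add[OF assms forms_cochains forms_cochains[OF forms_sum]]) (use insert.prems in auto)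
  then show ?case using insert by (simp del: form_ops)
qed (simp_all add: lie_0 assms del: form_ops)

lemma lie_contr: "X \<in> VF \<Longrightarrow> Y \<in> VF \<Longrightarrow> \<omega> \<in> forms C k \<Longrightarrow>
    lie X (contr Y \<omega>) = contr Y (lie X \<omega>) + contr (lie_bracket X Y) \<omega>"
  using contr_lie[OF forms_cochains] by (simp del: form_ops)

lemma d_contr: "X \<in> VF \<Longrightarrow> \<omega> \<in> forms C k \<Longrightarrow> d (contr X \<omega>) = lie X \<omega> - contr X (d \<omega>)"
  using contr_d by (simp del: form_ops)

text \<open>
  All Lie derivatives of \<open>\<omega>\<close> cancel when they are moved to the right past the contractions; what remains are the commutators
  of Lie derivatives and contractions. Summed over two pairs of vector fields, this is the trivector that represents
  the Schouten bracket.
\<close>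

lemma Schouten_term:
  assumes V: "A \<in> VF" "B \<in> VF" "A' \<in> VF" "B' \<in> VF" and w: "\<omega> \<in> forms C k"
  shows "contr B (lie A (contr B' (contr A' \<omega>))) - lie B (contr A (contr B' (contr A' \<omega>)))
      - contr B' (contr A' (contr B (lie A \<omega>) - lie B (contr A \<omega>)))
    = contr B (contr B' (contr (lie_bracket A A') \<omega>)) + contr B (contr (lie_bracket A B') (contr A' \<omega>))
      - contr B' (contr (lie_bracket B A') (contr A \<omega>)) - contr (lie_bracket B B') (contr A' (contr A \<omega>))"
proof -
  note c = contr_forms
  have 1: "lie X (contr B' (contr A' \<eta>)) = contr B' (contr A' (lie X \<eta>)) + contr B' (contr (lie_bracket X A') \<eta>)
      + contr (lie_bracket X B') (contr A' \<eta>)" if "X \<in> VF" "\<eta> \<in> forms C r" for X \<eta> r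
    using lie_contr[OF that(1) V(4) c[OF that(2) V(3)]] lie_contr[OF that(1) V(3) that(2)] by (simp del: form_ops)
  have "contr A (contr B' (contr A' \<omega>)) = - contr B' (contr A (contr A' \<omega>))"
    by (rule contr_anti[OF c[OF w V(3)] V(1,4)])
  also have "contr A (contr A' \<omega>) = - contr A' (contr A \<omega>)" by (rule contr_anti[OF w V(1,3)])
  finally have 2: "contr A (contr B' (contr A' \<omega>)) = contr B' (contr A' (contr A \<omega>))" by (simp del: form_ops)
  have l: "lie A \<omega> \<in> forms C k" by (rule lie_forms[OF V(1) w])
  have "contr A' (contr B (lie A \<omega>)) = - contr B (contr A' (lie A \<omega>))"
    by (rule contr_anti[OF l V(3,2)])
  moreover have "contr B' (contr B (contr A' (lie A \<omega>))) = - contr B (contr B' (contr A' (lie A \<omega>)))"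
    by (rule contr_anti[OF c[OF l V(3)] V(4,2)])
  ultimately have 3: "contr B' (contr A' (contr B (lie A \<omega>))) = contr B (contr B' (contr A' (lie A \<omega>)))"
    by (simp del: form_ops)
  show ?thesis
    using 1[OF V(1) w] 1[OF V(2) c[OF w V(1)]] unfolding 2 by (simp add: 3 del: form_ops)
qed

lemma contr_pairs_Schouten:
  assumes AB: "\<And>j. j < m \<Longrightarrow> A j \<in> VF" "\<And>j. j < m \<Longrightarrow> B j \<in> VF" and w: "\<omega> \<in> forms C k"
  defines "K \<equiv> contr_pairs m A B"
  shows "(K (d (K \<omega>)) - d (K (K \<omega>))) - (K (K (d \<omega>)) - K (d (K \<omega>))) = (\<Sum>j<m. \<Sum>l<m.
      contr (B j) (contr (B l) (contr (lie_bracket (A j) (A l)) \<omega>)) + contr (B j) (contr (lie_bracket (A j) (B l)) (contr (A l) \<omega>))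
      - contr (B l) (contr (lie_bracket (B j) (A l)) (contr (A j) \<omega>)) - contr (lie_bracket (B j) (B l)) (contr (A l) (contr (A j) \<omega>)))"
proof -
  note c = contr_forms
  \<comment> \<open>Cartan's formula, once for each contraction in \<open>K\<close>.\<close>
  have comm: "K (d \<eta>) - d (K \<eta>) = (\<Sum>j<m. contr (B j) (lie (A j) \<eta>) - lie (B j) (contr (A j) \<eta>))"
    if e: "\<eta> \<in> forms C r" for \<eta> r
  proof -
    have "d (K \<eta>) = (\<Sum>j<m. d (contr (B j) (contr (A j) \<eta>)))"
      unfolding K_def contr_pairs_def by (rule d_sum[OF c[OF c[OF e]]]) (use AB in auto)
    also have "\<dots> = (\<Sum>j<m. contr (B j) (contr (A j) (d \<eta>)) - (contr (B j) (lie (A j) \<eta>) - lie (B j) (contr (A j) \<eta>)))"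
    proof (intro sum.cong refl)
      fix j assume "j \<in> {..<m}"
      then have j: "A j \<in> VF" "B j \<in> VF" using AB by auto
      show "d (contr (B j) (contr (A j) \<eta>)) = contr (B j) (contr (A j) (d \<eta>)) - (contr (B j) (lie (A j) \<eta>) - lie (B j) (contr (A j) \<eta>))"
        unfolding d_contr[OF j(2) c[OF e j(1)]] d_contr[OF j(1) e] by (simp del: form_ops)
    qed
    finally show ?thesis unfolding K_def contr_pairs_def by (simp add: sum_subtractf del: form_ops)
  qed
  have Kw: "K \<omega> \<in> forms C (k - 2)" unfolding K_def by (rule contr_pairs_forms[OF _ w]) (use AB in auto)
  have cc: "contr (B l) (contr (A l) \<omega>) \<in> forms C (k - 1 - 1)" if "l < m" for l by (rule c[OF c[OF w]]) (use AB that in auto)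
  have "K (K (d \<omega>)) - K (d (K \<omega>)) = K (K (d \<omega>) - d (K \<omega>))"
    unfolding K_def contr_pairs_def by (simp add: sum_subtractf del: form_ops)
  also have "\<dots> = (\<Sum>l<m. \<Sum>j<m. contr (B l) (contr (A l) (contr (B j) (lie (A j) \<omega>) - lie (B j) (contr (A j) \<omega>))))"
    unfolding comm[OF w] by (simp only: K_def contr_pairs_def contr_sum)
  also have "\<dots> = (\<Sum>j<m. \<Sum>l<m. contr (B l) (contr (A l) (contr (B j) (lie (A j) \<omega>) - lie (B j) (contr (A j) \<omega>))))"
    by (rule sum.swap)
  finally have 2: "K (K (d \<omega>)) - K (d (K \<omega>)) = \<dots>" .
  have "K (d (K \<omega>)) - d (K (K \<omega>)) = (\<Sum>j<m. \<Sum>l<m. contr (B j) (lie (A j) (contr (B l) (contr (A l) \<omega>)))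
      - lie (B j) (contr (A j) (contr (B l) (contr (A l) \<omega>))))"
    unfolding comm[OF Kw]
  proof (intro sum.cong refl)
    fix j assume "j \<in> {..<m}"
    then have j: "A j \<in> VF" "B j \<in> VF" using AB by auto
    have "lie (A j) (K \<omega>) = (\<Sum>l<m. lie (A j) (contr (B l) (contr (A l) \<omega>)))"
      unfolding K_def contr_pairs_def by (rule lie_sum[OF j(1) cc]) simp
    moreover have "lie (B j) (contr (A j) (K \<omega>)) = (\<Sum>l<m. lie (B j) (contr (A j) (contr (B l) (contr (A l) \<omega>))))"
      unfolding K_def contr_pairs_def contr_sum by (rule lie_sum[OF j(2) c[OF cc j(1)]]) simp
    ultimately show "contr (B j) (lie (A j) (K \<omega>)) - lie (B j) (contr (A j) (K \<omega>)) = (\<Sum>l<m. contr (B j) (lie (A j) (contr (B l) (contr (A l) \<omega>)))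
        - lie (B j) (contr (A j) (contr (B l) (contr (A l) \<omega>))))"
      by (simp only: contr_sum sum_subtractf)
  qed
  then show ?thesis unfolding 2
    by (simp only: sum_subtractf[symmetric]) (intro sum.cong refl, rule Schouten_term[OF AB(1) AB(2) AB(1) AB(2) w], auto)
qed

text \<open>
  Expanded in the frame, the trivector is paired with antisymmetric values of \<open>\<omega>\<close>, so only its values on triples of differentials
  of the functions \<open>x i\<close> matter, and those are multiples of Jacobiators of the Poisson bracket.
\<close>

lemma trivector_vanishes:
  assumes F: "frame_on U m x E" and q: "q \<in> U" and w: "\<omega> \<in> forms C k"
  defines "A \<equiv> half_sharp m x E"
  shows "(\<Sum>j<m. \<Sum>l<m.
      contr (E j) (contr (E l) (contr (lie_bracket (A j) (A l)) \<omega>)) + contr (E j) (contr (lie_bracket (A j) (E l)) (contr (A l) \<omega>))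
      - contr (E l) (contr (lie_bracket (E j) (A l)) (contr (A j) \<omega>)) - contr (lie_bracket (E j) (E l)) (contr (A l) (contr (A j) \<omega>))) Xs q = 0"
proof -
  have U: "open U" and x: "\<And>i. i < m \<Longrightarrow> x i \<in> C" and E: "\<And>i. i < m \<Longrightarrow> E i \<in> VF"
    using F unfolding frame_on_def by blast+
  have A: "A i \<in> VF" if "i < m" for i unfolding A_def by (rule half_sharp_VF[OF F that])
  define W where "W a b c = (if a < m \<and> b < m \<and> c < m then \<omega> (E a # E b # E c # Xs) q else 0)" for a b c
  have W: "W b a c = - W a b c" "W a c b = - W a b c" for a b c
    using fun_cong[OF fun_cong[OF contr_anti[OF w, of "E a" "E b"], of "E c # Xs"], of q]
      fun_cong[OF fun_cong[OF contr_anti[OF contr_forms[OF w, of "E a"], of "E b" "E c"], of Xs], of q] E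
    by (auto simp: W_def contr_def fun_ops)
  have expand3: "contr Z (contr Y (contr X \<omega>)) Xs q = (\<Sum>a<m. \<Sum>b<m. \<Sum>c<m. X (x a) q * Y (x b) q * Z (x c) q * W a b c)"
    if V: "X \<in> VF" "Y \<in> VF" "Z \<in> VF" for X Y Z
  proof -
    have "\<omega> (E a # E b # Z # Xs) q = (\<Sum>c<m. Z (x c) q * W a b c)" if "a < m" "b < m" for a b
      using form_expand[OF F q contr_forms[OF contr_forms[OF w E[OF that(1)]] E[OF that(2)]] V(3), of Xs] that
      by (simp add: contr_def W_def)
    then have "\<omega> (E a # Y # Z # Xs) q = (\<Sum>b<m. \<Sum>c<m. Y (x b) q * Z (x c) q * W a b c)" if "a < m" for a
      using form_expand[OF F q contr_forms[OF w E[OF that]] V(2), of "Z # Xs"] that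
      by (simp add: contr_def sum_distrib_left mult.assoc)
    then show ?thesis
      using form_expand[OF F q w V(1), of "Y # Z # Xs"] by (simp add: contr_def sum_distrib_left mult.assoc)
  qed
  define a b where "a j u = A j (x u) q" and "b j u = E j (x u) q" for j u
  define aa ab ba bb where "aa j l u = A j (A l (x u)) q" and "ab j l u = A j (E l (x u)) q"
    and "ba j l u = E j (A l (x u)) q" and "bb j l u = E j (E l (x u)) q" for j l u
  define S where "S j l u v w = (aa j l u - aa l j u) * b l v * b j w + a l u * (ab j l v - ba l j v) * b j w
      - a j u * (ba j l v - ab l j v) * b l w - a j u * a l v * (bb j l w - bb l j w)" for j l u v w
  define J where "J j l u v w = a j u * (ba j l v * b l w + a l v * bb j l w - (bb j l v * a l w + b l v * ba j l w))
      - b j u * (aa j l v * b l w + a l v * ab j l w - (ab j l v * a l w + b l v * aa j l w))" for j l u v w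
  \<comment> \<open>The local formula for the bracket may be differentiated because it holds near \<open>q\<close>.\<close>
  have brJ: "br (x u) (br (x v) (x w)) q = (\<Sum>j<m. \<Sum>l<m. J j l u v w)" if uvw: "u < m" "v < m" "w < m" for u v w
  proof -
    define G where "G = (\<Sum>l<m. A l (x v) * E l (x w) - E l (x v) * A l (x w))"
    have in1: "A l (x v) * E l (x w) \<in> C" "E l (x v) * A l (x w) \<in> C" if "l < m" for l
      using VF_in[OF A[OF that] x] VF_in[OF E[OF that] x] uvw by (auto intro: mult_in)
    have G: "G \<in> C" unfolding G_def using in1 by (intro sum_in diff_in) auto
    have X: "X (br (x v) (x w)) q = (\<Sum>l<m. X (A l (x v)) q * E l (x w) q + A l (x v) q * X (E l (x w)) q
        - (X (E l (x v)) q * A l (x w) q + E l (x v) q * X (A l (x w)) q))" if X: "X \<in> VF" for X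
    proof -
      have "X (br (x v) (x w)) q = X G q"
        by (rule VF_local[OF X bracket_in[OF x x] G U _ q])
          (use uvw bracket_local[OF F] x in \<open>auto simp: G_def sum_fun_apply fun_ops A_def\<close>)
      also have "X G = (\<Sum>l<m. X (A l (x v) * E l (x w) - E l (x v) * A l (x w)))"
        unfolding G_def by (rule VF_sum[OF X]) (auto intro!: diff_in in1)
      also have "\<dots> = (\<Sum>l<m. X (A l (x v) * E l (x w)) - X (E l (x v) * A l (x w)))"
        by (intro sum.cong refl VF_diff[OF X] in1) auto
      also have "\<dots> q = (\<Sum>l<m. X (A l (x v) * E l (x w)) q - X (E l (x v) * A l (x w)) q)"
        by (simp add: sum_fun_apply fun_ops)
      also have "\<dots> = (\<Sum>l<m. X (A l (x v)) q * E l (x w) q + A l (x v) q * X (E l (x w)) q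
        - (X (E l (x v)) q * A l (x w) q + E l (x v) q * X (A l (x w)) q))"
      proof (intro sum.cong refl)
        fix l assume "l \<in> {..<m}"
        then have l: "A l (x v) \<in> C" "E l (x w) \<in> C" "E l (x v) \<in> C" "A l (x w) \<in> C"
          using VF_in[OF A x] VF_in[OF E x] uvw by auto
        show "X (A l (x v) * E l (x w)) q - X (E l (x v) * A l (x w)) q = X (A l (x v)) q * E l (x w) q + A l (x v) q * X (E l (x w)) q
            - (X (E l (x v)) q * A l (x w) q + E l (x v) q * X (A l (x w)) q)"
          unfolding VF_mult[OF X l(1,2)] VF_mult[OF X l(3,4)] by (simp add: fun_ops)
      qed
      finally show ?thesis .
    qed
    have "br (x u) (br (x v) (x w)) q = (\<Sum>j<m. A j (x u) q * E j (br (x v) (x w)) q - E j (x u) q * A j (br (x v) (x w)) q)"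
      unfolding A_def by (rule bracket_local[OF F q x bracket_in[OF x x]]) (use uvw in auto)
    also have "\<dots> = (\<Sum>j<m. \<Sum>l<m. J j l u v w)"
    proof (intro sum.cong refl)
      fix j assume "j \<in> {..<m}"
      then have j: "A j \<in> VF" "E j \<in> VF" using A E by auto
      show "A j (x u) q * E j (br (x v) (x w)) q - E j (x u) q * A j (br (x v) (x w)) q = (\<Sum>l<m. J j l u v w)"
        unfolding X[OF j(1)] X[OF j(2)] sum_distrib_left sum_subtractf[symmetric]
        by (simp only: J_def a_def b_def aa_def ab_def ba_def bb_def)
    qed
    finally show ?thesis .
  qed
  have Salt: "(\<Sum>j<m. \<Sum>l<m. S j l u v w - S j l u w v - S j l v u w + S j l v w u + S j l w u v - S j l w v u) = 0"
    if uvw: "u < m" "v < m" "w < m" for u v w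
  proof -
    have "(\<Sum>j<m. \<Sum>l<m. J j l u v w + J j l v w u + J j l w u v) =
        br (x u) (br (x v) (x w)) q + br (x v) (br (x w) (x u)) q + br (x w) (br (x u) (x v)) q"
      by (simp add: brJ uvw sum.distrib)
    also have "\<dots> = 0"
      using fun_cong[OF Jacobi[OF x[OF uvw(1)] x[OF uvw(2)] x[OF uvw(3)]], of q] by (simp add: fun_ops)
    finally have J0: "(\<Sum>j<m. \<Sum>l<m. J j l u v w + J j l v w u + J j l w u v) = 0" .
    have "(\<Sum>j<m. \<Sum>l<m. S j l u v w - S j l u w v - S j l v u w + S j l v w u + S j l w u v - S j l w v u) =
        - 2 * (\<Sum>j<m. \<Sum>l<m. J j l u v w + J j l v w u + J j l w u v)"
      unfolding S_def J_def by (rule Schouten_Jacobi_identity)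
    then show ?thesis unfolding J0 by simp
  qed
  have "(\<Sum>j<m. \<Sum>l<m.
      contr (E j) (contr (E l) (contr (lie_bracket (A j) (A l)) \<omega>)) + contr (E j) (contr (lie_bracket (A j) (E l)) (contr (A l) \<omega>))
      - contr (E l) (contr (lie_bracket (E j) (A l)) (contr (A j) \<omega>)) - contr (lie_bracket (E j) (E l)) (contr (A l) (contr (A j) \<omega>))) Xs q
    = (\<Sum>j<m. \<Sum>l<m. \<Sum>u<m. \<Sum>v<m. \<Sum>w<m. S j l u v w * W u v w)"
  proof -
    have "(contr (E j) (contr (E l) (contr (lie_bracket (A j) (A l)) \<omega>)) + contr (E j) (contr (lie_bracket (A j) (E l)) (contr (A l) \<omega>))
      - contr (E l) (contr (lie_bracket (E j) (A l)) (contr (A j) \<omega>)) - contr (lie_bracket (E j) (E l)) (contr (A l) (contr (A j) \<omega>))) Xs q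
      = (\<Sum>u<m. \<Sum>v<m. \<Sum>w<m. S j l u v w * W u v w)" if "j < m" "l < m" for j l
    proof -
      note jl = A[OF that(1)] A[OF that(2)] E[OF that(1)] E[OF that(2)]
      show ?thesis
        by (simp add: fun_ops expand3 jl VF_lie_bracket sum.distrib[symmetric] sum_subtractf[symmetric])
          (intro sum.cong refl, simp add: lie_bracket_def fun_ops S_def a_def b_def aa_def ab_def ba_def bb_def algebra_simps)
    qed
    then show ?thesis by (simp add: sum_fun_apply)
  qed
  also have "\<dots> = (\<Sum>u<m. \<Sum>v<m. \<Sum>w<m. (\<Sum>j<m. \<Sum>l<m. S j l u v w) * W u v w)"
  proof -
    have sw: "(\<Sum>j<m. \<Sum>u<m. \<Sum>v<m. \<Sum>w<m. f j u v w) = (\<Sum>u<m. \<Sum>v<m. \<Sum>w<m. \<Sum>j<m. f j u v w)" for f :: "nat \<Rightarrow> nat \<Rightarrow> nat \<Rightarrow> nat \<Rightarrow> real"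
    proof -
      have "(\<Sum>j<m. \<Sum>u<m. \<Sum>v<m. \<Sum>w<m. f j u v w) = (\<Sum>u<m. \<Sum>j<m. \<Sum>v<m. \<Sum>w<m. f j u v w)" by (rule sum.swap)
      also have "\<dots> = (\<Sum>u<m. \<Sum>v<m. \<Sum>j<m. \<Sum>w<m. f j u v w)" by (intro sum.cong refl sum.swap)
      also have "\<dots> = (\<Sum>u<m. \<Sum>v<m. \<Sum>w<m. \<Sum>j<m. f j u v w)" by (intro sum.cong refl sum.swap)
      finally show ?thesis .
    qed
    have "(\<Sum>j<m. \<Sum>l<m. \<Sum>u<m. \<Sum>v<m. \<Sum>w<m. S j l u v w * W u v w) =
        (\<Sum>j<m. \<Sum>u<m. \<Sum>v<m. \<Sum>w<m. \<Sum>l<m. S j l u v w * W u v w)"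
      by (rule sum.cong[OF refl sw])
    also have "\<dots> = (\<Sum>u<m. \<Sum>v<m. \<Sum>w<m. \<Sum>j<m. \<Sum>l<m. S j l u v w * W u v w)" by (rule sw)
    finally show ?thesis by (simp only: sum_distrib_right)
  qed
  also have "\<dots> = 0"
    by (rule sum_antisym_eq_0[OF W]) (use Salt in \<open>simp add: sum.distrib sum_subtractf\<close>)
  finally show ?thesis .
qed

lemma contr_pairs_local: "loc_eq U \<omega> \<eta> \<Longrightarrow> loc_eq U (contr_pairs m A B \<omega>) (contr_pairs m A B \<eta>)"
  by (simp add: loc_eq_def contr_pairs_def sum_fun_apply contr_def)

lemma loc_eq_trans: "loc_eq U \<omega> \<eta> \<Longrightarrow> loc_eq U \<eta> \<zeta> \<Longrightarrow> loc_eq U \<omega> \<zeta>"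
  by (simp add: loc_eq_def)

text \<open>
  The operator is local, and near each point the interior product is the globally defined \<open>contr_pairs\<close> of a frame, for which the result
  is known.
\<close>

lemma Schouten_vanishes:
  assumes w: "\<omega> \<in> forms C k"
  shows "(\<iota> (d (\<iota> \<omega>)) - d (\<iota> (\<iota> \<omega>))) - (\<iota> (\<iota> (d \<omega>)) - \<iota> (d (\<iota> \<omega>))) = 0"
proof (intro ext)
  fix Xs p
  obtain U m x E where F: "frame_on U m x E" and p: "p \<in> U" by (rule frame_exists)
  define K where "K = contr_pairs m (half_sharp m x E) E"
  have U: "open U" and V: "\<And>j. j < m \<Longrightarrow> half_sharp m x E j \<in> VF \<and> E j \<in> VF"
    using F half_sharp_VF[OF F] unfolding frame_on_def by blast+
  have Kf: "\<eta> \<in> forms C r \<Longrightarrow> K \<eta> \<in> forms C (r - 2)" for \<eta> r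
    unfolding K_def using V by (rule contr_pairs_forms)
  have \<iota>K: "\<eta> \<in> forms C r \<Longrightarrow> loc_eq U (\<iota> \<eta>) (K \<eta>)" for \<eta> r
    unfolding K_def by (rule interior_local[OF F])
  have KK: "loc_eq U \<eta> \<zeta> \<Longrightarrow> loc_eq U (K \<eta>) (K \<zeta>)" for \<eta> \<zeta> unfolding K_def by (rule contr_pairs_local)
  have dd: "\<eta> \<in> forms C r \<Longrightarrow> \<zeta> \<in> forms C s \<Longrightarrow> loc_eq U \<eta> \<zeta> \<Longrightarrow> loc_eq U (d \<eta>) (d \<zeta>)" for \<eta> \<zeta> r s
    by (rule d_local[OF U forms_cochains forms_cochains])
  note f = w interior_forms[OF w] Kf[OF w]
  have 1: "loc_eq U (\<iota> (d (\<iota> \<omega>))) (K (d (K \<omega>)))"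
    using loc_eq_trans[OF \<iota>K[OF d_forms[OF f(2)]] KK[OF dd[OF f(2,3) \<iota>K[OF w]]]] .
  have "loc_eq U (\<iota> (\<iota> \<omega>)) (K (K \<omega>))" using loc_eq_trans[OF \<iota>K[OF f(2)] KK[OF \<iota>K[OF w]]] .
  then have 2: "loc_eq U (d (\<iota> (\<iota> \<omega>))) (d (K (K \<omega>)))" by (rule dd[OF interior_forms[OF f(2)] Kf[OF f(3)]])
  have 3: "loc_eq U (\<iota> (\<iota> (d \<omega>))) (K (K (d \<omega>)))"
    using loc_eq_trans[OF \<iota>K[OF interior_forms[OF d_forms[OF w]]] KK[OF \<iota>K[OF d_forms[OF w]]]] .
  have "((K (d (K \<omega>)) - d (K (K \<omega>))) - (K (K (d \<omega>)) - K (d (K \<omega>)))) Xs p = 0"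
    unfolding K_def using contr_pairs_Schouten[OF _ _ w, of m "half_sharp m x E" E] V trivector_vanishes[OF F p w] by presburger
  then show "((\<iota> (d (\<iota> \<omega>)) - d (\<iota> (\<iota> \<omega>))) - (\<iota> (\<iota> (d \<omega>)) - \<iota> (d (\<iota> \<omega>)))) Xs p = 0 Xs p"
    using 1 2 3 p by (simp add: loc_eq_def fun_ops)
qed

lemma koszul_eq: "\<delta> \<omega> = \<iota> (d \<omega>) - d (\<iota> \<omega>)"
  by (simp add: koszul_diff_def)

text \<open>
  With \<open>T\<close> the operator of \<open>Schouten_vanishes\<close>, \<open>d (T \<omega>) + T (d \<omega>)\<close> equals \<open>2 \<delta> (\<delta> \<omega>)\<close>, because \<open>d\<close> squares to zero.
\<close>

lemma koszul_koszul:
  assumes w: "\<omega> \<in> forms C k"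
  shows "\<delta> (\<delta> \<omega>) = 0"
proof -
  let ?T = "\<lambda>\<omega>. (\<iota> (d (\<iota> \<omega>)) - d (\<iota> (\<iota> \<omega>))) - (\<iota> (\<iota> (d \<omega>)) - \<iota> (d (\<iota> \<omega>)))"
  note i = interior_forms and D = d_forms
  note c = forms_cochains
  note iw = i[OF w] and dw = D[OF w]
  have "\<delta> (\<delta> \<omega>) = \<iota> (d (\<iota> (d \<omega>)) - d (d (\<iota> \<omega>))) - d (\<iota> (\<iota> (d \<omega>)) - \<iota> (d (\<iota> \<omega>)))"
    unfolding koszul_eq interior_diff d_diff[OF c[OF i[OF dw]] c[OF D[OF iw]]] ..
  also have "\<dots> = \<iota> (d (\<iota> (d \<omega>))) - d (\<iota> (\<iota> (d \<omega>))) + d (\<iota> (d (\<iota> \<omega>)))"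
    unfolding d_d[OF iw] d_diff[OF c[OF i[OF i[OF dw]]] c[OF i[OF D[OF iw]]]] by (simp del: form_ops)
  finally have e: "\<delta> (\<delta> \<omega>) = \<dots>" .
  have "0 = d (?T \<omega>)" using Schouten_vanishes[OF w] d_0 by (simp del: form_ops)
  also have "\<dots> = (d (\<iota> (d (\<iota> \<omega>))) - d (d (\<iota> (\<iota> \<omega>)))) - (d (\<iota> (\<iota> (d \<omega>))) - d (\<iota> (d (\<iota> \<omega>))))"
    using c[OF i[OF D[OF iw]]] c[OF D[OF i[OF iw]]] c[OF i[OF i[OF dw]]]
    by (simp only: d_diff cochains_diff)
  also have "\<dots> = 2 *\<^sub>R d (\<iota> (d (\<iota> \<omega>))) - d (\<iota> (\<iota> (d \<omega>)))"
    unfolding d_d[OF i[OF iw]] by (simp add: scaleR_2 del: form_ops)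
  finally have 1: "2 *\<^sub>R d (\<iota> (d (\<iota> \<omega>))) = d (\<iota> (\<iota> (d \<omega>)))" by (simp del: form_ops)
  have "2 *\<^sub>R \<iota> (d (\<iota> (d \<omega>))) - d (\<iota> (\<iota> (d \<omega>))) = ?T (d \<omega>)"
    unfolding d_d[OF w] interior_0 by (simp add: scaleR_2 del: form_ops)
  then have 2: "2 *\<^sub>R \<iota> (d (\<iota> (d \<omega>))) = d (\<iota> (\<iota> (d \<omega>)))" 
    unfolding Schouten_vanishes[OF dw] by (simp del: form_ops)
  have "2 *\<^sub>R \<delta> (\<delta> \<omega>) = 0" unfolding e scaleR_add_right scaleR_diff_right 1 2 by (simp add: scaleR_2 del: form_ops)
  then show ?thesis by (metis scaleR_eq_0_iff zero_neq_numeral)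
qed

lemma koszul_forms: "\<omega> \<in> forms C (Suc k) \<Longrightarrow> \<delta> \<omega> \<in> forms C k"
proof (cases k)
  case 0
  assume w: "\<omega> \<in> forms C (Suc k)"
  then have "\<iota> \<omega> = 0" using 0 by (intro interior_low[OF w]) simp
  then show ?thesis using interior_forms[OF d_forms[OF w]] by (simp add: koszul_eq d_0 del: form_ops)
next
  case (Suc r)
  assume w: "\<omega> \<in> forms C (Suc k)"
  show ?thesis using interior_forms[OF d_forms[OF w]] d_forms[OF interior_forms[OF w]] Suc
    by (simp add: koszul_eq forms_diff del: form_ops)
qed

lemma koszul_add: "\<omega> \<in> cochains \<Longrightarrow> \<eta> \<in> cochains \<Longrightarrow> \<iota> \<omega> \<in> cochains \<Longrightarrow> \<iota> \<eta> \<in> cochains \<Longrightarrow> \<delta> (\<omega> + \<eta>) = \<delta> \<omega> + \<delta> \<eta>"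
  by (simp add: koszul_eq d_add interior_add del: form_ops)

lemma koszul_scaleR: "\<omega> \<in> cochains \<Longrightarrow> \<iota> \<omega> \<in> cochains \<Longrightarrow> \<delta> (c *\<^sub>R \<omega>) = c *\<^sub>R \<delta> \<omega>"
  by (simp add: koszul_eq d_scaleR interior_scaleR scaleR_diff_right del: form_ops)

lemma d_fscale_dfun:
  assumes "f \<in> C" "g \<in> C"
  shows "d (fscale f (dfun g)) = wedge1 (dfun f) (dfun g)"
proof
  fix Xs
  have w: "d (fscale f (dfun g)) \<in> forms C 2"
    using d_forms[OF forms_fscale[OF dfun_forms[OF assms(2)] assms(1)]] by (simp add: numeral_2_eq_2 One_nat_def)
  consider "length Xs \<noteq> 2" | X Y where "Xs = [X, Y]" "X \<notin> VF \<or> Y \<notin> VF" | X Y where "Xs = [X, Y]" "X \<in> VF" "Y \<in> VF"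
    by (auto simp: numeral_2_eq_2 length_Suc_conv)
  then show "d (fscale f (dfun g)) Xs = wedge1 (dfun f) (dfun g) Xs"
  proof cases
    case 1 then show ?thesis using forms_out[OF w, of Xs] by (simp add: wedge1_def)
  next
    case 2 then show ?thesis using forms_out[OF w, of Xs] by (auto simp: wedge1_def d_out)
  next
    case 3
    have "lie_bracket X Y \<in> VF" using 3 by (intro VF_lie_bracket)
    moreover have "fscale f (dfun g) [Z] = f * Z g" if "Z \<in> VF" for Z
      using that by (simp add: fscale_def dfun_single)
    ultimately have "d (fscale f (dfun g)) Xs = X (f * Y g) - Y (f * X g) - f * lie_bracket X Y g"
      using 3 by (simp add: ext_deriv_def[of C "fscale f (dfun g)"] omit_def numeral_2_eq_2 One_nat_def lessThan_Suc)
    also have "\<dots> = X f * Y g - Y f * X g"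
      using 3 assms by (simp add: VF_mult VF_in lie_bracket_def algebra_simps)
    finally show ?thesis using 3 by (simp add: wedge1_def dfun_single)
  qed
qed

lemma koszul_fscale_dfun: "f \<in> C \<Longrightarrow> g \<in> C \<Longrightarrow> \<delta> (fscale f (dfun g)) [] = br f g"
  by (simp add: koszul_eq d_Nil d_fscale_dfun poisson_bracket_def)

lemma bracket_anti: "f \<in> C \<Longrightarrow> g \<in> C \<Longrightarrow> br f g = - br g f"
  by (simp only: bracket_eq_pi) (rule pi_anti[OF dfun_forms dfun_forms])

end


section \<open>Lie 2-algebras whose higher brackets factor through a projection\<close>

text \<open>
  The sums over unshuffles are evaluated term by term. The few permutations involved are written as products of transpositions, from which their
  signs can be read off.
\<close>

abbreviation trp :: "nat \<Rightarrow> nat \<Rightarrow> nat \<Rightarrow> nat" where "trp \<equiv> Transposition.transpose"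

lemma permutes_ext:
  assumes "\<sigma> permutes {..<n}" "\<tau> permutes {..<n}" "\<And>i. i < n \<Longrightarrow> \<sigma> i = \<tau> i"
  shows "\<sigma> = \<tau>"
proof
  fix i show "\<sigma> i = \<tau> i"
    using assms(3)[of i] permutes_not_in[OF assms(1), of i] permutes_not_in[OF assms(2), of i] by (cases "i < n") auto
qed

lemma less_3_iff: "i < 3 \<longleftrightarrow> i = 0 \<or> i = 1 \<or> i = (2::nat)" by auto
lemma less_4_iff: "i < 4 \<longleftrightarrow> i = 0 \<or> i = 1 \<or> i = 2 \<or> i = (3::nat)" by auto
lemma less_2_iff: "i < 2 \<longleftrightarrow> i = 0 \<or> i = (1::nat)" by auto

lemmas perm_intros = permutes_compose permutes_swap_id permutes_id permutation_compose permutation_swap_id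

lemma permutes_values:
  assumes "\<sigma> permutes {..<n}"
  shows "i < n \<Longrightarrow> \<sigma> i < n" "i \<noteq> j \<Longrightarrow> \<sigma> i \<noteq> \<sigma> j"
  using permutes_in_image[OF assms, of i] permutes_inj[OF assms] by (auto dest: injD)

lemma permutes_2:
  assumes "\<sigma> permutes {..<2}"
  shows "\<sigma> = id \<or> \<sigma> = trp 0 1"
proof -
  note v = permutes_values[OF assms]
  have "\<sigma> 0 = 0 \<and> \<sigma> 1 = 1 \<or> \<sigma> 0 = 1 \<and> \<sigma> 1 = 0"
    using v(1)[of 0] v(1)[of 1] v(2)[of 0 1] by (auto simp: less_2_iff)
  then show ?thesis
  proof
    assume "\<sigma> 0 = 0 \<and> \<sigma> 1 = 1"
    then have "\<sigma> = id" by (intro permutes_ext[OF assms] perm_intros) (auto simp: less_2_iff)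
    then show ?thesis ..
  next
    assume "\<sigma> 0 = 1 \<and> \<sigma> 1 = 0"
    then have "\<sigma> = trp 0 1" by (intro permutes_ext[OF assms] perm_intros) (auto simp: less_2_iff)
    then show ?thesis ..
  qed
qed

lemma permutes_3:
  assumes "\<sigma> permutes {..<3}"
  shows "\<sigma> \<in> set [id, trp 0 1, trp 1 2, trp 0 2,
    trp 0 1 \<circ> trp 1 2, trp 1 2 \<circ> trp 0 1]"
proof -
  note v = permutes_values[OF assms]
  have eqI: "\<sigma> = \<tau>" if "\<tau> permutes {..<3}" "\<sigma> 0 = \<tau> 0" "\<sigma> 1 = \<tau> 1" "\<sigma> 2 = \<tau> 2" for \<tau>
    using that by (intro permutes_ext[OF assms]) (auto simp: less_3_iff)
  have p: "trp a b permutes {..<3}" if "a < 3" "b < 3" for a b :: nat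
    using that by (intro permutes_swap_id) auto
  have "(\<sigma> 0 = 0 \<and> \<sigma> 1 = 1 \<and> \<sigma> 2 = 2) \<or> (\<sigma> 0 = 1 \<and> \<sigma> 1 = 0 \<and> \<sigma> 2 = 2) \<or> (\<sigma> 0 = 0 \<and> \<sigma> 1 = 2 \<and> \<sigma> 2 = 1) \<or>
      (\<sigma> 0 = 2 \<and> \<sigma> 1 = 1 \<and> \<sigma> 2 = 0) \<or> (\<sigma> 0 = 1 \<and> \<sigma> 1 = 2 \<and> \<sigma> 2 = 0) \<or> (\<sigma> 0 = 2 \<and> \<sigma> 1 = 0 \<and> \<sigma> 2 = 1)"
  proof -
    have "\<sigma> 0 \<noteq> \<sigma> 1" "\<sigma> 0 \<noteq> \<sigma> 2" "\<sigma> 1 \<noteq> \<sigma> 2" by (rule v(2); simp)+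
    moreover have "\<sigma> i = 0 \<or> \<sigma> i = 1 \<or> \<sigma> i = 2" if "i < 3" for i using v(1)[OF that] by (simp add: less_3_iff)
    from this[of 0] this[of 1] this[of 2]
    have "\<sigma> 0 = 0 \<or> \<sigma> 0 = 1 \<or> \<sigma> 0 = 2" "\<sigma> 1 = 0 \<or> \<sigma> 1 = 1 \<or> \<sigma> 1 = 2" "\<sigma> 2 = 0 \<or> \<sigma> 2 = 1 \<or> \<sigma> 2 = 2"
      by simp_all
    ultimately show ?thesis by metis
  qed
  then show ?thesis
  proof (elim disjE)
    assume "\<sigma> 0 = 0 \<and> \<sigma> 1 = 1 \<and> \<sigma> 2 = 2"
    then have "\<sigma> = id" by (intro eqI permutes_id) auto
    then show ?thesis by simp
  next
    assume "\<sigma> 0 = 1 \<and> \<sigma> 1 = 0 \<and> \<sigma> 2 = 2"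
    then have "\<sigma> = trp 0 1" by (intro eqI p) (auto simp: Transposition.transpose_def)
    then show ?thesis by simp
  next
    assume "\<sigma> 0 = 0 \<and> \<sigma> 1 = 2 \<and> \<sigma> 2 = 1"
    then have "\<sigma> = trp 1 2" by (intro eqI p) (auto simp: Transposition.transpose_def)
    then show ?thesis by simp
  next
    assume "\<sigma> 0 = 2 \<and> \<sigma> 1 = 1 \<and> \<sigma> 2 = 0"
    then have "\<sigma> = trp 0 2" by (intro eqI p) (auto simp: Transposition.transpose_def)
    then show ?thesis by simp
  next
    assume "\<sigma> 0 = 1 \<and> \<sigma> 1 = 2 \<and> \<sigma> 2 = 0"
    then have "\<sigma> = trp 0 1 \<circ> trp 1 2" by (intro eqI permutes_compose p) (auto simp: Transposition.transpose_def)
    then show ?thesis by simp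
  next
    assume "\<sigma> 0 = 2 \<and> \<sigma> 1 = 0 \<and> \<sigma> 2 = 1"
    then have "\<sigma> = trp 1 2 \<circ> trp 0 1" by (intro eqI permutes_compose p) (auto simp: Transposition.transpose_def)
    then show ?thesis by simp
  qed
qed

lemma strict_mono_on_pair: "strict_mono_on {..<2} \<sigma> \<longleftrightarrow> \<sigma> 0 < (\<sigma> 1 :: nat)"
  "strict_mono_on {2..<4} \<sigma> \<longleftrightarrow> \<sigma> 2 < (\<sigma> 3 :: nat)"
  "strict_mono_on {2..<3} (\<sigma> :: nat \<Rightarrow> nat)"
proof -
  have "{..<2} = {0, 1::nat}" "{2..<4} = {2, 3::nat}" "{2..<3} = {2::nat}" by auto
  then show "strict_mono_on {..<2} \<sigma> \<longleftrightarrow> \<sigma> 0 < (\<sigma> 1 :: nat)"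
    "strict_mono_on {2..<4} \<sigma> \<longleftrightarrow> \<sigma> 2 < (\<sigma> 3 :: nat)" "strict_mono_on {2..<3} (\<sigma> :: nat \<Rightarrow> nat)"
    by (auto simp: strict_mono_on_def)
qed

lemma unshuffles_all: "unshuffles n 0 = {id}"
proof (intro equalityI subsetI)
  fix \<sigma> assume "\<sigma> \<in> unshuffles n 0"
  then have p: "\<sigma> permutes {..<n}" and m: "strict_mono_on {..<n} \<sigma>" by (auto simp: unshuffles_def)
  have ge: "i < n \<Longrightarrow> i \<le> \<sigma> i" for i
  proof (induction i)
    case (Suc i)
    then have "\<sigma> i < \<sigma> (Suc i)" by (intro strict_mono_onD[OF m]) auto
    then show ?case using Suc by simp
  qed simp
  \<comment> \<open>A permutation with \<open>i \<le> \<sigma> i\<close> for all \<open>i\<close> is the identity, since both sides have the same sum.\<close>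
  have "(\<Sum>i<n. \<sigma> i) = (\<Sum>i<n. i)" using sum.permute[OF p, of "\<lambda>i. i"] by (simp add: o_def)
  then have "(\<Sum>i<n. \<sigma> i - i) = 0"
    using ge by (subst sum_subtractf_nat) auto
  then have "\<forall>i\<in>{..<n}. \<sigma> i \<le> i" by simp
  then have "\<sigma> i = i" if "i < n" for i using ge[OF that] that by (intro antisym) auto
  then have "\<sigma> = id" by (intro permutes_ext[OF p permutes_id]) simp
  then show "\<sigma> \<in> {id}" by simp
qed (auto simp: unshuffles_def permutes_id strict_mono_on_def)

lemma unshuffles_2_1: "unshuffles 2 1 = set [id, trp 1 2, trp 0 1 \<circ> trp 1 2]"
proof (intro equalityI subsetI)
  fix \<sigma> assume "\<sigma> \<in> unshuffles 2 1"
  then have "\<sigma> permutes {..<3}" and "\<sigma> 0 < \<sigma> 1"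
    by (simp_all add: unshuffles_def strict_mono_on_pair)
  with permutes_3[OF this(1)] show "\<sigma> \<in> set [id, trp 1 2, trp 0 1 \<circ> trp 1 2]"
    by (auto simp: Transposition.transpose_def)
next
  have p: "trp a b permutes {..<3}" if "a < 3" "b < 3" for a b :: nat
    using that by (intro permutes_swap_id) auto
  fix \<sigma> :: "nat \<Rightarrow> nat" assume "\<sigma> \<in> set [id, trp 1 2, trp 0 1 \<circ> trp 1 2]"
  then show "\<sigma> \<in> unshuffles 2 1"
    using p by (auto simp: unshuffles_def strict_mono_on_pair permutes_id Transposition.transpose_def intro!: permutes_compose)
qed

text \<open>
  In the order \<open>01|23\<close>, \<open>02|13\<close>, \<open>03|12\<close>, \<open>12|03\<close>, \<open>13|02\<close>, \<open>23|01\<close>, where \<open>02|13\<close> sends \<open>0, 1, 2, 3\<close> to \<open>0, 2, 1, 3\<close>.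
\<close>

definition ush22 :: "(nat \<Rightarrow> nat) list" where
  "ush22 = [id, trp 1 2, trp 2 3 \<circ> trp 1 2, trp 0 1 \<circ> trp 1 2,
    trp 0 1 \<circ> (trp 2 3 \<circ> trp 1 2), trp 0 2 \<circ> trp 1 3]"

lemma unshuffles_2_2: "unshuffles 2 2 = set ush22"
proof (intro equalityI subsetI)
  have p: "trp a b permutes {..<4}" if "a < 4" "b < 4" for a b :: nat
    using that by (intro permutes_swap_id) auto
  {
    fix \<sigma> assume "\<sigma> \<in> unshuffles 2 2"
    then have s: "\<sigma> permutes {..<4}" and lt: "\<sigma> 0 < \<sigma> 1" "\<sigma> 2 < \<sigma> 3"
      by (simp_all add: unshuffles_def strict_mono_on_pair)
    note v = permutes_values[OF s]
    have eqI: "\<sigma> = \<tau>" if "\<tau> permutes {..<4}" "\<sigma> 0 = \<tau> 0" "\<sigma> 1 = \<tau> 1" "\<sigma> 2 = \<tau> 2" "\<sigma> 3 = \<tau> 3" for \<tau>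
      using that by (intro permutes_ext[OF s]) (auto simp: less_4_iff)
    have "(\<sigma> 0 = 0 \<and> \<sigma> 1 = 1 \<and> \<sigma> 2 = 2 \<and> \<sigma> 3 = 3) \<or> (\<sigma> 0 = 0 \<and> \<sigma> 1 = 2 \<and> \<sigma> 2 = 1 \<and> \<sigma> 3 = 3) \<or>
        (\<sigma> 0 = 0 \<and> \<sigma> 1 = 3 \<and> \<sigma> 2 = 1 \<and> \<sigma> 3 = 2) \<or> (\<sigma> 0 = 1 \<and> \<sigma> 1 = 2 \<and> \<sigma> 2 = 0 \<and> \<sigma> 3 = 3) \<or>
        (\<sigma> 0 = 1 \<and> \<sigma> 1 = 3 \<and> \<sigma> 2 = 0 \<and> \<sigma> 3 = 2) \<or> (\<sigma> 0 = 2 \<and> \<sigma> 1 = 3 \<and> \<sigma> 2 = 0 \<and> \<sigma> 3 = 1)"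
    proof -
      have ne: "\<sigma> 0 \<noteq> \<sigma> 2" "\<sigma> 0 \<noteq> \<sigma> 3" "\<sigma> 1 \<noteq> \<sigma> 2" "\<sigma> 1 \<noteq> \<sigma> 3" by (rule v(2); simp)+
      have pair: "\<sigma> i = 0 \<and> \<sigma> j = 1 \<or> \<sigma> i = 0 \<and> \<sigma> j = 2 \<or> \<sigma> i = 0 \<and> \<sigma> j = 3 \<or> \<sigma> i = 1 \<and> \<sigma> j = 2 \<or>
          \<sigma> i = 1 \<and> \<sigma> j = 3 \<or> \<sigma> i = 2 \<and> \<sigma> j = 3" if "\<sigma> i < \<sigma> j" "j < 4" for i j
        using v(1)[OF that(2)] that(1) by linarith
      have "\<sigma> 0 = 0 \<and> \<sigma> 1 = 1 \<or> \<sigma> 0 = 0 \<and> \<sigma> 1 = 2 \<or> \<sigma> 0 = 0 \<and> \<sigma> 1 = 3 \<or> \<sigma> 0 = 1 \<and> \<sigma> 1 = 2 \<or>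
          \<sigma> 0 = 1 \<and> \<sigma> 1 = 3 \<or> \<sigma> 0 = 2 \<and> \<sigma> 1 = 3" by (rule pair[OF lt(1)]) simp
      moreover have "\<sigma> 2 = 0 \<and> \<sigma> 3 = 1 \<or> \<sigma> 2 = 0 \<and> \<sigma> 3 = 2 \<or> \<sigma> 2 = 0 \<and> \<sigma> 3 = 3 \<or> \<sigma> 2 = 1 \<and> \<sigma> 3 = 2 \<or>
          \<sigma> 2 = 1 \<and> \<sigma> 3 = 3 \<or> \<sigma> 2 = 2 \<and> \<sigma> 3 = 3" by (rule pair[OF lt(2)]) simp
      ultimately show ?thesis using ne by (elim disjE conjE) simp_all
    qed
    then show "\<sigma> \<in> set ush22"
    proof (elim disjE)
      assume "\<sigma> 0 = 0 \<and> \<sigma> 1 = 1 \<and> \<sigma> 2 = 2 \<and> \<sigma> 3 = 3"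
      then have "\<sigma> = id" by (intro eqI permutes_id) auto
      then show ?thesis by (simp add: ush22_def)
    next
      assume "\<sigma> 0 = 0 \<and> \<sigma> 1 = 2 \<and> \<sigma> 2 = 1 \<and> \<sigma> 3 = 3"
      then have "\<sigma> = trp 1 2" by (intro eqI p) (auto simp: Transposition.transpose_def)
      then show ?thesis by (simp add: ush22_def)
    next
      assume "\<sigma> 0 = 0 \<and> \<sigma> 1 = 3 \<and> \<sigma> 2 = 1 \<and> \<sigma> 3 = 2"
      then have "\<sigma> = trp 2 3 \<circ> trp 1 2" by (intro eqI permutes_compose p) (auto simp: Transposition.transpose_def)
      then show ?thesis by (simp add: ush22_def)
    next
      assume "\<sigma> 0 = 1 \<and> \<sigma> 1 = 2 \<and> \<sigma> 2 = 0 \<and> \<sigma> 3 = 3"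
      then have "\<sigma> = trp 0 1 \<circ> trp 1 2" by (intro eqI permutes_compose p) (auto simp: Transposition.transpose_def)
      then show ?thesis by (simp add: ush22_def)
    next
      assume "\<sigma> 0 = 1 \<and> \<sigma> 1 = 3 \<and> \<sigma> 2 = 0 \<and> \<sigma> 3 = 2"
      then have "\<sigma> = trp 0 1 \<circ> (trp 2 3 \<circ> trp 1 2)" by (intro eqI permutes_compose p) (auto simp: Transposition.transpose_def)
      then show ?thesis by (simp add: ush22_def)
    next
      assume "\<sigma> 0 = 2 \<and> \<sigma> 1 = 3 \<and> \<sigma> 2 = 0 \<and> \<sigma> 3 = 1"
      then have "\<sigma> = trp 0 2 \<circ> trp 1 3" by (intro eqI permutes_compose p) (auto simp: Transposition.transpose_def)
      then show ?thesis by (simp add: ush22_def)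
    qed
  next
    fix \<sigma> :: "nat \<Rightarrow> nat" assume "\<sigma> \<in> set ush22"
    then show "\<sigma> \<in> unshuffles 2 2"
      using p by (auto simp: ush22_def unshuffles_def strict_mono_on_pair permutes_id Transposition.transpose_def intro!: permutes_compose)
  }
qed

lemma sign_transposes:
  "sign (trp a b) = (if a = b then 1 else - 1)"
  "sign (trp a b \<circ> trp c d) = sign (trp a b) * sign (trp c d)"
  "sign (trp a b \<circ> (trp c d \<circ> trp e f)) = sign (trp a b) * sign (trp c d) * sign (trp e f)"
  by (simp_all add: sign_swap_id sign_compose permutation_swap_id permutation_compose)

lemma sum_set_list: "distinct (map (\<lambda>\<sigma>. (\<sigma> (0::nat), \<sigma> (1::nat))) xs) \<Longrightarrow> sum f (set xs) = (\<Sum>\<sigma>\<leftarrow>xs. f (\<sigma> :: nat \<Rightarrow> nat))"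
  by (simp add: distinct_map sum_list_distinct_conv_sum_set)

lemma sum_unshuffles_2_1:
  "sum f (unshuffles 2 1) = f id + (f (trp 1 2) + f (trp 0 1 \<circ> trp 1 2))"
  unfolding unshuffles_2_1 by (subst sum_set_list) (simp_all add: Transposition.transpose_def)

lemma sum_unshuffles_2_2:
  "sum f (unshuffles 2 2) = f id + (f (trp 1 2) + (f (trp 2 3 \<circ> trp 1 2) + (f (trp 0 1 \<circ> trp 1 2)
    + (f (trp 0 1 \<circ> (trp 2 3 \<circ> trp 1 2)) + f (trp 0 2 \<circ> trp 1 3)))))"
  unfolding unshuffles_2_2 ush22_def by (subst sum_set_list) (simp_all add: Transposition.transpose_def)

lemma koszul_sign_even:
  assumes "\<sigma> permutes {..<length ds}" "\<forall>d\<in>set ds. d = 0"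
  shows "koszul_sign \<sigma> ds = 1"
  unfolding koszul_sign_def
proof (rule prod.neutral, clarify)
  fix r s assume "r < s" "s < length ds"
  then have "ds ! \<sigma> r = 0" using permutes_values(1)[OF assms(1), of r] assms(2) by auto
  then show "(- 1) powi (ds ! \<sigma> r * ds ! \<sigma> s) = (1 :: real)" by simp
qed

lemma set_permute_args:
  assumes "\<sigma> permutes {..<length xs}"
  shows "set (permute_args \<sigma> xs) = set xs"
proof -
  have "set (permute_args \<sigma> xs) = (!) xs ` \<sigma> ` {..<length xs}"
    by (simp add: permute_args_def image_image atLeast0LessThan)
  also have "\<dots> = (!) xs ` {..<length xs}" by (simp only: permutes_image[OF assms])
  also have "\<dots> = set xs" by (auto simp: set_conv_nth)
  finally show ?thesis .
qed

lemma length_permute_args [simp]: "length (permute_args \<sigma> xs) = length xs"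
  by (simp add: permute_args_def)

lemma permute_args_2: "permute_args \<sigma> [x, y] = [[x, y] ! \<sigma> 0, [x, y] ! \<sigma> 1]"
  by (simp add: permute_args_def One_nat_def)

lemma permute_args_3: "permute_args \<sigma> [x, y, z] = [[x, y, z] ! \<sigma> 0, [x, y, z] ! \<sigma> 1, [x, y, z] ! \<sigma> 2]"
  by (simp add: permute_args_def numeral_2_eq_2 One_nat_def)

lemma permute_args_4: "permute_args \<sigma> [x, y, z, w] = [[x, y, z, w] ! \<sigma> 0, [x, y, z, w] ! \<sigma> 1, [x, y, z, w] ! \<sigma> 2, [x, y, z, w] ! \<sigma> 3]"
  by (simp add: permute_args_def numeral_2_eq_2 numeral_3_eq_3 One_nat_def)

lemma length_3_conv: "length xs = 3 \<longleftrightarrow> (\<exists>x y z. xs = [x, y, z])"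
  by (auto simp: numeral_3_eq_3 length_Suc_conv)

lemma length_2_conv: "length xs = 2 \<longleftrightarrow> (\<exists>x y. xs = [x, y])"
  by (auto simp: numeral_2_eq_2 length_Suc_conv)

lemma length_4_conv: "length xs = 4 \<longleftrightarrow> (\<exists>x y z w. xs = [x, y, z, w])"
  by (cases xs) (simp_all add: length_3_conv)

text \<open>
  The data of a Lie 2-algebra in which the binary and ternary bracket depend on their arguments only through a projection \<open>pr\<close> to
  a vector space \<open>W\<close> that vanishes outside degree \<open>0\<close> and on the image of the differential \<open>D\<close>. The space \<open>W\<close> inherits the bracket
  \<open>pr (b f g)\<close>. The last two assumptions are the identities for three and four arguments, read in \<open>W\<close>.
\<close>

locale lie_two_data =
  fixes V :: "int \<Rightarrow> 'v::real_vector set" and D :: "'v \<Rightarrow> 'v" and W :: "'w::real_vector set"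
    and pr :: "'v \<Rightarrow> 'w" and b :: "'w \<Rightarrow> 'w \<Rightarrow> 'v" and s :: "'w \<Rightarrow> 'w \<Rightarrow> 'w \<Rightarrow> 'v"
  assumes graded: "graded_space V"
    and D_lin: "x \<in> total_space V \<Longrightarrow> y \<in> total_space V \<Longrightarrow> D (p *\<^sub>R x + q *\<^sub>R y) = p *\<^sub>R D x + q *\<^sub>R D y"
    and D_deg: "x \<in> V e \<Longrightarrow> D x \<in> V (e + 1)"
    and D_D: "x \<in> V e \<Longrightarrow> D (D x) = 0"
    and pr_in: "x \<in> total_space V \<Longrightarrow> pr x \<in> W"
    and pr_lin: "x \<in> total_space V \<Longrightarrow> y \<in> total_space V \<Longrightarrow> pr (p *\<^sub>R x + q *\<^sub>R y) = p *\<^sub>R pr x + q *\<^sub>R pr y"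
    and pr_deg: "x \<in> V e \<Longrightarrow> e \<noteq> 0 \<Longrightarrow> pr x = 0"
    and pr_D: "x \<in> V e \<Longrightarrow> pr (D x) = 0"
    and W: "subspace W"
    and b_in: "f \<in> W \<Longrightarrow> g \<in> W \<Longrightarrow> b f g \<in> V 0"
    and b_lin: "f \<in> W \<Longrightarrow> g \<in> W \<Longrightarrow> h \<in> W \<Longrightarrow> b (p *\<^sub>R f + q *\<^sub>R g) h = p *\<^sub>R b f h + q *\<^sub>R b g h"
    and b_anti: "f \<in> W \<Longrightarrow> g \<in> W \<Longrightarrow> b g f = - b f g"
    and D_b: "f \<in> W \<Longrightarrow> g \<in> W \<Longrightarrow> D (b f g) = 0"
    and s_in: "f \<in> W \<Longrightarrow> g \<in> W \<Longrightarrow> h \<in> W \<Longrightarrow> s f g h \<in> V (- 1)"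
    and s_lin: "f \<in> W \<Longrightarrow> g \<in> W \<Longrightarrow> h \<in> W \<Longrightarrow> k \<in> W \<Longrightarrow>
      s (p *\<^sub>R f + q *\<^sub>R g) h k = p *\<^sub>R s f h k + q *\<^sub>R s g h k"
    and s_anti: "f \<in> W \<Longrightarrow> g \<in> W \<Longrightarrow> h \<in> W \<Longrightarrow> s g f h = - s f g h"
      "f \<in> W \<Longrightarrow> g \<in> W \<Longrightarrow> h \<in> W \<Longrightarrow> s f h g = - s f g h"
    and Jacobiator: "f \<in> W \<Longrightarrow> g \<in> W \<Longrightarrow> h \<in> W \<Longrightarrow>
      b (pr (b f g)) h - b (pr (b f h)) g + b (pr (b g h)) f + D (s f g h) = 0"
    and cocycle: "f \<in> W \<Longrightarrow> g \<in> W \<Longrightarrow> h \<in> W \<Longrightarrow> k \<in> W \<Longrightarrow>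
      s (pr (b f g)) h k - s (pr (b f h)) g k + s (pr (b f k)) g h
        + s (pr (b g h)) f k - s (pr (b g k)) f h + s (pr (b h k)) f g = 0"
begin

definition l :: "nat \<Rightarrow> 'v list \<Rightarrow> 'v" where
  "l k xs = (if k = 1 then D (xs ! 0) else if k = 2 then b (pr (xs ! 0)) (pr (xs ! 1))
     else if k = 3 then s (pr (xs ! 0)) (pr (xs ! 1)) (pr (xs ! 2)) else 0)"

lemma l_simps:
  "l 1 xs = D (xs ! 0)" "l 2 xs = b (pr (xs ! 0)) (pr (xs ! 1))"
  "l 3 xs = s (pr (xs ! 0)) (pr (xs ! 1)) (pr (xs ! 2))" "k > 3 \<Longrightarrow> l k xs = 0"
  by (auto simp: l_def)

lemma V_total: "x \<in> V e \<Longrightarrow> x \<in> total_space V"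
  unfolding total_space_def by (rule span_base) blast

lemma V_subspace: "subspace (V e)" using graded by (simp add: graded_space_def)

lemma V_0: "0 \<in> V e" using V_subspace subspace_0 by blast

lemma D_0: "D 0 = 0" using D_lin[OF V_total V_total, of 0 0 0 0 0 0] V_0 by simp

lemma pr_0: "pr 0 = 0" using pr_lin[OF V_total V_total, of 0 0 0 0 0 0] V_0 by simp

lemma W_0: "0 \<in> W" using W subspace_0 by blast

lemma b_0: "f \<in> W \<Longrightarrow> b 0 f = 0" "f \<in> W \<Longrightarrow> b f 0 = 0"
  using b_lin[of 0 0 f 0 0] b_anti[of 0 f] W_0 by simp_all

lemma s_0: "f \<in> W \<Longrightarrow> g \<in> W \<Longrightarrow> s 0 f g = 0" "f \<in> W \<Longrightarrow> g \<in> W \<Longrightarrow> s f 0 g = 0" "f \<in> W \<Longrightarrow> g \<in> W \<Longrightarrow> s f g 0 = 0"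
proof -
  assume fg: "f \<in> W" "g \<in> W"
  show "s 0 f g = 0" using s_lin[of 0 0 f g 0 0] W_0 fg by simp
  then show "s f 0 g = 0" using s_anti(1)[of 0 f g] W_0 fg by simp
  then show "s f g 0 = 0" using s_anti(2)[of f 0 g] W_0 fg by simp
qed

lemma b_lin2: "f \<in> W \<Longrightarrow> g \<in> W \<Longrightarrow> h \<in> W \<Longrightarrow> b h (p *\<^sub>R f + q *\<^sub>R g) = p *\<^sub>R b h f + q *\<^sub>R b h g"
  using b_anti[of "p *\<^sub>R f + q *\<^sub>R g" h] b_anti[of f h] b_anti[of g h] b_lin[of f g h p q] W
  by (simp add: subspace_add subspace_scale)

lemma s_lin2: "f \<in> W \<Longrightarrow> g \<in> W \<Longrightarrow> h \<in> W \<Longrightarrow> k \<in> W \<Longrightarrow>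
    s h (p *\<^sub>R f + q *\<^sub>R g) k = p *\<^sub>R s h f k + q *\<^sub>R s h g k"
  using s_anti(1)[of "p *\<^sub>R f + q *\<^sub>R g" h k] s_anti(1)[of f h k] s_anti(1)[of g h k] s_lin[of f g h k p q] W
  by (simp add: subspace_add subspace_scale)

lemma s_lin3: "f \<in> W \<Longrightarrow> g \<in> W \<Longrightarrow> h \<in> W \<Longrightarrow> k \<in> W \<Longrightarrow>
    s h k (p *\<^sub>R f + q *\<^sub>R g) = p *\<^sub>R s h k f + q *\<^sub>R s h k g"
  using s_anti(2)[of h "p *\<^sub>R f + q *\<^sub>R g" k] s_anti(2)[of h f k] s_anti(2)[of h g k] s_lin2[of f g h k p q] W
  by (simp add: subspace_add subspace_scale)

lemma l_multilinear:
  assumes len: "length xs + 1 + length ys = k" and T: "set xs \<union> set ys \<subseteq> total_space V" "x \<in> total_space V" "y \<in> total_space V"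
  shows "l k (xs @ (p *\<^sub>R x + q *\<^sub>R y) # ys) = p *\<^sub>R l k (xs @ x # ys) + q *\<^sub>R l k (xs @ y # ys)"
proof -
  have in_W: "pr z \<in> W" if "z \<in> set xs \<union> set ys" for z using pr_in T that by blast
  note prs = pr_lin[OF T(2,3)] pr_in[OF T(2)] pr_in[OF T(3)]
  consider "k = 1" | "k = 2" | "k = 3" | "k > 3" using len by linarith
  then show ?thesis
  proof cases
    case 1
    then have "xs = []" "ys = []" using len by auto
    then show ?thesis using 1 by (simp add: l_simps[unfolded One_nat_def] One_nat_def D_lin T)
  next
    case 2
    then have "length xs = 0 \<and> length ys = 1 \<or> length xs = 1 \<and> length ys = 0" using len by arith
    then show ?thesis
    proof
      assume "length xs = 0 \<and> length ys = 1"
      then obtain u where "xs = []" "ys = [u]" by (auto simp: One_nat_def length_Suc_conv)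
      then show ?thesis using 2 in_W by (simp add: l_simps prs b_lin)
    next
      assume "length xs = 1 \<and> length ys = 0"
      then obtain u where "xs = [u]" "ys = []" by (auto simp: One_nat_def length_Suc_conv)
      then show ?thesis using 2 in_W by (simp add: l_simps prs b_lin2)
    qed
  next
    case 3
    then have "length xs = 0 \<and> length ys = 2 \<or> length xs = 1 \<and> length ys = 1 \<or> length xs = 2 \<and> length ys = 0" using len by arith
    then show ?thesis
    proof (elim disjE)
      assume "length xs = 0 \<and> length ys = 2"
      then obtain u v where "xs = []" "ys = [u, v]" by (auto simp: length_2_conv)
      then show ?thesis using 3 in_W by (simp add: l_simps prs s_lin)
    next
      assume "length xs = 1 \<and> length ys = 1"
      then obtain u v where "xs = [u]" "ys = [v]" by (auto simp: One_nat_def length_Suc_conv)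
      then show ?thesis using 3 in_W by (simp add: l_simps prs s_lin2)
    next
      assume "length xs = 2 \<and> length ys = 0"
      then obtain u v where "xs = [u, v]" "ys = []" by (auto simp: length_2_conv)
      then show ?thesis using 3 in_W by (simp add: l_simps prs s_lin3)
    qed
  qed (simp add: l_simps)
qed

lemma l_zero:
  assumes "k \<ge> 2" "length xs = k" "set xs \<subseteq> total_space V" "x \<in> set xs" "pr x = 0"
  shows "l k xs = 0"
proof -
  have in_W: "pr z \<in> W" if "z \<in> set xs" for z using pr_in assms(3) that by blast
  consider "k = 2" | "k = 3" | "k > 3" using assms(1) by linarith
  then show ?thesis
  proof cases
    case 1
    then obtain u v where "xs = [u, v]" using assms(2) by (auto simp: length_2_conv)
    then show ?thesis using 1 assms(4,5) in_W by (auto simp: l_simps b_0)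
  next
    case 2
    then obtain u v w where "xs = [u, v, w]" using assms(2) by (auto simp: length_3_conv)
    then show ?thesis using 2 assms(4,5) in_W by (auto simp: l_simps s_0)
  qed (simp add: l_simps)
qed

lemma list_all2_V_total: "list_all2 (\<lambda>x d. x \<in> V d) xs ds \<Longrightarrow> set xs \<subseteq> total_space V"
  unfolding list_all2_conv_all_nth by (metis V_total in_set_conv_nth subsetI)

lemma pr_zero_if_degree:
  assumes "list_all2 (\<lambda>x d. x \<in> V d) xs ds" "\<not> (\<forall>d\<in>set ds. d = 0)"
  obtains x where "x \<in> set xs" "pr x = 0"
proof -
  obtain i where i: "i < length ds" "ds ! i \<noteq> 0" using assms(2) by (auto simp: in_set_conv_nth)
  then have "xs ! i \<in> V (ds ! i)" "i < length xs" using assms(1) by (auto simp: list_all2_conv_all_nth)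
  then show ?thesis using that[of "xs ! i"] pr_deg i(2) by auto
qed

lemma sum_list_0: "\<forall>d\<in>set ds. d = 0 \<Longrightarrow> sum_list ds = (0::int)"
  by (induction ds) auto

lemma l_degree:
  assumes len: "length xs = k" and k: "k \<ge> 1" and xs: "list_all2 (\<lambda>x d. x \<in> V d) xs ds"
  shows "l k xs \<in> V (sum_list ds + 2 - int k)"
proof (cases "k = 1")
  case True
  then obtain x where x: "xs = [x]" using len by (auto simp: One_nat_def length_Suc_conv)
  then obtain e where e: "ds = [e]" "x \<in> V e" using xs by (auto simp: list_all2_Cons1)
  then show ?thesis using D_deg[of x e] x True by (simp add: l_simps add.commute)
next
  case False
  show ?thesis
  proof (cases "\<forall>d\<in>set ds. d = 0")
    case True
    have in_W: "pr z \<in> W" if "z \<in> set xs" for z using pr_in list_all2_V_total[OF xs] that by blast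
    consider "k = 2" | "k = 3" | "k > 3" using k False by linarith
    then show ?thesis
    proof cases
      case 1
      then obtain u v where "xs = [u, v]" using len by (auto simp: length_2_conv)
      then show ?thesis using 1 in_W b_in by (simp add: sum_list_0[OF True] l_simps)
    next
      case 2
      then obtain u v w where "xs = [u, v, w]" using len by (auto simp: length_3_conv)
      then show ?thesis using 2 in_W s_in by (simp add: sum_list_0[OF True] l_simps)
    qed (simp add: l_simps V_0)
  next
    case nz: False
    obtain x where "x \<in> set xs" "pr x = 0" by (rule pr_zero_if_degree[OF xs nz])
    then have "l k xs = 0" using False k len list_all2_V_total[OF xs] by (intro l_zero) auto
    then show ?thesis using V_0 by simp
  qed
qed

lemma l_skew:
  assumes len: "length xs = k" and k: "k \<ge> 1" and xs: "list_all2 (\<lambda>x d. x \<in> V d) xs ds" and p: "\<sigma> permutes {..<k}"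
  shows "l k (permute_args \<sigma> xs) = (of_int (sign \<sigma>) * koszul_sign \<sigma> ds) *\<^sub>R l k xs"
proof (cases "k = 1")
  case True
  then have "\<sigma> = id" using p by (intro permutes_ext[OF p permutes_id]) (use permutes_values(1)[OF p] in auto)
  moreover have "koszul_sign id ds = 1" by (auto simp: koszul_sign_def intro!: prod.neutral)
  moreover have "permute_args id xs = xs" by (simp add: permute_args_def map_nth)
  ultimately show ?thesis by simp
next
  case False
  have T: "set xs \<subseteq> total_space V" by (rule list_all2_V_total[OF xs])
  have lds: "length ds = k" using xs len by (simp add: list_all2_lengthD)
  show ?thesis
  proof (cases "\<forall>d\<in>set ds. d = 0")
    case True
    have in_W: "pr z \<in> W" if "z \<in> set xs" for z using pr_in T that by blast
    have ks: "koszul_sign \<sigma> ds = 1" using p lds True by (intro koszul_sign_even) auto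
    consider "k = 2" | "k = 3" | "k > 3" using k False by linarith
    then show ?thesis
    proof cases
      case 1
      then obtain u v where uv: "xs = [u, v]" using len by (auto simp: length_2_conv)
      have "\<sigma> = id \<or> \<sigma> = trp 0 1" using p 1 permutes_2 by blast
      then show ?thesis unfolding uv permute_args_2 ks 1
        using in_W b_anti[of "pr u" "pr v"] uv by (auto simp: l_simps sign_transposes)
    next
      case 2
      then obtain u v w where uvw: "xs = [u, v, w]" using len by (auto simp: length_3_conv)
      then have w: "pr u \<in> W" "pr v \<in> W" "pr w \<in> W" using in_W by auto
      note a = s_anti(1)[OF w] s_anti(2)[OF w] s_anti(1)[OF w(1,3,2)] s_anti(2)[OF w(2,1,3)] s_anti(1)[OF w(2,3,1)] s_anti(2)[OF w(3,1,2)]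
      have "\<sigma> \<in> set [id, trp 0 1, trp 1 2, trp 0 2,
          trp 0 1 \<circ> trp 1 2, trp 1 2 \<circ> trp 0 1]" using p 2 permutes_3 by blast
      then show ?thesis unfolding uvw permute_args_3 ks 2
        using a by (auto simp: l_simps sign_transposes Transposition.transpose_def)
    qed (simp add: l_simps)
  next
    case nz: False
    obtain x where x: "x \<in> set xs" "pr x = 0" by (rule pr_zero_if_degree[OF xs nz])
    have "l k xs = 0" using False k len T x by (intro l_zero) auto
    moreover have "set (permute_args \<sigma> xs) = set xs" using p len by (intro set_permute_args) auto
    then have "l k (permute_args \<sigma> xs) = 0" using False k len T x by (intro l_zero) auto
    ultimately show ?thesis by simp
  qed
qed

lemma l_in_degree:
  assumes "length ys = k" "k \<ge> 1" "\<And>y. y \<in> set ys \<Longrightarrow> \<exists>e. y \<in> V e"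
  obtains e where "l k ys \<in> V e"
proof -
  have "\<exists>ds. list_all2 (\<lambda>x d. x \<in> V d) ys ds" using assms(3)
  proof (induction ys)
    case (Cons y ys)
    then obtain ds e where "list_all2 (\<lambda>x d. x \<in> V d) ys ds" "y \<in> V e" by (metis list.set_intros)
    then have "list_all2 (\<lambda>x d. x \<in> V d) (y # ys) (e # ds)" by simp
    then show ?case ..
  qed (intro exI[of _ "[]"], simp)
  then show ?thesis using that l_degree[OF assms(1,2)] by blast
qed

text \<open>
  In a nested bracket the inner result is fed into the projection unless the outer bracket is \<open>D\<close>. It is killed there if it comes from \<open>D\<close>, or
  from the ternary bracket by its degree; and \<open>D\<close> kills values of \<open>D\<close> and of the binary bracket. This leaves the three exceptional cases.
\<close>

lemma nested_zero:
  assumes ys: "length ys = n" "\<And>y. y \<in> set ys \<Longrightarrow> \<exists>e. y \<in> V e" and i: "1 \<le> i" "i \<le> n"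
    and ne: "\<not> (n = 3 \<and> i = 2)" "\<not> (n = 3 \<and> i = 3)" "\<not> (n = 4 \<and> i = 2)"
  shows "l (n + 1 - i) (l i (take i ys) # drop i ys) = 0"
proof -
  have T: "set ys \<subseteq> total_space V" using ys(2) V_total by blast
  have tk: "length (take i ys) = i" using ys i by simp
  have tkV: "\<exists>e. y \<in> V e" if "y \<in> set (take i ys)" for y by (rule ys(2)[OF in_set_takeD[OF that]])
  obtain e where e: "l i (take i ys) \<in> V e" by (rule l_in_degree[OF tk i(1) tkV])
  have in_W: "pr z \<in> W" if "z \<in> set ys" for z using pr_in T that by blast
  show ?thesis
  proof (cases "i = n")
    case True
    then have n: "n + 1 - i = 1" by simp
    consider "n = 1" | "n = 2" | "n > 3" using i True ne by linarith
    then show ?thesis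
    proof cases
      case 1
      then obtain y where y: "ys = [y]" using ys(1) by (auto simp: One_nat_def length_Suc_conv)
      then obtain e where "y \<in> V e" using ys(2) by auto
      then show ?thesis unfolding n using D_D 1 True y by (simp add: l_simps)
    next
      case 2
      then obtain u v where "ys = [u, v]" using ys(1) by (auto simp: length_2_conv)
      then show ?thesis unfolding n using D_b 2 True in_W by (simp add: l_simps)
    next
      case 3 then show ?thesis unfolding n using True by (simp add: l_simps D_0)
    qed
  next
    case False
    then have j: "n + 1 - i \<ge> 2" using i by linarith
    consider "pr (l i (take i ys)) = 0" | "n + 1 - i > 3"
    proof -
      consider "i = 1" | "i = 2" | "i = 3" | "i > 3" using i(1) by linarith
      then show ?thesis
      proof cases
        case 1
        then have "length (take i ys) = Suc 0" using tk by (simp only: One_nat_def)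
        then obtain y where y: "take i ys = [y]" unfolding length_Suc_conv length_0_conv by blast
        then obtain e where "y \<in> V e" using tkV by auto
        then have "pr (l i (take i ys)) = 0" using pr_D y 1 by (simp add: l_simps)
        then show ?thesis using that by blast
      next
        case 2
        then have "n + 1 - i > 3" using ne i False by linarith
        then show ?thesis using that by blast
      next
        case 3
        then have "length (take i ys) = 3" using tk by (simp only:)
        then obtain u v w where y: "take i ys = [u, v, w]" unfolding length_3_conv by blast
        then have "{u, v, w} \<subseteq> set ys" using set_take_subset[of i ys] by simp
        then have "l i (take i ys) \<in> V (- 1)" using 3 y s_in in_W by (simp add: l_simps)
        then have "pr (l i (take i ys)) = 0" using pr_deg by simp
        then show ?thesis using that by blast
      next
        case 4 then have "pr (l i (take i ys)) = 0" by (simp add: l_simps pr_0)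
        then show ?thesis using that by blast
      qed
    qed
    then show ?thesis
    proof cases
      case 1
      have "set (drop i ys) \<subseteq> total_space V" using T set_drop_subset[of i ys] by blast
      then show ?thesis using j ys(1) i V_total[OF e] 1
        by (intro l_zero[where x="l i (take i ys)"]) auto
    qed (simp add: l_simps)
  qed
qed

text \<open>
  Only the identities for three and four arguments have nonzero terms. If an argument has degree other than \<open>0\<close>, its projection is zero and so is every
  term; otherwise all Koszul signs are \<open>1\<close>, and the identities are the last two assumptions of the locale.
\<close>

lemma Jacobi_identities:
  assumes n: "n \<ge> 1" and len: "length xs = n" and xs: "list_all2 (\<lambda>x d. x \<in> V d) xs ds"
  shows "(\<Sum>i=1..n. let j = n + 1 - i in
           (- 1) ^ (i * (j + 1)) *\<^sub>R
           (\<Sum>\<sigma>\<in>unshuffles i (n - i). (of_int (sign \<sigma>) * koszul_sign \<sigma> ds) *\<^sub>R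
              (let ys = permute_args \<sigma> xs in l j (l i (take i ys) # drop i ys)))) = 0"
    (is "(\<Sum>i=1..n. ?G i) = 0")
proof -
  have T: "set xs \<subseteq> total_space V" by (rule list_all2_V_total[OF xs])
  have lds: "length ds = n" using xs len by (simp add: list_all2_lengthD)
  have ex: "\<exists>e. x \<in> V e" if "x \<in> set xs" for x
    using that xs by (auto simp: list_all2_conv_all_nth in_set_conv_nth)
  have ush: "\<sigma> permutes {..<n}" if "\<sigma> \<in> unshuffles i (n - i)" "i \<le> n" for \<sigma> i
    using that by (simp add: unshuffles_def)
  have G0: "?G i = 0" if i: "1 \<le> i" "i \<le> n" and ne: "\<not> (n = 3 \<and> i = 2)" "\<not> (n = 3 \<and> i = 3)" "\<not> (n = 4 \<and> i = 2)" for i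
  proof -
    have "l (n + 1 - i) (l i (take i (permute_args \<sigma> xs)) # drop i (permute_args \<sigma> xs)) = 0" if "\<sigma> \<in> unshuffles i (n - i)" for \<sigma>
      using ush[OF that i(2)] len ex set_permute_args[of \<sigma> xs] by (intro nested_zero i ne) auto
    then show ?thesis by (simp add: Let_def)
  qed
  have in_W: "pr z \<in> W" if "z \<in> set xs" for z using pr_in T that by blast
  have b_pr: "pr (b f g) \<in> W" if "f \<in> W" "g \<in> W" for f g using pr_in[OF V_total[OF b_in[OF that]]] .
  consider "n = 3" | "n = 4" | "n \<noteq> 3 \<and> n \<noteq> 4" by blast
  then show ?thesis
  proof cases
    case 3 then show ?thesis by (intro sum.neutral ballI G0) auto
  next
    case 1
    then obtain u v w where uvw: "xs = [u, v, w]" using len by (auto simp: length_3_conv)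
    have W3: "pr u \<in> W" "pr v \<in> W" "pr w \<in> W" using in_W uvw by auto
    have "{1..n} = {1, 2, 3}" using 1 by auto
    then have "(\<Sum>i=1..n. ?G i) = ?G 1 + (?G 2 + ?G 3)" by simp
    also have "?G 1 = 0" using 1 by (intro G0) auto
    also have "?G 2 + ?G 3 = 0"
    proof -
      define c where "c \<sigma> = of_int (sign \<sigma>) * koszul_sign \<sigma> ds" for \<sigma>
      define x where "x = pr u" define y where "y = pr v" define z where "z = pr w"
      have G2: "?G 2 = c id *\<^sub>R b (pr (b x y)) z + c (trp 1 2) *\<^sub>R b (pr (b x z)) y
          + c (trp 0 1 \<circ> trp 1 2) *\<^sub>R b (pr (b y z)) x"
        unfolding 1 c_def[symmetric] x_def y_def z_def
        by (simp add: Let_def sum_unshuffles_2_1 uvw permute_args_3 l_simps Transposition.transpose_def nth_Cons' One_nat_def[symmetric])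
      have G3: "?G 3 = c id *\<^sub>R D (s x y z)"
        unfolding 1 c_def[symmetric] x_def y_def z_def
        by (simp add: Let_def unshuffles_all uvw permute_args_3 l_simps l_simps(1)[unfolded One_nat_def])
      show ?thesis
      proof (cases "\<forall>d\<in>set ds. d = 0")
        case True
        have p: "trp 1 2 permutes {..<3::nat}" "trp 0 1 permutes {..<3::nat}" by (auto intro: permutes_swap_id)
        have "c id = 1" "c (trp 1 2) = - 1" "c (trp 0 1 \<circ> trp 1 2) = 1"
          unfolding c_def using True lds 1 p permutes_compose[OF p]
          by (simp_all add: koszul_sign_even permutes_id sign_transposes)
        then show ?thesis unfolding G2 G3 using Jacobiator[OF W3] by (simp add: x_def y_def z_def)
      next
        case False
        obtain a where "a \<in> set xs" "pr a = 0" by (rule pr_zero_if_degree[OF xs False])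
        then have "x = 0 \<or> y = 0 \<or> z = 0" by (auto simp: uvw x_def y_def z_def)
        then show ?thesis unfolding G2 G3 using W3 b_pr
          by (elim disjE) (simp_all add: x_def[symmetric] y_def[symmetric] z_def[symmetric] b_0 s_0 pr_0 D_0)
      qed
    qed
    finally show ?thesis by simp
  next
    case 2
    then obtain u v w t where uvwt: "xs = [u, v, w, t]" using len by (auto simp: length_4_conv)
    have W4: "pr u \<in> W" "pr v \<in> W" "pr w \<in> W" "pr t \<in> W" using in_W uvwt by auto
    have "{1..n} = {1, 2, 3, 4}" using 2 by auto
    then have "(\<Sum>i=1..n. ?G i) = ?G 1 + (?G 2 + (?G 3 + ?G 4))" by simp
    also have "?G 1 = 0" using 2 by (intro G0) auto
    also have "?G 3 = 0" using 2 by (intro G0) auto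
    also have "?G 4 = 0" using 2 by (intro G0) auto
    also have "?G 2 = 0"
    proof -
      define c where "c \<sigma> = of_int (sign \<sigma>) * koszul_sign \<sigma> ds" for \<sigma>
      define x where "x = pr u" define y where "y = pr v" define z where "z = pr w" define r where "r = pr t"
      have G2: "?G 2 = c id *\<^sub>R s (pr (b x y)) z r + (c (trp 1 2) *\<^sub>R s (pr (b x z)) y r
          + (c (trp 2 3 \<circ> trp 1 2) *\<^sub>R s (pr (b x r)) y z
          + (c (trp 0 1 \<circ> trp 1 2) *\<^sub>R s (pr (b y z)) x r
          + (c (trp 0 1 \<circ> (trp 2 3 \<circ> trp 1 2)) *\<^sub>R s (pr (b y r)) x z
          + c (trp 0 2 \<circ> trp 1 3) *\<^sub>R s (pr (b z r)) x y))))"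
        unfolding 2 c_def[symmetric] x_def y_def z_def r_def
        by (simp add: Let_def sum_unshuffles_2_2 uvwt permute_args_4 l_simps Transposition.transpose_def nth_Cons')
      show ?thesis
      proof (cases "\<forall>d\<in>set ds. d = 0")
        case True
        have p: "trp i j permutes {..<4::nat}" if "i < 4" "j < 4" for i j using that by (auto intro: permutes_swap_id)
        have "c id = 1" "c (trp 1 2) = - 1" "c (trp 2 3 \<circ> trp 1 2) = 1" "c (trp 0 1 \<circ> trp 1 2) = 1"
          "c (trp 0 1 \<circ> (trp 2 3 \<circ> trp 1 2)) = - 1" "c (trp 0 2 \<circ> trp 1 3) = 1"
          unfolding c_def using True lds 2
          by (simp_all add: koszul_sign_even permutes_id sign_transposes p permutes_compose)
        then show ?thesis unfolding G2 using cocycle[OF W4] by (simp add: x_def y_def z_def r_def algebra_simps)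
      next
        case False
        obtain a where "a \<in> set xs" "pr a = 0" by (rule pr_zero_if_degree[OF xs False])
        then have "x = 0 \<or> y = 0 \<or> z = 0 \<or> r = 0" by (auto simp: uvwt x_def y_def z_def r_def)
        then show ?thesis unfolding G2 using W4 b_pr
          by (elim disjE) (simp_all add: x_def[symmetric] y_def[symmetric] z_def[symmetric] r_def[symmetric] b_0 s_0 pr_0)
      qed
    qed
    finally show ?thesis by simp
  qed
qed

lemma L_infinity: "L_infinity_algebra V l"
  unfolding L_infinity_algebra_def
  by (intro conjI allI impI ballI) (rule graded l_multilinear l_degree l_skew Jacobi_identities; assumption)+

end


section \<open>The Lie 2-algebra of a Poisson manifold\<close>

text \<open>
  A right inverse is prescribed on a basis of the image. Linearity of \<open>h\<close> is required on \<open>S\<close> only, since the Koszul differential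
  is linear on forms but not on arbitrary functions.
\<close>

lemma linear_section_exists:
  fixes h :: "'v::real_vector \<Rightarrow> 'w::real_vector"
  assumes S: "subspace S" and add: "\<And>x y. x \<in> S \<Longrightarrow> y \<in> S \<Longrightarrow> h (x + y) = h x + h y"
    and scale: "\<And>c x. x \<in> S \<Longrightarrow> h (c *\<^sub>R x) = c *\<^sub>R h x"
  obtains g where "linear g" "\<And>w. w \<in> h ` S \<Longrightarrow> g w \<in> S \<and> h (g w) = w"
proof -
  obtain B where B: "B \<subseteq> h ` S" "independent B" "h ` S \<subseteq> span B" by (rule basis_exists)
  have "\<forall>w\<in>B. \<exists>x. x \<in> S \<and> h x = w" using B(1) by blast
  then obtain r where r: "\<And>w. w \<in> B \<Longrightarrow> r w \<in> S \<and> h (r w) = w" by metis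
  obtain g where g: "linear g" "\<forall>w\<in>B. g w = r w" using linear_independent_extend[OF B(2), of r] by blast
  have h0: "h 0 = 0" using scale[of 0 0] subspace_0[OF S] by simp
  have "subspace {w. g w \<in> S \<and> h (g w) = w}"
    unfolding subspace_def using S h0 add scale linear_0[OF g(1)] linear_add[OF g(1)] linear_scale[OF g(1)]
    by (auto simp: subspace_0 subspace_add subspace_scale)
  moreover have "B \<subseteq> {w. g w \<in> S \<and> h (g w) = w}" using g(2) r by auto
  ultimately have "span B \<subseteq> {w. g w \<in> S \<and> h (g w) = w}" by (rule span_minimal[rotated])
  then show ?thesis using that[OF g(1)] B(3) by blast
qed

context function_algebra
begin

lemma form_grading_subspace: "subspace (form_grading C e)"
  by (simp add: form_grading_def subspace_forms)

lemma graded_space_forms: "graded_space (form_grading C)"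
  unfolding graded_space_def
proof (intro conjI allI)
  fix e
  show "subspace (form_grading C e)" by (rule form_grading_subspace)
  show "form_grading C e \<inter> span (\<Union>e'\<in>- {e}. form_grading C e') = {0}"
  proof (cases "e \<le> 0")
    case True
    define N where "N = {\<omega> :: 'a form. \<forall>Xs. length Xs = nat (1 - e) \<longrightarrow> \<omega> Xs = 0}"
    have "subspace N" by (auto simp: subspace_def N_def)
    moreover have "(\<Union>e'\<in>- {e}. form_grading C e') \<subseteq> N"
    proof
      fix \<omega> assume "\<omega> \<in> (\<Union>e'\<in>- {e}. form_grading C e')"
      then obtain e' where "e' \<noteq> e" "\<omega> \<in> form_grading C e'" by blast
      show "\<omega> \<in> N"
      proof (cases "e' \<le> 0")
        case le: True
        then have "\<omega> \<in> forms C (nat (1 - e'))" "nat (1 - e) \<noteq> nat (1 - e')"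
          using \<open>\<omega> \<in> form_grading C e'\<close> \<open>e' \<noteq> e\<close> True by (auto simp: form_grading_def)
        then show ?thesis using forms_out unfolding N_def by auto
      next
        case False then show ?thesis using \<open>\<omega> \<in> form_grading C e'\<close> by (simp add: form_grading_def N_def)
      qed
    qed
    ultimately have sub: "span (\<Union>e'\<in>- {e}. form_grading C e') \<subseteq> N" by (rule span_minimal[rotated])
    have "\<omega> = 0" if "\<omega> \<in> form_grading C e" "\<omega> \<in> N" for \<omega>
    proof
      fix Xs show "\<omega> Xs = 0 Xs"
        using that True forms_out[of \<omega> "nat (1 - e)" Xs] by (cases "length Xs = nat (1 - e)") (auto simp: form_grading_def N_def)
    qed
    then show ?thesis using sub subspace_0[OF form_grading_subspace] span_zero by blast
  next
    case False
    then show ?thesis using span_zero by (auto simp: form_grading_def)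
  qed
qed

end

context poisson_algebra
begin

text \<open>
  A linear space that contains all forms and on which the Koszul differential is linear. Brackets have to be multilinear on sums of forms
  of different degrees, so linearity in each single degree is not enough.
\<close>

definition koszul_domain :: "'a form set" where "koszul_domain = {\<omega>. \<omega> \<in> cochains \<and> \<iota> \<omega> \<in> cochains}"

lemma forms_koszul_domain: "\<omega> \<in> forms C k \<Longrightarrow> \<omega> \<in> koszul_domain"
  by (auto simp: koszul_domain_def intro: forms_cochains interior_forms)

lemma subspace_koszul_domain: "subspace koszul_domain"
  by (auto simp: subspace_def koszul_domain_def cochains_add cochains_scaleR interior_add interior_scaleR interior_0 simp del: form_ops)

lemma koszul_lin: "\<omega> \<in> koszul_domain \<Longrightarrow> \<eta> \<in> koszul_domain \<Longrightarrow> \<delta> (p *\<^sub>R \<omega> + q *\<^sub>R \<eta>) = p *\<^sub>R \<delta> \<omega> + q *\<^sub>R \<delta> \<eta>"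
  by (simp add: koszul_domain_def koszul_add koszul_scaleR cochains_scaleR interior_scaleR del: form_ops)

lemma total_koszul_domain: "total_space (form_grading C) \<subseteq> koszul_domain"
  unfolding total_space_def
  by (rule span_minimal[OF _ subspace_koszul_domain])
    (auto simp: form_grading_def forms_koszul_domain subspace_0[OF subspace_koszul_domain] split: if_splits)

text \<open>
  On forms of mixed degree, \<open>koszul_fun\<close> is the function part of the Koszul differential, which comes from the \<open>1\<close>-form part of the argument,
  and \<open>koszul_pos\<close> is the rest of it. The latter is the differential of the \<open>L\<^sub>\<infinity>\<close>-algebra, which has to vanish on \<open>1\<close>-forms.
\<close>

definition koszul_fun :: "'a form \<Rightarrow> 'a \<Rightarrow> real" where "koszul_fun \<omega> = \<delta> \<omega> []"

definition koszul_pos :: "'a form \<Rightarrow> 'a form" where "koszul_pos \<omega> = (\<lambda>Xs. if Xs = [] then 0 else \<delta> \<omega> Xs)"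

definition \<beta> :: "('a \<Rightarrow> real) \<Rightarrow> ('a \<Rightarrow> real) \<Rightarrow> 'a form" where
  "\<beta> f g = fscale f (dfun g) - fscale g (dfun f)"

definition J :: "('a \<Rightarrow> real) \<Rightarrow> ('a \<Rightarrow> real) \<Rightarrow> ('a \<Rightarrow> real) \<Rightarrow> 'a form" where
  "J f g h = \<beta> f (br g h) + \<beta> g (br h f) + \<beta> h (br f g)"

lemma koszul_pos_lin: "\<omega> \<in> koszul_domain \<Longrightarrow> \<eta> \<in> koszul_domain \<Longrightarrow> koszul_pos (p *\<^sub>R \<omega> + q *\<^sub>R \<eta>) = p *\<^sub>R koszul_pos \<omega> + q *\<^sub>R koszul_pos \<eta>"
  by (rule ext) (simp add: koszul_pos_def koszul_lin)

lemma koszul_fun_lin: "\<omega> \<in> koszul_domain \<Longrightarrow> \<eta> \<in> koszul_domain \<Longrightarrow> koszul_fun (p *\<^sub>R \<omega> + q *\<^sub>R \<eta>) = p *\<^sub>R koszul_fun \<omega> + q *\<^sub>R koszul_fun \<eta>"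
  by (simp only: koszul_fun_def koszul_lin form_ops)

lemma koszul_pos_Suc: "\<omega> \<in> forms C (Suc (Suc k)) \<Longrightarrow> koszul_pos \<omega> = \<delta> \<omega>"
  using forms_out[OF koszul_forms] by (auto simp: koszul_pos_def fun_eq_iff[where 'b="'a \<Rightarrow> real"])

lemma koszul_pos_1: "\<omega> \<in> forms C 1 \<Longrightarrow> koszul_pos \<omega> = 0"
  using forms_out[OF koszul_forms[of \<omega> 0]] by (auto simp: koszul_pos_def One_nat_def fun_eq_iff[where 'b="'a \<Rightarrow> real"])

lemma koszul_fun_1: "\<omega> \<in> forms C 1 \<Longrightarrow> koszul_fun \<omega> \<in> C"
  using forms_in[OF koszul_forms[of \<omega> 0]] by (simp add: koszul_fun_def One_nat_def)

lemma koszul_fun_Suc: "\<omega> \<in> forms C (Suc (Suc k)) \<Longrightarrow> koszul_fun \<omega> = 0"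
  using forms_out[OF koszul_forms[of \<omega> "Suc k"]] by (simp add: koszul_fun_def)

lemma koszul_0: "\<delta> 0 = 0"
  by (simp add: koszul_eq d_0 interior_0 del: form_ops)

lemma koszul_pos_0: "koszul_pos 0 = 0"
  by (rule ext) (simp add: koszul_pos_def koszul_0 del: form_ops, simp)

lemma koszul_fun_0: "koszul_fun 0 = 0"
  unfolding koszul_fun_def koszul_0 by simp

lemma grading_cases:
  assumes "\<omega> \<in> form_grading C e"
  obtains "\<omega> = 0" "e > 0" | "e = 0" "\<omega> \<in> forms C 1"
    | k where "e = - int (Suc k)" "\<omega> \<in> forms C (Suc (Suc k))"
proof -
  consider "e > 0" | "e = 0" | "e < 0" by linarith
  then show ?thesis
  proof cases
    case 1 then show ?thesis using assms that(1) by (simp add: form_grading_def)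
  next
    case 2 then show ?thesis using assms that(2) by (simp add: form_grading_def One_nat_def)
  next
    case 3
    define k where "k = nat (- e - 1)"
    have "e = - int (Suc k)" "nat (1 - e) = Suc (Suc k)" using 3 by (auto simp: k_def)
    then show ?thesis using assms that(3)[of k] 3 by (simp add: form_grading_def)
  qed
qed

lemma grading_neg: "form_grading C (- int k) = forms C (Suc k)"
  by (simp add: form_grading_def nat_add_distrib[of 1 "int k", simplified])

lemma koszul_fun_in:
  assumes "\<omega> \<in> total_space (form_grading C)"
  shows "koszul_fun \<omega> \<in> C"
proof -
  have "subspace {\<omega> \<in> koszul_domain. koszul_fun \<omega> \<in> C}"
    unfolding subspace_def
  proof (intro conjI ballI allI)
    show "0 \<in> {\<omega> \<in> koszul_domain. koszul_fun \<omega> \<in> C}" using subspace_0[OF subspace_koszul_domain] koszul_fun_0 by simp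
    show "\<omega> + \<eta> \<in> {\<omega> \<in> koszul_domain. koszul_fun \<omega> \<in> C}" if "\<omega> \<in> {\<omega> \<in> koszul_domain. koszul_fun \<omega> \<in> C}" "\<eta> \<in> {\<omega> \<in> koszul_domain. koszul_fun \<omega> \<in> C}" for \<omega> \<eta>
      using that koszul_fun_lin[of \<omega> \<eta> 1 1] subspace_add[OF subspace_koszul_domain] add_in by (simp del: form_ops)
    show "c *\<^sub>R \<omega> \<in> {\<omega> \<in> koszul_domain. koszul_fun \<omega> \<in> C}" if "\<omega> \<in> {\<omega> \<in> koszul_domain. koszul_fun \<omega> \<in> C}" for c \<omega>
      using that koszul_fun_lin[of \<omega> \<omega> c 0] subspace_scale[OF subspace_koszul_domain] scaleR_in by (simp del: form_ops)
  qed
  moreover have "(\<Union>e. form_grading C e) \<subseteq> {\<omega> \<in> koszul_domain. koszul_fun \<omega> \<in> C}"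
  proof safe
    fix \<omega> e assume "\<omega> \<in> form_grading C e"
    then show "\<omega> \<in> koszul_domain" "koszul_fun \<omega> \<in> C"
      by (cases rule: grading_cases, auto simp: subspace_0[OF subspace_koszul_domain] koszul_fun_0 koszul_fun_1 koszul_fun_Suc intro: forms_koszul_domain)+
  qed
  ultimately have "span (\<Union>e. form_grading C e) \<subseteq> {\<omega> \<in> koszul_domain. koszul_fun \<omega> \<in> C}" by (rule span_minimal[rotated])
  then show ?thesis using assms by (auto simp: total_space_def)
qed

lemma dfun_lin: "f \<in> C \<Longrightarrow> g \<in> C \<Longrightarrow> dfun (p *\<^sub>R f + q *\<^sub>R g) = p *\<^sub>R dfun f + q *\<^sub>R dfun g"
proof -
  assume fg: "f \<in> C" "g \<in> C"
  have "of_fun (p *\<^sub>R f + q *\<^sub>R g) = p *\<^sub>R of_fun f + q *\<^sub>R of_fun g"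
    by (rule ext) (simp add: of_fun_def)
  then show ?thesis
    using forms_cochains[OF of_fun_forms[OF fg(1)]] forms_cochains[OF of_fun_forms[OF fg(2)]]
    by (simp add: d_add d_scaleR cochains_scaleR del: form_ops)
qed

lemma fscale_fun_lin: "fscale (p *\<^sub>R f + q *\<^sub>R g) \<omega> = p *\<^sub>R fscale f \<omega> + q *\<^sub>R fscale g \<omega>"
  by (rule ext) (simp add: fscale_def distrib_right)

lemma fscale_scaleR: "fscale f (p *\<^sub>R \<omega>) = p *\<^sub>R fscale f \<omega>"
  by (rule ext) (simp add: fscale_def)

lemma \<beta>_forms: "f \<in> C \<Longrightarrow> g \<in> C \<Longrightarrow> \<beta> f g \<in> forms C 1"
  unfolding \<beta>_def by (intro forms_diff forms_fscale dfun_forms)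

lemma \<beta>_anti: "\<beta> g f = - \<beta> f g"
  by (simp add: \<beta>_def del: form_ops)

lemma \<beta>_lin: "f \<in> C \<Longrightarrow> g \<in> C \<Longrightarrow> h \<in> C \<Longrightarrow> \<beta> (p *\<^sub>R f + q *\<^sub>R g) h = p *\<^sub>R \<beta> f h + q *\<^sub>R \<beta> g h"
  by (simp add: \<beta>_def dfun_lin fscale_fun_lin fscale_lin fscale_scaleR algebra_simps scaleR_diff_right del: form_ops)

lemma \<beta>_lin2: "f \<in> C \<Longrightarrow> g \<in> C \<Longrightarrow> h \<in> C \<Longrightarrow> \<beta> h (p *\<^sub>R f + q *\<^sub>R g) = p *\<^sub>R \<beta> h f + q *\<^sub>R \<beta> h g"
  unfolding \<beta>_anti[of h "p *\<^sub>R f + q *\<^sub>R g"] \<beta>_anti[of h f] \<beta>_anti[of h g]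
  by (simp add: \<beta>_lin del: form_ops)

lemma bracket_lin: "f \<in> C \<Longrightarrow> g \<in> C \<Longrightarrow> h \<in> C \<Longrightarrow> br (p *\<^sub>R f + q *\<^sub>R g) h = p *\<^sub>R br f h + q *\<^sub>R br g h"
proof -
  assume fgh: "f \<in> C" "g \<in> C" "h \<in> C"
  then have "br (p *\<^sub>R f + q *\<^sub>R g) h = \<pi> (dfun (p *\<^sub>R f + q *\<^sub>R g)) (dfun h)"
    by (intro bracket_eq_pi add_in scaleR_in)
  also have "\<dots> = \<pi> (p *\<^sub>R dfun f) (dfun h) + \<pi> (q *\<^sub>R dfun g) (dfun h)"
    unfolding dfun_lin[OF fgh(1,2)] by (intro pi_add forms_scaleR dfun_forms fgh)
  finally have e: "br (p *\<^sub>R f + q *\<^sub>R g) h = \<pi> (p *\<^sub>R dfun f) (dfun h) + \<pi> (q *\<^sub>R dfun g) (dfun h)" .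
  have "\<pi> (c *\<^sub>R dfun k) (dfun h) = c *\<^sub>R br k h" if "k \<in> C" for c k
  proof -
    have "c *\<^sub>R dfun k = fscale (\<lambda>_. c) (dfun k)"
      by (rule ext) (simp add: fscale_def fun_eq_iff scaleR_fun_def fun_ops)
    then have "\<pi> (c *\<^sub>R dfun k) (dfun h) = (\<lambda>_. c) * \<pi> (dfun k) (dfun h)"
      using pi_fscale(1)[OF const_in dfun_forms dfun_forms, of k h c] that fgh by simp
    then show ?thesis using bracket_eq_pi[OF that fgh(3)] by (simp add: fun_eq_iff scaleR_fun_def fun_ops)
  qed
  then show ?thesis unfolding e using fgh by (simp only:)
qed

lemma bracket_lin2: "f \<in> C \<Longrightarrow> g \<in> C \<Longrightarrow> h \<in> C \<Longrightarrow> br h (p *\<^sub>R f + q *\<^sub>R g) = p *\<^sub>R br h f + q *\<^sub>R br h g"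
proof -
  assume fgh: "f \<in> C" "g \<in> C" "h \<in> C"
  have "br h (p *\<^sub>R f + q *\<^sub>R g) = - br (p *\<^sub>R f + q *\<^sub>R g) h"
    using fgh by (intro bracket_anti add_in scaleR_in)
  also have "\<dots> = p *\<^sub>R (- br f h) + q *\<^sub>R (- br g h)" using bracket_lin[OF fgh, of p q] by simp
  finally show ?thesis using bracket_anti[OF fgh(3,1)] bracket_anti[OF fgh(3,2)] by simp
qed

lemma koszul_fun_\<beta>: "f \<in> C \<Longrightarrow> g \<in> C \<Longrightarrow> koszul_fun (\<beta> f g) = 2 *\<^sub>R br f g"
proof -
  assume fg: "f \<in> C" "g \<in> C"
  have "koszul_fun (\<beta> f g) = 1 *\<^sub>R koszul_fun (fscale f (dfun g)) + (- 1) *\<^sub>R koszul_fun (fscale g (dfun f))"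
    using koszul_fun_lin[of "fscale f (dfun g)" "fscale g (dfun f)" 1 "- 1"] fg forms_koszul_domain[OF forms_fscale[OF dfun_forms]]
    by (simp add: \<beta>_def del: form_ops)
  also have "\<dots> = br f g - br g f" by (simp add: koszul_fun_def koszul_fscale_dfun fg)
  also have "br g f = - br f g" by (rule bracket_anti[OF fg(2,1)])
  finally show ?thesis by (simp add: scaleR_2)
qed

lemma J_lin:
  assumes "f \<in> C" "g \<in> C" "h \<in> C" "k \<in> C"
  shows "J (p *\<^sub>R f + q *\<^sub>R g) h k = p *\<^sub>R J f h k + q *\<^sub>R J g h k"
  using assms by (simp add: J_def \<beta>_lin \<beta>_lin2 bracket_lin bracket_lin2 bracket_in scaleR_add_right del: form_ops)

lemma \<beta>_neg2: "f \<in> C \<Longrightarrow> g \<in> C \<Longrightarrow> \<beta> f (- g) = - \<beta> f g"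
  using \<beta>_lin2[of g g f "- 1" 0] by (simp del: form_ops)

lemma J_anti:
  assumes "f \<in> C" "g \<in> C" "h \<in> C"
  shows "J g f h = - J f g h" "J f h g = - J f g h"
proof -
  note b = bracket_anti[OF assms(1,2)] bracket_anti[OF assms(1,3)] bracket_anti[OF assms(2,3)]
  have "\<beta> g (br f h) = - \<beta> g (br h f)" "\<beta> f (br h g) = - \<beta> f (br g h)" "\<beta> h (br g f) = - \<beta> h (br f g)"
    using assms by (subst bracket_anti, simp, simp, simp add: \<beta>_neg2 bracket_in del: form_ops)+
  then show "J g f h = - J f g h" "J f h g = - J f g h" by (simp_all add: J_def del: form_ops)
qed

lemma \<beta>_Jacobi:
  assumes "u \<in> C" "x \<in> C" "y \<in> C" "z \<in> C"
  shows "\<beta> u (br z (br x y)) = \<beta> u (br y (br x z)) - \<beta> u (br x (br y z))"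
proof -
  note x = bracket_in[OF assms(4) bracket_in[OF assms(2,3)]] bracket_in[OF assms(2) bracket_in[OF assms(3,4)]]
    and y = bracket_in[OF assms(3) bracket_in[OF assms(2,4)]]
  have "br y (br z x) = - br y (br x z)"
    unfolding bracket_anti[OF assms(4,2)]
    using bracket_lin2[OF bracket_in[OF assms(2,4)] bracket_in[OF assms(2,4)] assms(3), of "- 1" 0] by simp
  then have "br x (br y z) + br z (br x y) = br y (br x z)"
    using Jacobi[OF assms(2,3,4)] by (simp add: algebra_simps)
  moreover have "\<beta> u (br x (br y z) + br z (br x y)) = \<beta> u (br x (br y z)) + \<beta> u (br z (br x y))"
    using \<beta>_lin2[OF x(2,1) assms(1), of 1 1] by (simp del: form_ops)
  ultimately show ?thesis by (simp del: form_ops)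
qed

text \<open>
  The terms \<open>\<beta> {f, g} {h, k}\<close> occur in pairs that cancel because \<open>\<beta>\<close> is skew. The terms \<open>\<beta> k {\<cdot>, {\<cdot>, \<cdot>}}\<close> with a fixed first argument add up
  to zero by the Jacobi identity.
\<close>

lemma J_cocycle:
  assumes C: "f \<in> C" "g \<in> C" "h \<in> C" "k \<in> C"
  shows "J (br f g) h k - J (br f h) g k + J (br f k) g h + J (br g h) f k - J (br g k) f h + J (br h k) f g = 0"
proof -
  have e: "J (br x y) z w = \<beta> (br x y) (br z w) + \<beta> z (br w (br x y)) - \<beta> w (br z (br x y))"
    if "x \<in> C" "y \<in> C" "z \<in> C" "w \<in> C" for x y z w
    unfolding J_def bracket_anti[OF bracket_in[OF that(1,2)] that(3)]
      \<beta>_neg2[OF that(4) bracket_in[OF that(3) bracket_in[OF that(1,2)]]] by (simp del: form_ops)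
  have jac: "\<beta> k (br h (br f g)) = \<beta> k (br g (br f h)) - \<beta> k (br f (br g h))"
    "\<beta> h (br k (br f g)) = \<beta> h (br g (br f k)) - \<beta> h (br f (br g k))"
    "\<beta> g (br k (br f h)) = \<beta> g (br h (br f k)) - \<beta> g (br f (br h k))"
    "\<beta> f (br k (br g h)) = \<beta> f (br h (br g k)) - \<beta> f (br g (br h k))"
    by (rule \<beta>_Jacobi; rule C)+
  have swap: "\<beta> (br h k) (br f g) = - \<beta> (br f g) (br h k)" "\<beta> (br g k) (br f h) = - \<beta> (br f h) (br g k)"
    "\<beta> (br g h) (br f k) = - \<beta> (br f k) (br g h)" by (rule \<beta>_anti)+
  show ?thesis
    unfolding e[OF C(1,2,3,4)] e[OF C(1,3,2,4)] e[OF C(1,4,2,3)] e[OF C(2,3,1,4)] e[OF C(2,4,1,3)] e[OF C(3,4,1,2)] jac swap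
    by (simp add: algebra_simps del: form_ops)
qed

text \<open>
  The ternary bracket is half the chosen primitive of \<open>J\<close>. It is skew and satisfies the four-argument identity because \<open>J\<close> does and the choice
  of primitives is linear.
\<close>

lemma lie_two_algebra:
  assumes ex: "\<And>f g h. f \<in> C \<Longrightarrow> g \<in> C \<Longrightarrow> h \<in> C \<Longrightarrow> J f g h \<in> \<delta> ` forms C 2"
  obtains s where "lie_two_data (form_grading C) koszul_pos C koszul_fun (\<lambda>f g. (1 / 2) *\<^sub>R \<beta> f g) s"
proof -
  have kz: "\<delta> (p *\<^sub>R \<omega> + q *\<^sub>R \<eta>) = p *\<^sub>R \<delta> \<omega> + q *\<^sub>R \<delta> \<eta>" if "\<omega> \<in> forms C k" "\<eta> \<in> forms C k" for \<omega> \<eta> p q k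
    using koszul_lin forms_koszul_domain that by blast
  obtain S where S: "linear S" "\<And>w. w \<in> \<delta> ` forms C 2 \<Longrightarrow> S w \<in> forms C 2 \<and> \<delta> (S w) = w"
  proof (rule linear_section_exists[OF subspace_forms])
    show "\<delta> (\<omega> + \<eta>) = \<delta> \<omega> + \<delta> \<eta>" if "\<omega> \<in> forms C 2" "\<eta> \<in> forms C 2" for \<omega> \<eta>
      using kz[OF that, of 1 1] by (simp del: form_ops)
    show "\<delta> (c *\<^sub>R \<omega>) = c *\<^sub>R \<delta> \<omega>" if "\<omega> \<in> forms C 2" for c \<omega>
      using kz[OF that that, of c 0] by (simp del: form_ops)
  qed blast
  define s where "s f g h = S ((1 / 2) *\<^sub>R J f g h)" for f g h
  have s_eq: "s f g h = (1 / 2) *\<^sub>R S (J f g h)" for f g h unfolding s_def by (rule linear_scale[OF S(1)])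
  have s2: "s f g h \<in> forms C 2" if "f \<in> C" "g \<in> C" "h \<in> C" for f g h
    unfolding s_eq using S(2)[OF ex[OF that]] by (blast intro: forms_scaleR)
  have Ds: "koszul_pos (s f g h) = (1 / 2) *\<^sub>R J f g h" if "f \<in> C" "g \<in> C" "h \<in> C" for f g h
  proof -
    have "koszul_pos (s f g h) = \<delta> (s f g h)" using s2[OF that] by (intro koszul_pos_Suc[of _ 0]) (simp add: numeral_2_eq_2)
    also have "\<dots> = (1 / 2) *\<^sub>R \<delta> (S (J f g h)) + 0 *\<^sub>R \<delta> (S (J f g h))"
      using kz[of "S (J f g h)" 2 "S (J f g h)" "1 / 2" 0] S(2)[OF ex[OF that]] by (simp add: s_eq del: form_ops)
    also have "\<delta> (S (J f g h)) = J f g h" using S(2)[OF ex[OF that]] by blast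
    finally show ?thesis by (simp del: form_ops)
  qed
  have koszul_fun\<beta>: "koszul_fun ((1 / 2) *\<^sub>R \<beta> f g) = br f g" if "f \<in> C" "g \<in> C" for f g
    using koszul_fun_lin[OF forms_koszul_domain[OF \<beta>_forms[OF that]] forms_koszul_domain[OF \<beta>_forms[OF that]], of "1 / 2" 0] koszul_fun_\<beta>[OF that]
    by (simp del: form_ops)
  have "lie_two_data (form_grading C) koszul_pos C koszul_fun (\<lambda>f g. (1 / 2) *\<^sub>R \<beta> f g) s"
  proof
    show "graded_space (form_grading C)" by (rule graded_space_forms)
    show "subspace C" by (rule subspace_C)
    note g = subsetD[OF total_koszul_domain]
    show "koszul_pos (p *\<^sub>R x + q *\<^sub>R y) = p *\<^sub>R koszul_pos x + q *\<^sub>R koszul_pos y" "koszul_fun (p *\<^sub>R x + q *\<^sub>R y) = p *\<^sub>R koszul_fun x + q *\<^sub>R koszul_fun y"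
      if "x \<in> total_space (form_grading C)" "y \<in> total_space (form_grading C)" for x y p q
      using koszul_pos_lin[OF g[OF that(1)] g[OF that(2)]] koszul_fun_lin[OF g[OF that(1)] g[OF that(2)]] by blast+
    show "koszul_fun x \<in> C" if "x \<in> total_space (form_grading C)" for x by (rule koszul_fun_in[OF that])
    show "koszul_pos x \<in> form_grading C (e + 1)" if "x \<in> form_grading C e" for x e
      using that
    proof (cases rule: grading_cases)
      case 1 then show ?thesis using subspace_0[OF form_grading_subspace] by (simp add: koszul_pos_0)
    next
      case 2 then show ?thesis using subspace_0[OF form_grading_subspace] by (simp add: koszul_pos_1)
    next
      case (3 k)
      then have "e + 1 = - int k" by simp
      then show ?thesis using koszul_forms[OF 3(2)] by (simp only: koszul_pos_Suc[OF 3(2)] grading_neg)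
    qed
    have DD: "koszul_pos (koszul_pos x) = 0 \<and> koszul_fun (koszul_pos x) = 0" if "x \<in> form_grading C e" for x e
      using that
    proof (cases rule: grading_cases)
      case 1 then show ?thesis by (simp add: koszul_pos_0 koszul_fun_0 del: form_ops)
    next
      case 2 then show ?thesis by (simp add: koszul_pos_1 koszul_pos_0 koszul_fun_0 del: form_ops)
    next
      case (3 k)
      have "\<delta> (\<delta> x) = 0" by (rule koszul_koszul[OF 3(2)])
      then show ?thesis unfolding koszul_pos_Suc[OF 3(2)] by (auto simp: koszul_pos_def koszul_fun_def zero_fun_def[where 'b="'a \<Rightarrow> real"])
    qed
    show "koszul_pos (koszul_pos x) = 0" "koszul_fun (koszul_pos x) = 0" if "x \<in> form_grading C e" for x e using DD[OF that] by blast+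
    show "koszul_fun x = 0" if "x \<in> form_grading C e" "e \<noteq> 0" for x e
      using that(1) by (cases rule: grading_cases) (use that(2) in \<open>auto simp: koszul_fun_0 koszul_fun_Suc\<close>)
    fix f g assume fg: "f \<in> C" "g \<in> C"
    have half: "(1 / 2) *\<^sub>R \<beta> f g \<in> forms C 1" by (rule forms_scaleR[OF \<beta>_forms[OF fg]])
    then show "(1 / 2) *\<^sub>R \<beta> f g \<in> form_grading C 0" by (simp add: form_grading_def One_nat_def)
    show "(1 / 2) *\<^sub>R \<beta> g f = - ((1 / 2) *\<^sub>R \<beta> f g)" unfolding \<beta>_anti[of g f] by (simp del: form_ops)
    show "koszul_pos ((1 / 2) *\<^sub>R \<beta> f g) = 0" by (rule koszul_pos_1[OF half])
    fix h assume h: "h \<in> C"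
    show "(1 / 2) *\<^sub>R \<beta> (p *\<^sub>R f + q *\<^sub>R g) h = p *\<^sub>R (1 / 2) *\<^sub>R \<beta> f h + q *\<^sub>R (1 / 2) *\<^sub>R \<beta> g h" for p q
      by (simp add: \<beta>_lin[OF fg h] scaleR_add_right del: form_ops)
    show "s f g h \<in> form_grading C (- 1)" using s2[OF fg h] grading_neg[of 1] by (simp add: numeral_2_eq_2 One_nat_def)
    show "s g f h = - s f g h" "s f h g = - s f g h"
      unfolding s_eq J_anti[OF fg h] linear_neg[OF S(1)] by (simp_all del: form_ops)
    show "(1 / 2) *\<^sub>R \<beta> (koszul_fun ((1 / 2) *\<^sub>R \<beta> f g)) h - (1 / 2) *\<^sub>R \<beta> (koszul_fun ((1 / 2) *\<^sub>R \<beta> f h)) g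
        + (1 / 2) *\<^sub>R \<beta> (koszul_fun ((1 / 2) *\<^sub>R \<beta> g h)) f + koszul_pos (s f g h) = 0"
    proof -
      have "\<beta> (br f h) g = \<beta> g (br h f)"
        using \<beta>_anti[of g "br f h"] bracket_anti[OF h fg(1)] \<beta>_neg2[OF fg(2) bracket_in[OF fg(1) h]] by (simp del: form_ops)
      moreover have "\<beta> (br f g) h = - \<beta> h (br f g)" "\<beta> (br g h) f = - \<beta> f (br g h)" by (rule \<beta>_anti)+
      ultimately show ?thesis
        unfolding koszul_fun\<beta>[OF fg] koszul_fun\<beta>[OF fg(1) h] koszul_fun\<beta>[OF fg(2) h] Ds[OF fg h]
        by (simp add: J_def scaleR_add_right del: form_ops)
    qed
    fix k assume k: "k \<in> C"
    show "s (p *\<^sub>R f + q *\<^sub>R g) h k = p *\<^sub>R s f h k + q *\<^sub>R s g h k" for p q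
      unfolding s_eq J_lin[OF fg h k] linear_add[OF S(1)] linear_scale[OF S(1)]
      by (simp add: scaleR_add_right del: form_ops)
    have "S (J (br f g) h k - J (br f h) g k + J (br f k) g h + J (br g h) f k - J (br g k) f h + J (br h k) f g) = 0"
      unfolding J_cocycle[OF fg h k] by (rule linear_0[OF S(1)])
    then have "(1 / 2) *\<^sub>R (S (J (br f g) h k) - S (J (br f h) g k) + S (J (br f k) g h) + S (J (br g h) f k) - S (J (br g k) f h) + S (J (br h k) f g)) = 0"
      by (simp only: linear_add[OF S(1)] linear_diff[OF S(1)] scaleR_zero_right)
    then show "s (koszul_fun ((1 / 2) *\<^sub>R \<beta> f g)) h k - s (koszul_fun ((1 / 2) *\<^sub>R \<beta> f h)) g k + s (koszul_fun ((1 / 2) *\<^sub>R \<beta> f k)) g h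
        + s (koszul_fun ((1 / 2) *\<^sub>R \<beta> g h)) f k - s (koszul_fun ((1 / 2) *\<^sub>R \<beta> g k)) f h + s (koszul_fun ((1 / 2) *\<^sub>R \<beta> h k)) f g = 0"
      unfolding koszul_fun\<beta>[OF fg] koszul_fun\<beta>[OF fg(1) h] koszul_fun\<beta>[OF fg(2) h] koszul_fun\<beta>[OF fg(1) k] koszul_fun\<beta>[OF fg(2) k] koszul_fun\<beta>[OF h k] s_eq
      by (simp only: scaleR_add_right scaleR_diff_right)
  qed
  then show ?thesis by (rule that)
qed

end

theorem proposition5p2:
  fixes n :: nat
    and \<A> :: "'a::{t2_space, second_countable_topology} atlas"
    and \<pi> :: "'a form \<Rightarrow> 'a form \<Rightarrow> 'a \<Rightarrow> real"
  assumes "poisson_manifold n \<A> \<pi>"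
    and "let C = smooth_functions n \<A>; br = poisson_bracket C \<pi>;
             d = (\<lambda>f. ext_deriv C (of_fun f)) in
      \<forall>f\<in>C. \<forall>g\<in>C. \<forall>h\<in>C.
        (fscale f (d (br g h)) - fscale (br g h) (d f)) +
        (fscale g (d (br h f)) - fscale (br h f) (d g)) +
        (fscale h (d (br f g)) - fscale (br f g) (d h))
        \<in> koszul_diff C \<pi> ` forms C 2"
  shows "let C = smooth_functions n \<A>; L = form_grading C; \<delta> = koszul_diff C \<pi>;
             is_solution = (\<lambda>l. L_infinity_algebra L l \<and>
               (\<forall>k\<ge>2. \<forall>\<omega>\<in>forms C k. l 1 [\<omega>] = \<delta> \<omega>) \<and>
               (\<forall>\<alpha>\<in>forms C 1. l 1 [\<alpha>] = 0) \<and>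
               (\<forall>\<alpha>\<in>forms C 1. \<forall>\<beta>\<in>forms C 1. l 2 [\<alpha>, \<beta>] =
                 (1 / 2) *\<^sub>R (fscale (\<delta> \<alpha> []) (ext_deriv C (\<delta> \<beta>)) -
                             fscale (\<delta> \<beta> []) (ext_deriv C (\<delta> \<alpha>))))) in
      (\<exists>l. is_solution l) \<and>
      (\<exists>l. is_solution l \<and> (\<forall>k>3. \<forall>xs. length xs = k \<longrightarrow> set xs \<subseteq> total_space L \<longrightarrow> l k xs = 0))"
proof -
  define C where "C = smooth_functions n \<A>"
  have "smooth_manifold n \<A>" using assms(1) by (simp add: poisson_manifold_def)
  then interpret framed_function_algebra C unfolding C_def by (rule framed_function_algebra_smooth)
  interpret poisson_algebra C \<pi>
    by unfold_locales (use assms(1) in \<open>auto simp: poisson_manifold_def Let_def C_def\<close>)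
  have "J f g h \<in> \<delta> ` forms C 2" if "f \<in> C" "g \<in> C" "h \<in> C" for f g h
    using assms(2) that unfolding Let_def C_def[symmetric] J_def \<beta>_def by blast
  then obtain s where "lie_two_data (form_grading C) koszul_pos C koszul_fun (\<lambda>f g. (1 / 2) *\<^sub>R \<beta> f g) s"
    by (rule lie_two_algebra) blast
  then interpret S: lie_two_data "form_grading C" koszul_pos C koszul_fun "\<lambda>f g. (1 / 2) *\<^sub>R \<beta> f g" s .
  have "S.l 1 [\<omega>] = \<delta> \<omega>" if "k \<ge> 2" "\<omega> \<in> forms C k" for k \<omega>
  proof -
    have "k = Suc (Suc (k - 2))" using that(1) by simp
    then have "koszul_pos \<omega> = \<delta> \<omega>" using koszul_pos_Suc[of \<omega> "k - 2"] that(2) by simp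
    then show ?thesis by (simp add: S.l_simps)
  qed
  moreover have "S.l 1 [\<alpha>] = 0" if "\<alpha> \<in> forms C 1" for \<alpha>
    using koszul_pos_1[OF that] by (simp add: S.l_simps)
  moreover have "S.l 2 [\<alpha>, \<beta>'] = (1 / 2) *\<^sub>R (fscale (\<delta> \<alpha> []) (d (\<delta> \<beta>')) - fscale (\<delta> \<beta>' []) (d (\<delta> \<alpha>)))"
    if "\<alpha> \<in> forms C 1" "\<beta>' \<in> forms C 1" for \<alpha> \<beta>'
  proof -
    have "d (\<delta> \<alpha>) = dfun (koszul_fun \<alpha>)" "d (\<delta> \<beta>') = dfun (koszul_fun \<beta>')"
      using forms_0_of_fun[OF koszul_forms] that unfolding koszul_fun_def by (metis One_nat_def)+
    moreover have "S.l 2 [\<alpha>, \<beta>'] = (1 / 2) *\<^sub>R \<beta> (koszul_fun \<alpha>) (koszul_fun \<beta>')" by (simp add: S.l_simps)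
    ultimately show ?thesis by (simp only: \<beta>_def koszul_fun_def)
  qed
  moreover have "S.l k xs = 0" if "k > 3" for k xs using that by (rule S.l_simps)
  ultimately show ?thesis
    using S.L_infinity unfolding Let_def C_def[symmetric] by blast
qed

end
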